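(* Let $n\ge1$ and let $(\mathscr C,\mathcal X)$ be an $n$-exact category in the sense of Jasso such that $\mathbb E(C,A)$ (the class of homotopy equivalence classes in $\mathbf C^{n+2}_{(A,C)}$ of members of $\mathcal X$ with end terms $A$ and $C$) is a set for all $A,C\in\mathscr C$. Regard $\mathbb E$ as the biadditive functor $\mathscr C^{op}\times\mathscr C\to Ab$ described in the context, and for $\delta\in\mathbb E(C,A)$ set $\mathfrak s(\delta)=[X^\bullet]$ where $\delta=[X^\bullet]$. Then $(\mathscr C,\mathbb E,\mathfrak s)$ is an $n$-exangulated category.
   Context: **Complexes.** For an additive category $\mathscr C$ and $n\ge1$, $\mathbf C^{n+2}_{\mathscr C}$ is the category of complexes $X^\bullet=(X^0\xrightarrow{d_X^0}\cdots\xrightarrow{d_X^n}X^{n+1})$ concentrated in degrees $0,\dots,n+1$, with usual chain homotopy. $\mathbf C^{n+2}_{(A,C)}$ has as objects the complexes with $X^0=A$, $X^{n+1}=C$ and as morphisms the chain maps with $f^0=1_A$, $f^{n+1}=1_C$; homotopy is the same relation, homotopy equivalences are taken within this category, and $[X^\bullet]$ is the homotopy equivalence class in it. Cones: for $f^\bullet:X^\bullet\to Y^\bullet$ with $f^0=1$, $M_f^\bullet$ is $X^1\to X^2\oplus Y^1\to\cdots\to X^{n+1}\oplus Y^n\to Y^{n+1}$ with $d^0=\begin{bmatrix}-d_X^1\\ f^1\end{bmatrix}$, $d^i=\begin{bmatrix}-d_X^{i+1}&0\\ f^{i+1}&d_Y^i\end{bmatrix}$ ($1\le i\le n-1$), $d^n=[f^{n+1}\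 d_Y^n]$. Dually for $h^\bullet$ with $h^{n+1}=1$, the mapping cocone is $X^0\to X^1\oplus Y^0\to\cdots\to X^n\oplus Y^{n-1}\to Y^n$ with $\begin{bmatrix}d_X^0\\ h^0\end{bmatrix}$, $\begin{bmatrix}d_X^i&0\\ h^i&-d_Y^{i-1}\end{bmatrix}$, $[h^n\ -d_Y^{n-1}]$. **$n$-exact categories (Jasso).** $X^\bullet\in\mathbf C^{n+2}_{\mathscr C}$ is an $n$-kernel sequence if $0\to\mathscr C(-,X^0)\to\cdots\to\mathscr C(-,X^{n+1})$ is exact, an $n$-cokernel sequence if $0\to\mathscr C(X^{n+1},-)\to\cdots\to\mathscr C(X^0,-)$ is exact, and $n$-exact if both. A commutative diagram with rows $X^1\to\cdots\to X^{n+1}$ and $Y^1\to\cdots\to Y^{n+1}$ and vertical maps $f^i:X^i\to Y^i$ is an $n$-pullback diagram if the sequence $X^1\to X^2\oplus Y^1\to\cdots\to X^{n+1}\oplus Y^n\to Y^{n+1}$, with the same matrices as in the mapping cone, is an $n$-kernel sequence; an $n$-pushout diagram, with rows $X^0\to\cdots\to X^n$, $Y^0\to\cdots\to Y^n$, is defined dually (the cocone-type sequence $X^0\to X^1\oplus Y^0\to\cdots\to Y^n$ is an $n$-cokernel sequence). Let $\mathcal X$ be a class of $n$-exact sequences. A morphism is an $\mathcal X$-admissible monomorphism (epimorphism) if it is $d_X^0$ (resp. $d_X^n$) of some $X^\bullet\in\mathcal X$. $(\mathscr C,\mathcal X)$ is $n$-exact if: (EC) for a chain map $f^\bullet:X^\bullet\to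 Y^\bullet$ between $n$-exact sequences: if $f^k,f^{k+1}$ are isomorphisms for some $0\le k\le n$, or if $f^0,f^{n+1}$ are isomorphisms, then $X^\bullet\in\mathcal X\iff Y^\bullet\in\mathcal X$; (E0) $0\to\cdots\to0$ is in $\mathcal X$; (E1), (E1$^{op}$) $\mathcal X$-admissible monomorphisms (resp. epimorphisms) are closed under composition; (E2) for $X^\bullet\in\mathcal X$ and $f^0:X^0\to Y^0$ there is an $n$-pushout diagram from $X^0\to\cdots\to X^n$ to some $Y^0\to\cdots\to Y^n$ extending $f^0$, with $d_Y^0$ an $\mathcal X$-admissible monomorphism; (E2$^{op}$) for $Y^\bullet\in\mathcal X$ and $f^{n+1}:X^{n+1}\to Y^{n+1}$ there is an $n$-pullback diagram from some $X^1\to\cdots\to X^{n+1}$ to $Y^1\to\cdots\to Y^{n+1}$ extending $f^{n+1}$, with $d_X^n$ an $\mathcal X$-admissible epimorphism. **The functor $\mathbb E$.** $\mathbb E(C,A)=\{[X^\bullet]: X^\bullet\in\mathcal X, X^0=A, X^{n+1}=C\}$. For $c:C'\to C$ and $[Y^\bullet]\in\mathbb E(C,A)$, $c^*[Y^\bullet]=[X^\bullet]$ where $X^\bullet$ is an $n$-exact sequence in $\mathbf C^{n+2}_{(A,C')}$ with a chain map $f^\bullet:X^\bullet\to Y^\bullet$, $f^0=1_A$, $f^{n+1}=c$, such that the part of $f^\bullet$ in degrees $1,\dots,n+1$ is an $n$-pullback diagram; this always exists with $X^\bullet\in\mathcal X$ and its class is unique. (Equivalently, $X^\bullet\in\mathcal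 X$ admits a chain map to $Y^\bullet$ with $f^0=1_A$, $f^{n+1}=c$.) Dually $a_*[X^\bullet]$ for $a:A\to A'$, via $n$-pushouts. $\mathbb E(c,a)=a_*c^*=c^*a_*$. The sum on $\mathbb E(C,A)$ is the Baer sum $[X^\bullet]+[Y^\bullet]=(\Delta_C)^*(\nabla_A)_*[X^\bullet\oplus Y^\bullet]$, with $\Delta_C:C\to C\oplus C$ the diagonal and $\nabla_A:A\oplus A\to A$ the codiagonal ($\mathcal X$ is closed under direct sums). This makes $\mathbb E$ a biadditive functor $\mathscr C^{op}\times\mathscr C\to Ab$. **$n$-exangulated categories.** Let $\mathbb E:\mathscr C^{op}\times\mathscr C\to Ab$ be biadditive. Put $a_*\delta=\mathbb E(C,a)(\delta)$, $c^*\delta=\mathbb E(c,A)(\delta)$ for $\delta\in\mathbb E(C,A)$. For $\delta\in\mathbb E(C,A)$, $\rho\in\mathbb E(D,B)$ a morphism $(a,c):\delta\to\rho$ is a pair $a:A\to B$, $c:C\to D$ with $a_*\delta=c^*\rho$. Put $\delta_\sharp:\mathscr C(-,C)\to\mathbb E(-,A)$, $f\mapsto f^*\delta$, $\delta^\sharp:\mathscr C(A,-)\to\mathbb E(C,-)$, $g\mapsto g_*\delta$. A pair $\langle X^\bullet,\delta\rangle$, $\delta\in\mathbb E(X^{n+1},X^0)$, is an $n$-exangle if $\mathscr C(-,X^0)\to\cdots\to\mathscr C(-,X^{n+1})\xrightarrow{\delta_\sharp}\mathbb E(-,X^0)$ and $\mathscr C(X^{n+1},-)\to\cdots\to\mathscr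 C(X^0,-)\xrightarrow{\delta^\sharp}\mathbb E(X^{n+1},-)$ are exact (at all inner terms). An exact realization $\mathfrak s$ assigns to each $\delta\in\mathbb E(C,A)$ a class $\mathfrak s(\delta)=[X^\bullet]$ of an object of $\mathbf C^{n+2}_{(A,C)}$ such that: (R0) if $\mathfrak s(\delta)=[X^\bullet]$, $\mathfrak s(\rho)=[Y^\bullet]$, every morphism $(a,c):\delta\to\rho$ has a lift, i.e. a chain map $f^\bullet:X^\bullet\to Y^\bullet$ with $f^0=a$, $f^{n+1}=c$; (R1) $\mathfrak s(\delta)=[X^\bullet]$ implies $\langle X^\bullet,\delta\rangle$ is an $n$-exangle; (R2) $0\in\mathbb E(0,A)$ has $\mathfrak s(0)=[A\xrightarrow{1}A\to0\to\cdots\to0]$ and $0\in\mathbb E(A,0)$ has $\mathfrak s(0)=[0\to\cdots\to0\to A\xrightarrow{1}A]$. If $\mathfrak s(\delta)=[X^\bullet]$, $\langle X^\bullet,\delta\rangle$ is distinguished, $d_X^0$ an inflation, $d_X^n$ a deflation. $(\mathscr C,\mathbb E,\mathfrak s)$ is $n$-exangulated if $\mathfrak s$ is an exact realization and: (EA1) inflations are closed under composition, and so are deflations; (EA2) for $\rho\in\mathbb E(D,A)$, $c:C\to D$ and distinguished $\langle X^\bullet,c^*\rho\rangle$, $\langle Y^\bullet,\rho\rangle$, $(1_A,c)$ has a lift $f^\bullet$ such that $\langle M_f^\bullet,(d_X^0)_*\rho\rangle$ is distinguished; (EA2$^{op}$) for $\delta\in\mathbb E(C,A)$, $a:A\to B$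 and distinguished $\langle X^\bullet,\delta\rangle$, $\langle Y^\bullet,a_*\delta\rangle$, $(a,1_C)$ has a lift whose mapping cocone with extension $(d_Y^n)^*\delta$ is distinguished. *)

theory Defs
  imports "HOL-Algebra.Coset"
begin

section \<open>Additive categories\<close>

text \<open>
  A preadditive category is given by its set of objects, its Hom groups, composition and
  identities. The Hom groups are records of HOL-Algebra, so their addition is written
  multiplicatively: \<open>\<otimes>\<close> is the sum of morphisms, \<open>\<one>\<close> the zero morphism and \<open>inv\<close> the negative.
  As usual, Hom sets of different pairs of objects are disjoint.
\<close>

record ('o, 'm) precat =
  Obj :: "'o set"
  Hom :: "'o \<Rightarrow> 'o \<Rightarrow> 'm monoid"
  Comp :: "'m \<Rightarrow> 'm \<Rightarrow> 'm" (infixl "\<cdot>\<index>" 75)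
  Idt :: "'o \<Rightarrow> 'm"

abbreviation Mor :: "('o, 'm) precat \<Rightarrow> 'o \<Rightarrow> 'o \<Rightarrow> 'm set" where
  "Mor \<C> A B \<equiv> carrier (Hom \<C> A B)"

abbreviation zero_mor :: "('o, 'm) precat \<Rightarrow> 'o \<Rightarrow> 'o \<Rightarrow> 'm" where
  "zero_mor \<C> A B \<equiv> \<one>\<^bsub>Hom \<C> A B\<^esub>"

abbreviation neg_mor :: "('o, 'm) precat \<Rightarrow> 'o \<Rightarrow> 'o \<Rightarrow> 'm \<Rightarrow> 'm" where
  "neg_mor \<C> A B f \<equiv> inv\<^bsub>Hom \<C> A B\<^esub> f"

definition is_zero_object :: "('o, 'm) precat \<Rightarrow> 'o \<Rightarrow> bool" where
  "is_zero_object \<C> Z \<longleftrightarrow> Z \<in> Obj \<C> \<and>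
     (\<forall>A\<in>Obj \<C>. (\<exists>!f. f \<in> Mor \<C> A Z) \<and> (\<exists>!f. f \<in> Mor \<C> Z A))"

definition is_biproduct ::
  "('o, 'm) precat \<Rightarrow> 'o \<Rightarrow> 'o \<Rightarrow> 'o \<Rightarrow> 'm \<Rightarrow> 'm \<Rightarrow> 'm \<Rightarrow> 'm \<Rightarrow> bool" where
  "is_biproduct \<C> A B S i1 i2 p1 p2 \<longleftrightarrow>
     S \<in> Obj \<C> \<and> i1 \<in> Mor \<C> A S \<and> i2 \<in> Mor \<C> B S \<and> p1 \<in> Mor \<C> S A \<and> p2 \<in> Mor \<C> S B \<and>
     p1 \<cdot>\<^bsub>\<C>\<^esub> i1 = Idt \<C> A \<and> p2 \<cdot>\<^bsub>\<C>\<^esub> i2 = Idt \<C> B \<and>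
     p1 \<cdot>\<^bsub>\<C>\<^esub> i2 = zero_mor \<C> B A \<and> p2 \<cdot>\<^bsub>\<C>\<^esub> i1 = zero_mor \<C> A B \<and>
     (i1 \<cdot>\<^bsub>\<C>\<^esub> p1) \<otimes>\<^bsub>Hom \<C> S S\<^esub> (i2 \<cdot>\<^bsub>\<C>\<^esub> p2) = Idt \<C> S"

locale additive_category =
  fixes \<C> :: "('o, 'm) precat" (structure)
  assumes Hom_comm_group: "\<lbrakk>A \<in> Obj \<C>; B \<in> Obj \<C>\<rbrakk> \<Longrightarrow> comm_group (Hom \<C> A B)"
    and Hom_disjoint:
      "\<lbrakk>A \<in> Obj \<C>; B \<in> Obj \<C>; A' \<in> Obj \<C>; B' \<in> Obj \<C>; f \<in> Mor \<C> A B; f \<in> Mor \<C> A' B'\<rbrakk>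
        \<Longrightarrow> A = A' \<and> B = B'"
    and Idt_closed: "A \<in> Obj \<C> \<Longrightarrow> Idt \<C> A \<in> Mor \<C> A A"
    and Comp_closed:
      "\<lbrakk>A \<in> Obj \<C>; B \<in> Obj \<C>; D \<in> Obj \<C>; f \<in> Mor \<C> A B; g \<in> Mor \<C> B D\<rbrakk>
        \<Longrightarrow> g \<cdot> f \<in> Mor \<C> A D"
    and Comp_Idt: "\<lbrakk>A \<in> Obj \<C>; B \<in> Obj \<C>; f \<in> Mor \<C> A B\<rbrakk> \<Longrightarrow> f \<cdot> Idt \<C> A = f"
    and Idt_Comp: "\<lbrakk>A \<in> Obj \<C>; B \<in> Obj \<C>; f \<in> Mor \<C> A B\<rbrakk> \<Longrightarrow> Idt \<C> B \<cdot> f = f"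
    and Comp_assoc:
      "\<lbrakk>A \<in> Obj \<C>; B \<in> Obj \<C>; D \<in> Obj \<C>; F \<in> Obj \<C>;
        f \<in> Mor \<C> A B; g \<in> Mor \<C> B D; h \<in> Mor \<C> D F\<rbrakk> \<Longrightarrow> h \<cdot> g \<cdot> f = h \<cdot> (g \<cdot> f)"
    and Comp_add_left:
      "\<lbrakk>A \<in> Obj \<C>; B \<in> Obj \<C>; D \<in> Obj \<C>; f \<in> Mor \<C> A B; g \<in> Mor \<C> B D; g' \<in> Mor \<C> B D\<rbrakk>
        \<Longrightarrow> (g \<otimes>\<^bsub>Hom \<C> B D\<^esub> g') \<cdot> f = (g \<cdot> f) \<otimes>\<^bsub>Hom \<C> A D\<^esub> (g' \<cdot> f)"
    and Comp_add_right:
      "\<lbrakk>A \<in> Obj \<C>; B \<in> Obj \<C>; D \<in> Obj \<C>; f \<in> Mor \<C> A B; f' \<in> Mor \<C> A B; g \<in> Mor \<C> B D\<rbrakk>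
        \<Longrightarrow> g \<cdot> (f \<otimes>\<^bsub>Hom \<C> A B\<^esub> f') = (g \<cdot> f) \<otimes>\<^bsub>Hom \<C> A D\<^esub> (g \<cdot> f')"
    and zero_object_exists: "\<exists>Z. is_zero_object \<C> Z"
    and biproduct_exists:
      "\<lbrakk>A \<in> Obj \<C>; B \<in> Obj \<C>\<rbrakk> \<Longrightarrow> \<exists>S i1 i2 p1 p2. is_biproduct \<C> A B S i1 i2 p1 p2"

definition is_iso :: "('o, 'm) precat \<Rightarrow> 'o \<Rightarrow> 'o \<Rightarrow> 'm \<Rightarrow> bool" where
  "is_iso \<C> A B f \<longleftrightarrow> f \<in> Mor \<C> A B \<and>
     (\<exists>g\<in>Mor \<C> B A. g \<cdot>\<^bsub>\<C>\<^esub> f = Idt \<C> A \<and> f \<cdot>\<^bsub>\<C>\<^esub> g = Idt \<C> B)"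

text \<open>
  A direct sum of two objects is fixed by choice. Nothing below depends on this choice, since
  complexes only matter up to homotopy equivalence with fixed end terms.
\<close>

definition biprod :: "('o, 'm) precat \<Rightarrow> 'o \<Rightarrow> 'o \<Rightarrow> 'o \<times> 'm \<times> 'm \<times> 'm \<times> 'm" where
  "biprod \<C> A B = (SOME (S, i1, i2, p1, p2). is_biproduct \<C> A B S i1 i2 p1 p2)"

definition dsum :: "('o, 'm) precat \<Rightarrow> 'o \<Rightarrow> 'o \<Rightarrow> 'o" where
  "dsum \<C> A B = (case biprod \<C> A B of (S, i1, i2, p1, p2) \<Rightarrow> S)"

definition inj1 :: "('o, 'm) precat \<Rightarrow> 'o \<Rightarrow> 'o \<Rightarrow> 'm" where
  "inj1 \<C> A B = (case biprod \<C> A B of (S, i1, i2, p1, p2) \<Rightarrow> i1)"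

definition inj2 :: "('o, 'm) precat \<Rightarrow> 'o \<Rightarrow> 'o \<Rightarrow> 'm" where
  "inj2 \<C> A B = (case biprod \<C> A B of (S, i1, i2, p1, p2) \<Rightarrow> i2)"

definition prj1 :: "('o, 'm) precat \<Rightarrow> 'o \<Rightarrow> 'o \<Rightarrow> 'm" where
  "prj1 \<C> A B = (case biprod \<C> A B of (S, i1, i2, p1, p2) \<Rightarrow> p1)"

definition prj2 :: "('o, 'm) precat \<Rightarrow> 'o \<Rightarrow> 'o \<Rightarrow> 'm" where
  "prj2 \<C> A B = (case biprod \<C> A B of (S, i1, i2, p1, p2) \<Rightarrow> p2)"

text \<open>
  \<open>row_mor \<C> A B W f g\<close> is the matrix \<open>[f g]\<close> from \<open>A \<oplus> B\<close> to \<open>W\<close>, \<open>col_mor \<C> W A B f g\<close> is the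
  column with entries \<open>f\<close>, \<open>g\<close> from \<open>W\<close> to \<open>A \<oplus> B\<close>, and \<open>mat_mor \<C> A B A' B' p q r s\<close> has the
  rows \<open>[p q]\<close> and \<open>[r s]\<close>.
\<close>

definition row_mor :: "('o, 'm) precat \<Rightarrow> 'o \<Rightarrow> 'o \<Rightarrow> 'o \<Rightarrow> 'm \<Rightarrow> 'm \<Rightarrow> 'm" where
  "row_mor \<C> A B W f g =
     (f \<cdot>\<^bsub>\<C>\<^esub> prj1 \<C> A B) \<otimes>\<^bsub>Hom \<C> (dsum \<C> A B) W\<^esub> (g \<cdot>\<^bsub>\<C>\<^esub> prj2 \<C> A B)"

definition col_mor :: "('o, 'm) precat \<Rightarrow> 'o \<Rightarrow> 'o \<Rightarrow> 'o \<Rightarrow> 'm \<Rightarrow> 'm \<Rightarrow> 'm" where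
  "col_mor \<C> W A B f g =
     (inj1 \<C> A B \<cdot>\<^bsub>\<C>\<^esub> f) \<otimes>\<^bsub>Hom \<C> W (dsum \<C> A B)\<^esub> (inj2 \<C> A B \<cdot>\<^bsub>\<C>\<^esub> g)"

definition mat_mor ::
  "('o, 'm) precat \<Rightarrow> 'o \<Rightarrow> 'o \<Rightarrow> 'o \<Rightarrow> 'o \<Rightarrow> 'm \<Rightarrow> 'm \<Rightarrow> 'm \<Rightarrow> 'm \<Rightarrow> 'm" where
  "mat_mor \<C> A B A' B' p q r s =
     col_mor \<C> (dsum \<C> A B) A' B' (row_mor \<C> A B A' p q) (row_mor \<C> A B B' r s)"

definition diag_mor :: "('o, 'm) precat \<Rightarrow> 'o \<Rightarrow> 'm" where
  "diag_mor \<C> A = col_mor \<C> A A A (Idt \<C> A) (Idt \<C> A)"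

definition codiag_mor :: "('o, 'm) precat \<Rightarrow> 'o \<Rightarrow> 'm" where
  "codiag_mor \<C> A = row_mor \<C> A A A (Idt \<C> A) (Idt \<C> A)"


section \<open>Complexes in degrees 0 to n + 1\<close>

text \<open>
  \<open>ob X i\<close> is the term in degree \<open>i\<close> and \<open>df X i\<close> the differential from degree \<open>i\<close> to degree
  \<open>i + 1\<close>. Values outside the degrees in question are irrelevant and never inspected; in
  particular the same record type also holds the truncated rows of \<open>n\<close>-pullback and \<open>n\<close>-pushout
  diagrams.
\<close>

record ('o, 'm) cpx =
  ob :: "nat \<Rightarrow> 'o"
  df :: "nat \<Rightarrow> 'm"

definition complexes :: "nat \<Rightarrow> ('o, 'm) precat \<Rightarrow> ('o, 'm) cpx set" where
  "complexes n \<C> = {X. (\<forall>i\<le>n+1. ob X i \<in> Obj \<C>) \<and>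
     (\<forall>i\<le>n. df X i \<in> Mor \<C> (ob X i) (ob X (i+1))) \<and>
     (\<forall>i<n. df X (i+1) \<cdot>\<^bsub>\<C>\<^esub> df X i = zero_mor \<C> (ob X i) (ob X (i+2)))}"

definition complexes_betw :: "nat \<Rightarrow> ('o, 'm) precat \<Rightarrow> 'o \<Rightarrow> 'o \<Rightarrow> ('o, 'm) cpx set" where
  "complexes_betw n \<C> A C = {X \<in> complexes n \<C>. ob X 0 = A \<and> ob X (n+1) = C}"

definition chain_map ::
  "nat \<Rightarrow> ('o, 'm) precat \<Rightarrow> ('o, 'm) cpx \<Rightarrow> ('o, 'm) cpx \<Rightarrow> (nat \<Rightarrow> 'm) \<Rightarrow> bool" where
  "chain_map n \<C> X Y f \<longleftrightarrow>
     (\<forall>i\<le>n+1. f i \<in> Mor \<C> (ob X i) (ob Y i)) \<and>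
     (\<forall>i\<le>n. f (i+1) \<cdot>\<^bsub>\<C>\<^esub> df X i = df Y i \<cdot>\<^bsub>\<C>\<^esub> f i)"

text \<open>Below, \<open>\<phi> i\<close> is the component of the homotopy from degree \<open>i + 1\<close> to degree \<open>i\<close>.\<close>

definition homotopic :: "nat \<Rightarrow> ('o, 'm) precat \<Rightarrow> ('o, 'm) cpx \<Rightarrow> ('o, 'm) cpx \<Rightarrow>
    (nat \<Rightarrow> 'm) \<Rightarrow> (nat \<Rightarrow> 'm) \<Rightarrow> bool" where
  "homotopic n \<C> X Y f g \<longleftrightarrow>
     (\<exists>\<phi>. (\<forall>i\<le>n. \<phi> i \<in> Mor \<C> (ob X (i+1)) (ob Y i)) \<and>
        f 0 = g 0 \<otimes>\<^bsub>Hom \<C> (ob X 0) (ob Y 0)\<^esub> (\<phi> 0 \<cdot>\<^bsub>\<C>\<^esub> df X 0) \<and>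
        (\<forall>i<n. f (i+1) = g (i+1) \<otimes>\<^bsub>Hom \<C> (ob X (i+1)) (ob Y (i+1))\<^esub>
           ((df Y i \<cdot>\<^bsub>\<C>\<^esub> \<phi> i) \<otimes>\<^bsub>Hom \<C> (ob X (i+1)) (ob Y (i+1))\<^esub>
            (\<phi> (i+1) \<cdot>\<^bsub>\<C>\<^esub> df X (i+1)))) \<and>
        f (n+1) = g (n+1) \<otimes>\<^bsub>Hom \<C> (ob X (n+1)) (ob Y (n+1))\<^esub> (df Y n \<cdot>\<^bsub>\<C>\<^esub> \<phi> n))"

definition chain_map_betw ::
  "nat \<Rightarrow> ('o, 'm) precat \<Rightarrow> ('o, 'm) cpx \<Rightarrow> ('o, 'm) cpx \<Rightarrow> (nat \<Rightarrow> 'm) \<Rightarrow> bool" where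
  "chain_map_betw n \<C> X Y f \<longleftrightarrow>
     chain_map n \<C> X Y f \<and> f 0 = Idt \<C> (ob X 0) \<and> f (n+1) = Idt \<C> (ob X (n+1))"

definition htpy_equiv_betw ::
  "nat \<Rightarrow> ('o, 'm) precat \<Rightarrow> ('o, 'm) cpx \<Rightarrow> ('o, 'm) cpx \<Rightarrow> bool" where
  "htpy_equiv_betw n \<C> X Y \<longleftrightarrow>
     (\<exists>f g. chain_map_betw n \<C> X Y f \<and> chain_map_betw n \<C> Y X g \<and>
        homotopic n \<C> X X (\<lambda>i. g i \<cdot>\<^bsub>\<C>\<^esub> f i) (\<lambda>i. Idt \<C> (ob X i)) \<and>
        homotopic n \<C> Y Y (\<lambda>i. f i \<cdot>\<^bsub>\<C>\<^esub> g i) (\<lambda>i. Idt \<C> (ob Y i)))"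

text \<open>The homotopy equivalence class \<open>[X]\<close>, taken with both end terms fixed.\<close>

definition hclass :: "nat \<Rightarrow> ('o, 'm) precat \<Rightarrow> ('o, 'm) cpx \<Rightarrow> ('o, 'm) cpx set" where
  "hclass n \<C> X =
     {Y \<in> complexes_betw n \<C> (ob X 0) (ob X (n+1)). htpy_equiv_betw n \<C> X Y}"

definition cpx_dsum ::
  "('o, 'm) precat \<Rightarrow> ('o, 'm) cpx \<Rightarrow> ('o, 'm) cpx \<Rightarrow> ('o, 'm) cpx" where
  "cpx_dsum \<C> X Y = \<lparr>
     ob = (\<lambda>i. dsum \<C> (ob X i) (ob Y i)),
     df = (\<lambda>i. mat_mor \<C> (ob X i) (ob Y i) (ob X (i+1)) (ob Y (i+1))
                (df X i) (zero_mor \<C> (ob Y i) (ob X (i+1)))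
                (zero_mor \<C> (ob X i) (ob Y (i+1))) (df Y i))\<rparr>"

text \<open>
  The cone only uses the part of \<open>X\<close>, \<open>Y\<close>, \<open>f\<close> in degrees \<open>1, \<dots>, n + 1\<close>, the cocone only the
  part in degrees \<open>0, \<dots>, n\<close>. Both are meant for \<open>n \<ge> 1\<close>.
\<close>

definition mcone :: "nat \<Rightarrow> ('o, 'm) precat \<Rightarrow> ('o, 'm) cpx \<Rightarrow> ('o, 'm) cpx \<Rightarrow>
    (nat \<Rightarrow> 'm) \<Rightarrow> ('o, 'm) cpx" where
  "mcone n \<C> X Y f = \<lparr>
     ob = (\<lambda>i. if i = 0 then ob X 1
               else if i \<le> n then dsum \<C> (ob X (i+1)) (ob Y i)
               else ob Y (n+1)),
     df = (\<lambda>i. if i = 0 then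
                 col_mor \<C> (ob X 1) (ob X 2) (ob Y 1)
                   (neg_mor \<C> (ob X 1) (ob X 2) (df X 1)) (f 1)
               else if i < n then
                 mat_mor \<C> (ob X (i+1)) (ob Y i) (ob X (i+2)) (ob Y (i+1))
                   (neg_mor \<C> (ob X (i+1)) (ob X (i+2)) (df X (i+1)))
                   (zero_mor \<C> (ob Y i) (ob X (i+2)))
                   (f (i+1)) (df Y i)
               else
                 row_mor \<C> (ob X (n+1)) (ob Y n) (ob Y (n+1)) (f (n+1)) (df Y n))\<rparr>"

definition mcocone :: "nat \<Rightarrow> ('o, 'm) precat \<Rightarrow> ('o, 'm) cpx \<Rightarrow> ('o, 'm) cpx \<Rightarrow>
    (nat \<Rightarrow> 'm) \<Rightarrow> ('o, 'm) cpx" where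
  "mcocone n \<C> X Y h = \<lparr>
     ob = (\<lambda>i. if i = 0 then ob X 0
               else if i \<le> n then dsum \<C> (ob X i) (ob Y (i-1))
               else ob Y n),
     df = (\<lambda>i. if i = 0 then
                 col_mor \<C> (ob X 0) (ob X 1) (ob Y 0) (df X 0) (h 0)
               else if i < n then
                 mat_mor \<C> (ob X i) (ob Y (i-1)) (ob X (i+1)) (ob Y i)
                   (df X i) (zero_mor \<C> (ob Y (i-1)) (ob X (i+1)))
                   (h i) (neg_mor \<C> (ob Y (i-1)) (ob Y i) (df Y (i-1)))
               else
                 row_mor \<C> (ob X n) (ob Y (n-1)) (ob Y n)
                   (h n) (neg_mor \<C> (ob Y (n-1)) (ob Y n) (df Y (n-1))))\<rparr>"


section \<open>n-exact categories in the sense of Jasso\<close>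

definition exact_at :: "'a monoid \<Rightarrow> 'b monoid \<Rightarrow> 'c monoid \<Rightarrow> ('a \<Rightarrow> 'b) \<Rightarrow> ('b \<Rightarrow> 'c) \<Rightarrow> bool" where
  "exact_at G H K f g \<longleftrightarrow> f ` carrier G = kernel H K g"

definition n_kernel_seq :: "nat \<Rightarrow> ('o, 'm) precat \<Rightarrow> ('o, 'm) cpx \<Rightarrow> bool" where
  "n_kernel_seq n \<C> X \<longleftrightarrow> X \<in> complexes n \<C> \<and>
     (\<forall>W\<in>Obj \<C>. inj_on (\<lambda>f. df X 0 \<cdot>\<^bsub>\<C>\<^esub> f) (Mor \<C> W (ob X 0)) \<and>
        (\<forall>i<n. exact_at (Hom \<C> W (ob X i)) (Hom \<C> W (ob X (i+1))) (Hom \<C> W (ob X (i+2)))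
                 (\<lambda>f. df X i \<cdot>\<^bsub>\<C>\<^esub> f) (\<lambda>f. df X (i+1) \<cdot>\<^bsub>\<C>\<^esub> f)))"

definition n_cokernel_seq :: "nat \<Rightarrow> ('o, 'm) precat \<Rightarrow> ('o, 'm) cpx \<Rightarrow> bool" where
  "n_cokernel_seq n \<C> X \<longleftrightarrow> X \<in> complexes n \<C> \<and>
     (\<forall>W\<in>Obj \<C>. inj_on (\<lambda>f. f \<cdot>\<^bsub>\<C>\<^esub> df X n) (Mor \<C> (ob X (n+1)) W) \<and>
        (\<forall>i<n. exact_at (Hom \<C> (ob X (i+2)) W) (Hom \<C> (ob X (i+1)) W) (Hom \<C> (ob X i) W)
                 (\<lambda>f. f \<cdot>\<^bsub>\<C>\<^esub> df X (i+1)) (\<lambda>f. f \<cdot>\<^bsub>\<C>\<^esub> df X i)))"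

definition n_exact_seq :: "nat \<Rightarrow> ('o, 'm) precat \<Rightarrow> ('o, 'm) cpx \<Rightarrow> bool" where
  "n_exact_seq n \<C> X \<longleftrightarrow> n_kernel_seq n \<C> X \<and> n_cokernel_seq n \<C> X"

definition n_pullback :: "nat \<Rightarrow> ('o, 'm) precat \<Rightarrow> ('o, 'm) cpx \<Rightarrow> ('o, 'm) cpx \<Rightarrow>
    (nat \<Rightarrow> 'm) \<Rightarrow> bool" where
  "n_pullback n \<C> X Y f \<longleftrightarrow>
     (\<forall>i. 1 \<le> i \<and> i \<le> n+1 \<longrightarrow>
        ob X i \<in> Obj \<C> \<and> ob Y i \<in> Obj \<C> \<and> f i \<in> Mor \<C> (ob X i) (ob Y i)) \<and>
     (\<forall>i. 1 \<le> i \<and> i \<le> n \<longrightarrow>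
        df X i \<in> Mor \<C> (ob X i) (ob X (i+1)) \<and> df Y i \<in> Mor \<C> (ob Y i) (ob Y (i+1)) \<and>
        f (i+1) \<cdot>\<^bsub>\<C>\<^esub> df X i = df Y i \<cdot>\<^bsub>\<C>\<^esub> f i) \<and>
     n_kernel_seq n \<C> (mcone n \<C> X Y f)"

definition n_pushout :: "nat \<Rightarrow> ('o, 'm) precat \<Rightarrow> ('o, 'm) cpx \<Rightarrow> ('o, 'm) cpx \<Rightarrow>
    (nat \<Rightarrow> 'm) \<Rightarrow> bool" where
  "n_pushout n \<C> X Y f \<longleftrightarrow>
     (\<forall>i\<le>n. ob X i \<in> Obj \<C> \<and> ob Y i \<in> Obj \<C> \<and> f i \<in> Mor \<C> (ob X i) (ob Y i)) \<and>
     (\<forall>i<n. df X i \<in> Mor \<C> (ob X i) (ob X (i+1)) \<and> df Y i \<in> Mor \<C> (ob Y i) (ob Y (i+1)) \<and>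
        f (i+1) \<cdot>\<^bsub>\<C>\<^esub> df X i = df Y i \<cdot>\<^bsub>\<C>\<^esub> f i) \<and>
     n_cokernel_seq n \<C> (mcocone n \<C> X Y f)"

definition admissible_mono :: "('o, 'm) cpx set \<Rightarrow> 'm \<Rightarrow> bool" where
  "admissible_mono \<X> f \<longleftrightarrow> (\<exists>X\<in>\<X>. f = df X 0)"

definition admissible_epi :: "nat \<Rightarrow> ('o, 'm) cpx set \<Rightarrow> 'm \<Rightarrow> bool" where
  "admissible_epi n \<X> f \<longleftrightarrow> (\<exists>X\<in>\<X>. f = df X n)"

definition zero_cpx :: "('o, 'm) precat \<Rightarrow> 'o \<Rightarrow> ('o, 'm) cpx" where
  "zero_cpx \<C> Z = \<lparr>ob = (\<lambda>i. Z), df = (\<lambda>i. zero_mor \<C> Z Z)\<rparr>"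

locale n_exact_category = additive_category \<C>
  for n :: nat and \<C> :: "('o, 'm) precat" (structure) +
  fixes \<X> :: "('o, 'm) cpx set"
  assumes X_n_exact: "X \<in> \<X> \<Longrightarrow> n_exact_seq n \<C> X"
    and EC: "\<lbrakk>n_exact_seq n \<C> X; n_exact_seq n \<C> Y; chain_map n \<C> X Y h;
        (\<exists>k\<le>n. is_iso \<C> (ob X k) (ob Y k) (h k) \<and>
                 is_iso \<C> (ob X (k+1)) (ob Y (k+1)) (h (k+1))) \<or>
        (is_iso \<C> (ob X 0) (ob Y 0) (h 0) \<and>
         is_iso \<C> (ob X (n+1)) (ob Y (n+1)) (h (n+1)))\<rbrakk> \<Longrightarrow> X \<in> \<X> \<longleftrightarrow> Y \<in> \<X>"
    and E0: "is_zero_object \<C> Z \<Longrightarrow> zero_cpx \<C> Z \<in> \<X>"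
    and E1: "\<lbrakk>A \<in> Obj \<C>; B \<in> Obj \<C>; D \<in> Obj \<C>; f \<in> Mor \<C> A B; g \<in> Mor \<C> B D;
        admissible_mono \<X> f; admissible_mono \<X> g\<rbrakk> \<Longrightarrow> admissible_mono \<X> (g \<cdot> f)"
    and E1_op: "\<lbrakk>A \<in> Obj \<C>; B \<in> Obj \<C>; D \<in> Obj \<C>; f \<in> Mor \<C> A B; g \<in> Mor \<C> B D;
        admissible_epi n \<X> f; admissible_epi n \<X> g\<rbrakk> \<Longrightarrow> admissible_epi n \<X> (g \<cdot> f)"
    and E2: "\<lbrakk>X \<in> \<X>; B \<in> Obj \<C>; a \<in> Mor \<C> (ob X 0) B\<rbrakk> \<Longrightarrow>
        \<exists>Y f. ob Y 0 = B \<and> f 0 = a \<and> n_pushout n \<C> X Y f \<and> admissible_mono \<X> (df Y 0)"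
    and E2_op: "\<lbrakk>Y \<in> \<X>; D \<in> Obj \<C>; c \<in> Mor \<C> D (ob Y (n+1))\<rbrakk> \<Longrightarrow>
        \<exists>X f. ob X (n+1) = D \<and> f (n+1) = c \<and> n_pullback n \<C> X Y f \<and>
          admissible_epi n \<X> (df X n)"


section \<open>The functor E of an n-exact category\<close>

definition Ext_set :: "nat \<Rightarrow> ('o, 'm) precat \<Rightarrow> ('o, 'm) cpx set \<Rightarrow> 'o \<Rightarrow> 'o \<Rightarrow>
    ('o, 'm) cpx set set" where
  "Ext_set n \<C> \<X> C A = {hclass n \<C> X |X. X \<in> \<X> \<and> ob X 0 = A \<and> ob X (n+1) = C}"

text \<open>
  \<open>c\<^sup>*\<delta>\<close> and \<open>a\<^sub>*\<delta>\<close>. The remaining end terms need not be passed as arguments, because a class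
  determines its end terms and a morphism determines its source and target.
\<close>

definition Ext_pull :: "nat \<Rightarrow> ('o, 'm) precat \<Rightarrow> 'm \<Rightarrow> ('o, 'm) cpx set \<Rightarrow> ('o, 'm) cpx set" where
  "Ext_pull n \<C> c \<delta> = (THE \<epsilon>. \<exists>X Y f. Y \<in> \<delta> \<and> n_exact_seq n \<C> X \<and> ob X 0 = ob Y 0 \<and>
     chain_map n \<C> X Y f \<and> f 0 = Idt \<C> (ob Y 0) \<and> f (n+1) = c \<and>
     n_pullback n \<C> X Y f \<and> \<epsilon> = hclass n \<C> X)"

definition Ext_push :: "nat \<Rightarrow> ('o, 'm) precat \<Rightarrow> 'm \<Rightarrow> ('o, 'm) cpx set \<Rightarrow> ('o, 'm) cpx set" where
  "Ext_push n \<C> a \<delta> = (THE \<epsilon>. \<exists>X Y f. X \<in> \<delta> \<and> n_exact_seq n \<C> Y \<and> ob Y (n+1) = ob X (n+1) \<and>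
     chain_map n \<C> X Y f \<and> f 0 = a \<and> f (n+1) = Idt \<C> (ob X (n+1)) \<and>
     n_pushout n \<C> X Y f \<and> \<epsilon> = hclass n \<C> Y)"

definition Ext_map :: "nat \<Rightarrow> ('o, 'm) precat \<Rightarrow> 'm \<Rightarrow> 'm \<Rightarrow> ('o, 'm) cpx set \<Rightarrow> ('o, 'm) cpx set"
  where "Ext_map n \<C> c a \<delta> = Ext_push n \<C> a (Ext_pull n \<C> c \<delta>)"

definition class_dsum ::
  "nat \<Rightarrow> ('o, 'm) precat \<Rightarrow> ('o, 'm) cpx set \<Rightarrow> ('o, 'm) cpx set \<Rightarrow> ('o, 'm) cpx set" where
  "class_dsum n \<C> \<delta> \<epsilon> = (THE \<kappa>. \<exists>X\<in>\<delta>. \<exists>Y\<in>\<epsilon>. \<kappa> = hclass n \<C> (cpx_dsum \<C> X Y))"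

definition baer_sum :: "nat \<Rightarrow> ('o, 'm) precat \<Rightarrow> 'o \<Rightarrow> 'o \<Rightarrow>
    ('o, 'm) cpx set \<Rightarrow> ('o, 'm) cpx set \<Rightarrow> ('o, 'm) cpx set" where
  "baer_sum n \<C> C A \<delta> \<epsilon> =
     Ext_pull n \<C> (diag_mor \<C> C) (Ext_push n \<C> (codiag_mor \<C> A) (class_dsum n \<C> \<delta> \<epsilon>))"

text \<open>The zero of \<open>\<E>(C, A)\<close> is the neutral element of the Baer sum.\<close>

definition Ext_group :: "nat \<Rightarrow> ('o, 'm) precat \<Rightarrow> ('o, 'm) cpx set \<Rightarrow> 'o \<Rightarrow> 'o \<Rightarrow>
    ('o, 'm) cpx set monoid" where
  "Ext_group n \<C> \<X> C A = \<lparr>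
     carrier = Ext_set n \<C> \<X> C A,
     mult = baer_sum n \<C> C A,
     one = (THE e. e \<in> Ext_set n \<C> \<X> C A \<and>
              (\<forall>\<delta>\<in>Ext_set n \<C> \<X> C A.
                 baer_sum n \<C> C A e \<delta> = \<delta> \<and> baer_sum n \<C> C A \<delta> e = \<delta>))\<rparr>"

text \<open>An element \<open>\<delta> = [X]\<close> of \<open>\<E>(C, A)\<close> is itself a homotopy class, so \<open>\<ss>(\<delta>) = [X]\<close> is \<open>\<delta>\<close>.\<close>

definition Ext_real :: "'o \<Rightarrow> 'o \<Rightarrow> ('o, 'm) cpx set \<Rightarrow> ('o, 'm) cpx set" where
  "Ext_real C A \<delta> = \<delta>"


section \<open>n-exangulated categories\<close>

text \<open>
  \<open>\<E> C A\<close> is the group of extensions of \<open>C\<close> by \<open>A\<close>, and \<open>\<E>m c a\<close> is the map \<open>\<E>(c, a)\<close>. Thus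
  \<open>a\<^sub>*\<delta>\<close> is \<open>\<E>m (Idt \<C> C) a \<delta>\<close> and \<open>c\<^sup>*\<delta>\<close> is \<open>\<E>m c (Idt \<C> A) \<delta>\<close>.
\<close>

locale biadditive_functor = additive_category \<C>
  for \<C> :: "('o, 'm) precat" (structure) +
  fixes \<E> :: "'o \<Rightarrow> 'o \<Rightarrow> 'e monoid"
    and \<E>m :: "'m \<Rightarrow> 'm \<Rightarrow> 'e \<Rightarrow> 'e"
  assumes E_comm_group: "\<lbrakk>C \<in> Obj \<C>; A \<in> Obj \<C>\<rbrakk> \<Longrightarrow> comm_group (\<E> C A)"
    and E_hom: "\<lbrakk>C \<in> Obj \<C>; C' \<in> Obj \<C>; A \<in> Obj \<C>; A' \<in> Obj \<C>; c \<in> Mor \<C> C' C; a \<in> Mor \<C> A A'\<rbrakk>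
        \<Longrightarrow> \<E>m c a \<in> hom (\<E> C A) (\<E> C' A')"
    and E_Idt: "\<lbrakk>C \<in> Obj \<C>; A \<in> Obj \<C>; \<delta> \<in> carrier (\<E> C A)\<rbrakk>
        \<Longrightarrow> \<E>m (Idt \<C> C) (Idt \<C> A) \<delta> = \<delta>"
    and E_Comp: "\<lbrakk>C \<in> Obj \<C>; C' \<in> Obj \<C>; C'' \<in> Obj \<C>; A \<in> Obj \<C>; A' \<in> Obj \<C>; A'' \<in> Obj \<C>;
        c \<in> Mor \<C> C' C; c' \<in> Mor \<C> C'' C'; a \<in> Mor \<C> A A'; a' \<in> Mor \<C> A' A'';
        \<delta> \<in> carrier (\<E> C A)\<rbrakk> \<Longrightarrow> \<E>m (c \<cdot> c') (a' \<cdot> a) \<delta> = \<E>m c' a' (\<E>m c a \<delta>)"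
    and E_add_left: "\<lbrakk>C \<in> Obj \<C>; C' \<in> Obj \<C>; A \<in> Obj \<C>; c \<in> Mor \<C> C' C; d \<in> Mor \<C> C' C;
        \<delta> \<in> carrier (\<E> C A)\<rbrakk> \<Longrightarrow>
        \<E>m (c \<otimes>\<^bsub>Hom \<C> C' C\<^esub> d) (Idt \<C> A) \<delta> =
        \<E>m c (Idt \<C> A) \<delta> \<otimes>\<^bsub>\<E> C' A\<^esub> \<E>m d (Idt \<C> A) \<delta>"
    and E_add_right: "\<lbrakk>C \<in> Obj \<C>; A \<in> Obj \<C>; A' \<in> Obj \<C>; a \<in> Mor \<C> A A'; b \<in> Mor \<C> A A';
        \<delta> \<in> carrier (\<E> C A)\<rbrakk> \<Longrightarrow>
        \<E>m (Idt \<C> C) (a \<otimes>\<^bsub>Hom \<C> A A'\<^esub> b) \<delta> =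
        \<E>m (Idt \<C> C) a \<delta> \<otimes>\<^bsub>\<E> C A'\<^esub> \<E>m (Idt \<C> C) b \<delta>"

definition n_exangle :: "nat \<Rightarrow> ('o, 'm) precat \<Rightarrow> ('o \<Rightarrow> 'o \<Rightarrow> 'e monoid) \<Rightarrow>
    ('m \<Rightarrow> 'm \<Rightarrow> 'e \<Rightarrow> 'e) \<Rightarrow> ('o, 'm) cpx \<Rightarrow> 'e \<Rightarrow> bool" where
  "n_exangle n \<C> \<E> \<E>m X \<delta> \<longleftrightarrow>
     X \<in> complexes n \<C> \<and> \<delta> \<in> carrier (\<E> (ob X (n+1)) (ob X 0)) \<and>
     (\<forall>W\<in>Obj \<C>.
        (\<forall>i<n. exact_at (Hom \<C> W (ob X i)) (Hom \<C> W (ob X (i+1))) (Hom \<C> W (ob X (i+2)))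
                 (\<lambda>f. df X i \<cdot>\<^bsub>\<C>\<^esub> f) (\<lambda>f. df X (i+1) \<cdot>\<^bsub>\<C>\<^esub> f)) \<and>
        exact_at (Hom \<C> W (ob X n)) (Hom \<C> W (ob X (n+1))) (\<E> W (ob X 0))
                 (\<lambda>f. df X n \<cdot>\<^bsub>\<C>\<^esub> f) (\<lambda>f. \<E>m f (Idt \<C> (ob X 0)) \<delta>)) \<and>
     (\<forall>W\<in>Obj \<C>.
        (\<forall>i<n. exact_at (Hom \<C> (ob X (i+2)) W) (Hom \<C> (ob X (i+1)) W) (Hom \<C> (ob X i) W)
                 (\<lambda>f. f \<cdot>\<^bsub>\<C>\<^esub> df X (i+1)) (\<lambda>f. f \<cdot>\<^bsub>\<C>\<^esub> df X i)) \<and>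
        exact_at (Hom \<C> (ob X 1) W) (Hom \<C> (ob X 0) W) (\<E> (ob X (n+1)) W)
                 (\<lambda>f. f \<cdot>\<^bsub>\<C>\<^esub> df X 0) (\<lambda>f. \<E>m (Idt \<C> (ob X (n+1))) f \<delta>))"

text \<open>\<open>A \<rightarrow> A \<rightarrow> 0 \<rightarrow> \<cdots> \<rightarrow> 0\<close> and \<open>0 \<rightarrow> \<cdots> \<rightarrow> 0 \<rightarrow> A \<rightarrow> A\<close>, with identities on \<open>A\<close>.\<close>

definition triv_left :: "('o, 'm) precat \<Rightarrow> 'o \<Rightarrow> 'o \<Rightarrow> ('o, 'm) cpx" where
  "triv_left \<C> A Z = \<lparr>
     ob = (\<lambda>i. if i \<le> 1 then A else Z),
     df = (\<lambda>i. if i = 0 then Idt \<C> A else if i = 1 then zero_mor \<C> A Z else zero_mor \<C> Z Z)\<rparr>"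

definition triv_right :: "nat \<Rightarrow> ('o, 'm) precat \<Rightarrow> 'o \<Rightarrow> 'o \<Rightarrow> ('o, 'm) cpx" where
  "triv_right n \<C> Z A = \<lparr>
     ob = (\<lambda>i. if i < n then Z else A),
     df = (\<lambda>i. if i + 1 < n then zero_mor \<C> Z Z else if i + 1 = n then zero_mor \<C> Z A
               else Idt \<C> A)\<rparr>"

text \<open>
  The realization \<open>\<ss>\<close> takes the end terms as arguments, since the underlying sets of different
  groups \<open>\<E> C A\<close> need not be disjoint.
\<close>

locale exact_realization = biadditive_functor \<C> \<E> \<E>m
  for n :: nat and \<C> :: "('o, 'm) precat" (structure)
    and \<E> :: "'o \<Rightarrow> 'o \<Rightarrow> 'e monoid" and \<E>m :: "'m \<Rightarrow> 'm \<Rightarrow> 'e \<Rightarrow> 'e" +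
  fixes \<ss> :: "'o \<Rightarrow> 'o \<Rightarrow> 'e \<Rightarrow> ('o, 'm) cpx set"
  assumes realization: "\<lbrakk>C \<in> Obj \<C>; A \<in> Obj \<C>; \<delta> \<in> carrier (\<E> C A)\<rbrakk>
        \<Longrightarrow> \<exists>X \<in> complexes_betw n \<C> A C. \<ss> C A \<delta> = hclass n \<C> X"
    and R0: "\<lbrakk>A \<in> Obj \<C>; B \<in> Obj \<C>; C \<in> Obj \<C>; D \<in> Obj \<C>;
        \<delta> \<in> carrier (\<E> C A); \<rho> \<in> carrier (\<E> D B);
        X \<in> complexes_betw n \<C> A C; \<ss> C A \<delta> = hclass n \<C> X;
        Y \<in> complexes_betw n \<C> B D; \<ss> D B \<rho> = hclass n \<C> Y;
        a \<in> Mor \<C> A B; c \<in> Mor \<C> C D; \<E>m (Idt \<C> C) a \<delta> = \<E>m c (Idt \<C> B) \<rho>\<rbrakk>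
        \<Longrightarrow> \<exists>f. chain_map n \<C> X Y f \<and> f 0 = a \<and> f (n+1) = c"
    and R1: "\<lbrakk>C \<in> Obj \<C>; A \<in> Obj \<C>; \<delta> \<in> carrier (\<E> C A);
        X \<in> complexes_betw n \<C> A C; \<ss> C A \<delta> = hclass n \<C> X\<rbrakk> \<Longrightarrow> n_exangle n \<C> \<E> \<E>m X \<delta>"
    and R2_left: "\<lbrakk>A \<in> Obj \<C>; is_zero_object \<C> Z\<rbrakk>
        \<Longrightarrow> \<ss> Z A \<one>\<^bsub>\<E> Z A\<^esub> = hclass n \<C> (triv_left \<C> A Z)"
    and R2_right: "\<lbrakk>A \<in> Obj \<C>; is_zero_object \<C> Z\<rbrakk>
        \<Longrightarrow> \<ss> A Z \<one>\<^bsub>\<E> A Z\<^esub> = hclass n \<C> (triv_right n \<C> Z A)"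

definition distinguished :: "nat \<Rightarrow> ('o, 'm) precat \<Rightarrow> ('o \<Rightarrow> 'o \<Rightarrow> 'e monoid) \<Rightarrow>
    ('o \<Rightarrow> 'o \<Rightarrow> 'e \<Rightarrow> ('o, 'm) cpx set) \<Rightarrow> ('o, 'm) cpx \<Rightarrow> 'e \<Rightarrow> bool" where
  "distinguished n \<C> \<E> \<ss> X \<delta> \<longleftrightarrow>
     X \<in> complexes n \<C> \<and> \<delta> \<in> carrier (\<E> (ob X (n+1)) (ob X 0)) \<and>
     \<ss> (ob X (n+1)) (ob X 0) \<delta> = hclass n \<C> X"

definition inflation :: "nat \<Rightarrow> ('o, 'm) precat \<Rightarrow> ('o \<Rightarrow> 'o \<Rightarrow> 'e monoid) \<Rightarrow>
    ('o \<Rightarrow> 'o \<Rightarrow> 'e \<Rightarrow> ('o, 'm) cpx set) \<Rightarrow> 'm \<Rightarrow> bool" where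
  "inflation n \<C> \<E> \<ss> f \<longleftrightarrow> (\<exists>X \<delta>. distinguished n \<C> \<E> \<ss> X \<delta> \<and> f = df X 0)"

definition deflation :: "nat \<Rightarrow> ('o, 'm) precat \<Rightarrow> ('o \<Rightarrow> 'o \<Rightarrow> 'e monoid) \<Rightarrow>
    ('o \<Rightarrow> 'o \<Rightarrow> 'e \<Rightarrow> ('o, 'm) cpx set) \<Rightarrow> 'm \<Rightarrow> bool" where
  "deflation n \<C> \<E> \<ss> f \<longleftrightarrow> (\<exists>X \<delta>. distinguished n \<C> \<E> \<ss> X \<delta> \<and> f = df X n)"

locale n_exangulated_category = exact_realization n \<C> \<E> \<E>m \<ss>
  for n :: nat and \<C> :: "('o, 'm) precat" (structure)
    and \<E> :: "'o \<Rightarrow> 'o \<Rightarrow> 'e monoid" and \<E>m :: "'m \<Rightarrow> 'm \<Rightarrow> 'e \<Rightarrow> 'e"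
    and \<ss> :: "'o \<Rightarrow> 'o \<Rightarrow> 'e \<Rightarrow> ('o, 'm) cpx set" +
  assumes EA1: "\<lbrakk>A \<in> Obj \<C>; B \<in> Obj \<C>; D \<in> Obj \<C>; f \<in> Mor \<C> A B; g \<in> Mor \<C> B D;
        inflation n \<C> \<E> \<ss> f; inflation n \<C> \<E> \<ss> g\<rbrakk> \<Longrightarrow> inflation n \<C> \<E> \<ss> (g \<cdot> f)"
    and EA1_op: "\<lbrakk>A \<in> Obj \<C>; B \<in> Obj \<C>; D \<in> Obj \<C>; f \<in> Mor \<C> A B; g \<in> Mor \<C> B D;
        deflation n \<C> \<E> \<ss> f; deflation n \<C> \<E> \<ss> g\<rbrakk> \<Longrightarrow> deflation n \<C> \<E> \<ss> (g \<cdot> f)"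
    and EA2: "\<lbrakk>A \<in> Obj \<C>; C \<in> Obj \<C>; D \<in> Obj \<C>; \<rho> \<in> carrier (\<E> D A); c \<in> Mor \<C> C D;
        X \<in> complexes_betw n \<C> A C; distinguished n \<C> \<E> \<ss> X (\<E>m c (Idt \<C> A) \<rho>);
        Y \<in> complexes_betw n \<C> A D; distinguished n \<C> \<E> \<ss> Y \<rho>\<rbrakk> \<Longrightarrow>
        \<exists>f. chain_map n \<C> X Y f \<and> f 0 = Idt \<C> A \<and> f (n+1) = c \<and>
          distinguished n \<C> \<E> \<ss> (mcone n \<C> X Y f) (\<E>m (Idt \<C> D) (df X 0) \<rho>)"
    and EA2_op: "\<lbrakk>A \<in> Obj \<C>; B \<in> Obj \<C>; C \<in> Obj \<C>; \<delta> \<in> carrier (\<E> C A); a \<in> Mor \<C> A B;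
        X \<in> complexes_betw n \<C> A C; distinguished n \<C> \<E> \<ss> X \<delta>;
        Y \<in> complexes_betw n \<C> B C; distinguished n \<C> \<E> \<ss> Y (\<E>m (Idt \<C> C) a \<delta>)\<rbrakk> \<Longrightarrow>
        \<exists>h. chain_map n \<C> X Y h \<and> h 0 = a \<and> h (n+1) = Idt \<C> C \<and>
          distinguished n \<C> \<E> \<ss> (mcocone n \<C> X Y h) (\<E>m (df Y n) (Idt \<C> A) \<delta>)"

end

theory Submission
  imports Defs
begin

text \<open>
  All statements about \<open>\<E>\<close> rest on one universal property. If \<open>q : X \<rightarrow> Y\<close> is an \<open>n\<close>-pullback with
  \<open>q\<^sup>0 = 1\<close> and \<open>f : V \<rightarrow> Y\<close> is a chain map with \<open>f\<^bsup>n+1\<^esup> = q\<^bsup>n+1\<^esup> w\<close>, then the composite of \<open>f\<close> with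
  the inclusion \<open>Y \<rightarrow> M\<^sub>q\<close> is null-homotopic, because its last component factors through the last
  differential of the \<open>n\<close>-kernel sequence \<open>M\<^sub>q\<close>; the \<open>X\<close>-components of the homotopy form a chain map
  \<open>V \<rightarrow> X\<close> with end components \<open>f\<^sup>0\<close> and \<open>w\<close>. Conversely every chain map \<open>f\<close> between members of \<open>\<X>\<close>
  with \<open>f\<^sup>0 = 1\<close> is an \<open>n\<close>-pullback: a map \<open>w\<close> for which \<open>f\<^bsup>n+1\<^esup> w\<close> factors through the last
  differential of \<open>Y\<close> is tested by pulling \<open>X\<close> back along \<open>w\<close>. Hence \<open>a\<^sub>*[X] = c\<^sup>*[Y]\<close> holds exactly
  when some chain map \<open>X \<rightarrow> Y\<close> has the end components \<open>a\<close> and \<open>c\<close>. It follows that the Baer sum is the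
  addition induced by \<open>\<E>(C, A \<oplus> A) = \<E>(C, A)\<^sup>2\<close>, that \<open>[X] = 0\<close> iff the first map of \<open>X\<close> splits, and
  that \<open>M\<^sub>f\<close> lies in \<open>\<X>\<close>, being \<open>n\<close>-exact and receiving from \<open>Y\<close> a chain map with last component \<open>1\<close>.
  The statements about pushouts are those about pullbacks in the opposite category.
\<close>

section \<open>Calculating with morphisms\<close>

text \<open>Two members of \<X> with the same end terms are equivalent as soon as one chain map
  between them is the identity at both ends: the universal property supplies a map back, and an
  endomorphism that is the identity in degree 0 is homotopic to the identity. So middle components
  can be forgotten, and everything is phrased by the relation \<open>erel\<close> on end components.
  Membership in \<X> mostly has to come from (EC), which presupposes n-exactness; each construction
  is therefore shown n-exact by hand and then compared with a known member. (E2op) gives little for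
  this: no degree 0, an n-kernel property in place of n-exactness, and a last map merely known to be
  admissible. These gaps are closed before any class is formed. Direct sums go through (E1), the
  first map of a sum being a composite of two admissible monomorphisms. The operations on classes
  are definite descriptions, so each gets a lemma that evaluates it at any representative, however
  found; the group axioms then become identities between morphisms.\<close>

context additive_category
begin

abbreviation Ob where "Ob \<equiv> Obj \<C>"
abbreviation in1 where "in1 \<equiv> inj1 \<C>"
abbreviation in2 where "in2 \<equiv> inj2 \<C>"
abbreviation pr1 where "pr1 \<equiv> prj1 \<C>"
abbreviation pr2 where "pr2 \<equiv> prj2 \<C>"
abbreviation col where "col \<equiv> col_mor \<C>"
abbreviation row where "row \<equiv> row_mor \<C>"
abbreviation mat where "mat \<equiv> mat_mor \<C>"

text \<open>
  Since Hom sets are disjoint, a morphism determines its source \<open>dm\<close> and target \<open>cd\<close>. This turns the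
  typing conditions of all laws into equations that the simplifier can solve, and sums and negatives
  need no Hom group as argument.
\<close>

definition arr :: "'m \<Rightarrow> bool" where
  "arr f \<longleftrightarrow> (\<exists>A\<in>Ob. \<exists>B\<in>Ob. f \<in> Mor \<C> A B)"

definition dm :: "'m \<Rightarrow> 'o" where
  "dm f = (THE A. A \<in> Ob \<and> (\<exists>B\<in>Ob. f \<in> Mor \<C> A B))"

definition cd :: "'m \<Rightarrow> 'o" where
  "cd f = (THE B. B \<in> Ob \<and> (\<exists>A\<in>Ob. f \<in> Mor \<C> A B))"

definition add :: "'m \<Rightarrow> 'm \<Rightarrow> 'm" (infixl "\<oplus>" 65) where
  "f \<oplus> g = f \<otimes>\<^bsub>Hom \<C> (dm f) (cd f)\<^esub> g"

definition neg :: "'m \<Rightarrow> 'm" where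
  "neg f = inv\<^bsub>Hom \<C> (dm f) (cd f)\<^esub> f"

abbreviation Zm :: "'o \<Rightarrow> 'o \<Rightarrow> 'm" where "Zm A B \<equiv> zero_mor \<C> A B"
abbreviation Id :: "'o \<Rightarrow> 'm" where "Id A \<equiv> Idt \<C> A"

lemma Mor_iff [simp]:
  assumes "A \<in> Ob" "B \<in> Ob"
  shows "f \<in> Mor \<C> A B \<longleftrightarrow> arr f \<and> dm f = A \<and> cd f = B"
proof
  assume f: "f \<in> Mor \<C> A B"
  have "dm f = A" unfolding dm_def
    by (rule the_equality) (use f assms Hom_disjoint in blast)+
  moreover have "cd f = B" unfolding cd_def
    by (rule the_equality) (use f assms Hom_disjoint in blast)+
  ultimately show "arr f \<and> dm f = A \<and> cd f = B" using f assms unfolding arr_def by blast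
next
  assume f: "arr f \<and> dm f = A \<and> cd f = B"
  then obtain A' B' where g: "A' \<in> Ob" "B' \<in> Ob" "f \<in> Mor \<C> A' B'"
    unfolding arr_def by blast
  have "dm f = A'" unfolding dm_def
    by (rule the_equality) (use g Hom_disjoint in blast)+
  moreover have "cd f = B'" unfolding cd_def
    by (rule the_equality) (use g Hom_disjoint in blast)+
  ultimately show "f \<in> Mor \<C> A B" using f g by simp
qed

lemma arr_dm [simp]: "arr f \<Longrightarrow> dm f \<in> Ob" and arr_cd [simp]: "arr f \<Longrightarrow> cd f \<in> Ob"
  unfolding arr_def by auto

lemma arr_mem: "arr f \<Longrightarrow> f \<in> Mor \<C> (dm f) (cd f)"
  by simp

lemma tensor_add [simp]: "\<lbrakk>dm f = A; cd f = B\<rbrakk> \<Longrightarrow> f \<otimes>\<^bsub>Hom \<C> A B\<^esub> g = f \<oplus> g"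
  by (simp add: add_def)

lemma inv_neg [simp]: "\<lbrakk>dm f = A; cd f = B\<rbrakk> \<Longrightarrow> inv\<^bsub>Hom \<C> A B\<^esub> f = neg f"
  by (simp add: neg_def)

lemma Id_type [simp]:
  assumes "A \<in> Ob" shows "arr (Id A)" "dm (Id A) = A" "cd (Id A) = A"
  using Idt_closed[OF assms] assms by simp_all

lemma Zm_type [simp]:
  assumes "A \<in> Ob" "B \<in> Ob" shows "arr (Zm A B)" "dm (Zm A B) = A" "cd (Zm A B) = B"
proof -
  interpret comm_group "Hom \<C> A B" using assms by (rule Hom_comm_group)
  have "Zm A B \<in> Mor \<C> A B" by (rule one_closed)
  then show "arr (Zm A B)" "dm (Zm A B) = A" "cd (Zm A B) = B"
    unfolding Mor_iff[OF assms] by blast+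
qed

lemma comp_type [simp]:
  assumes "arr f" "arr g" "dm g = cd f"
  shows "arr (g \<cdot> f)" "dm (g \<cdot> f) = dm f" "cd (g \<cdot> f) = cd g"
  using Comp_closed[of "dm f" "cd f" "cd g" f g] assms by (simp_all del: Mor_iff add: arr_mem)
     (metis Mor_iff arr_cd arr_dm arr_mem)+

lemma add_type [simp]:
  assumes "arr f" "arr g" "dm f = dm g" "cd f = cd g"
  shows "arr (f \<oplus> g)" "dm (f \<oplus> g) = dm g" "cd (f \<oplus> g) = cd g"
proof -
  interpret comm_group "Hom \<C> (dm g) (cd g)" using assms by (intro Hom_comm_group) auto
  have "f \<oplus> g \<in> Mor \<C> (dm g) (cd g)" using m_closed[of f g] assms by (simp del: Mor_iff add: arr_mem) (metis arr_mem)
  then show "arr (f \<oplus> g)" "dm (f \<oplus> g) = dm g" "cd (f \<oplus> g) = cd g" using assms by auto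
qed

lemma neg_type [simp]:
  assumes "arr f" shows "arr (neg f)" "dm (neg f) = dm f" "cd (neg f) = cd f"
proof -
  interpret comm_group "Hom \<C> (dm f) (cd f)" using assms by (intro Hom_comm_group) auto
  have "neg f \<in> Mor \<C> (dm f) (cd f)" using inv_closed[of f] assms by (simp del: Mor_iff add: arr_mem)
  then show "arr (neg f)" "dm (neg f) = dm f" "cd (neg f) = cd f" using assms by auto
qed

lemma comp_Id [simp]: "\<lbrakk>arr f; dm f = A\<rbrakk> \<Longrightarrow> f \<cdot> Id A = f"
  and Id_comp [simp]: "\<lbrakk>arr f; cd f = B\<rbrakk> \<Longrightarrow> Id B \<cdot> f = f"
  using Comp_Idt[of "dm f" "cd f" f] Idt_Comp[of "dm f" "cd f" f] by auto

lemma comp_assoc: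
  "\<lbrakk>arr f; arr g; arr h; dm g = cd f; dm h = cd g\<rbrakk> \<Longrightarrow> h \<cdot> g \<cdot> f = h \<cdot> (g \<cdot> f)"
  using Comp_assoc[of "dm f" "cd f" "cd g" "cd h" f g h] by simp

lemma comp_add_left:
  "\<lbrakk>arr f; arr g; arr g'; dm g = cd f; dm g' = cd f; cd g = cd g'\<rbrakk>
    \<Longrightarrow> (g \<oplus> g') \<cdot> f = g \<cdot> f \<oplus> g' \<cdot> f"
  using Comp_add_left[of "dm f" "cd f" "cd g" f g g'] by simp

lemma comp_add_right:
  "\<lbrakk>arr f; arr f'; arr g; dm f = dm f'; cd f = cd f'; dm g = cd f'\<rbrakk>
    \<Longrightarrow> g \<cdot> (f \<oplus> f') = g \<cdot> f \<oplus> g \<cdot> f'"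
  using Comp_add_right[of "dm f" "cd f" "cd g" f f' g] by simp

lemma add_assoc:
  assumes "arr f" "arr g" "arr h" "dm f = dm g" "dm g = dm h" "cd f = cd g" "cd g = cd h"
  shows "f \<oplus> g \<oplus> h = f \<oplus> (g \<oplus> h)"
proof -
  interpret comm_group "Hom \<C> (dm h) (cd h)" using assms by (intro Hom_comm_group) auto
  show ?thesis using m_assoc[of f g h] assms by simp
qed

lemma add_comm:
  assumes "arr f" "arr g" "dm f = dm g" "cd f = cd g"
  shows "f \<oplus> g = g \<oplus> f"
proof -
  interpret comm_group "Hom \<C> (dm g) (cd g)" using assms by (intro Hom_comm_group) auto
  show ?thesis using m_comm[of f g] assms by simp
qed

lemma add_left_comm:
  assumes "arr f" "arr g" "arr h" "dm f = dm g" "dm g = dm h" "cd f = cd g" "cd g = cd h"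
  shows "f \<oplus> (g \<oplus> h) = g \<oplus> (f \<oplus> h)"
  using assms add_assoc[of f g h] add_assoc[of g f h] add_comm[of f g] by simp

lemma add_zero [simp]:
  assumes "arr f" "dm f = A" "cd f = B"
  shows "f \<oplus> Zm A B = f" "Zm A B \<oplus> f = f"
proof -
  interpret comm_group "Hom \<C> A B" using assms by (intro Hom_comm_group) auto
  have A: "A \<in> Ob" "B \<in> Ob" and f: "f \<in> Mor \<C> A B" using assms by auto
  show "f \<oplus> Zm A B = f" using r_one[OF f] unfolding tensor_add[OF assms(2,3)] .
  show "Zm A B \<oplus> f = f" using l_one[OF f] A by (simp only: tensor_add Zm_type)
qed

lemma add_neg [simp]:
  assumes "arr f" shows "f \<oplus> neg f = Zm (dm f) (cd f)" "neg f \<oplus> f = Zm (dm f) (cd f)"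
proof -
  interpret comm_group "Hom \<C> (dm f) (cd f)" using assms by (intro Hom_comm_group) auto
  show "f \<oplus> neg f = Zm (dm f) (cd f)" "neg f \<oplus> f = Zm (dm f) (cd f)"
    using r_inv[OF arr_mem[OF assms]] l_inv[OF arr_mem[OF assms]]
    by (simp_all only: tensor_add inv_neg neg_type[OF assms])
qed

lemma neg_cancel [simp]:
  assumes "arr f" "arr g" "dm f = dm g" "cd f = cd g"
  shows "f \<oplus> (neg f \<oplus> g) = g" "neg f \<oplus> (f \<oplus> g) = g"
  using assms by (simp_all add: add_assoc[symmetric])

lemma add_cancel [simp]:
  assumes "arr f" "arr g" "arr h" "dm f = dm g" "dm g = dm h" "cd f = cd g" "cd g = cd h"
  shows "f \<oplus> g = f \<oplus> h \<longleftrightarrow> g = h" "g \<oplus> f = h \<oplus> f \<longleftrightarrow> g = h"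
proof -
  show "f \<oplus> g = f \<oplus> h \<longleftrightarrow> g = h" using assms neg_cancel(2)[of f g] neg_cancel(2)[of f h] by metis
  then show "g \<oplus> f = h \<oplus> f \<longleftrightarrow> g = h" using add_comm[of f g] add_comm[of f h] assms by simp
qed

lemma eq_zero_iff:
  assumes "arr f" "arr g" "dm f = dm g" "cd f = cd g"
  shows "f \<oplus> neg g = Zm (dm g) (cd g) \<longleftrightarrow> f = g"
  using assms add_cancel(2)[of "neg g" f g] by (simp del: add_cancel)

lemma neg_unique:
  assumes "arr f" "arr g" "dm f = dm g" "cd f = cd g" "f \<oplus> g = Zm (dm g) (cd g)"
  shows "neg f = g"
proof -
  have "neg f \<oplus> (f \<oplus> g) = g" using assms(1-4) by (rule neg_cancel(2))
  then show ?thesis unfolding assms(5) using assms(1-4) by simp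
qed

lemma neg_neg [simp]: "arr f \<Longrightarrow> neg (neg f) = f"
  by (rule neg_unique) auto

lemma neg_Zm [simp]: "\<lbrakk>A \<in> Ob; B \<in> Ob\<rbrakk> \<Longrightarrow> neg (Zm A B) = Zm A B"
  by (rule neg_unique) auto

lemma comp_Zm [simp]: "\<lbrakk>arr f; dm f = B; A \<in> Ob\<rbrakk> \<Longrightarrow> f \<cdot> Zm A B = Zm A (cd f)"
proof -
  assume a: "arr f" "dm f = B" "A \<in> Ob"
  have b: "B \<in> Ob" using a by auto
  \<comment> \<open>Zero plus zero is zero, and one summand is cancelled.\<close>
  then have "f \<cdot> Zm A B \<oplus> f \<cdot> Zm A B = f \<cdot> (Zm A B \<oplus> Zm A B)" using a by (subst comp_add_right) auto
  also have "\<dots> = f \<cdot> Zm A B \<oplus> Zm A (cd f)" using a b by simp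
  finally show ?thesis using a b by (simp del: add_zero)
qed

lemma Zm_comp [simp]: "\<lbrakk>arr f; cd f = A; B \<in> Ob\<rbrakk> \<Longrightarrow> Zm A B \<cdot> f = Zm (dm f) B"
proof -
  assume a: "arr f" "cd f = A" "B \<in> Ob"
  have b: "A \<in> Ob" using a by auto
  then have "Zm A B \<cdot> f \<oplus> Zm A B \<cdot> f = (Zm A B \<oplus> Zm A B) \<cdot> f" using a by (subst comp_add_left) auto
  also have "\<dots> = Zm A B \<cdot> f \<oplus> Zm (dm f) B" using a b by simp
  finally show ?thesis using a b by (simp del: add_zero)
qed

lemma comp_neg [simp]: "\<lbrakk>arr f; arr g; dm g = cd f\<rbrakk> \<Longrightarrow> g \<cdot> neg f = neg (g \<cdot> f)"
  by (rule neg_unique[symmetric]) (auto simp flip: comp_add_right)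

lemma neg_comp [simp]: "\<lbrakk>arr f; arr g; dm g = cd f\<rbrakk> \<Longrightarrow> neg g \<cdot> f = neg (g \<cdot> f)"
  by (rule neg_unique[symmetric]) (auto simp flip: comp_add_left)

lemma neg_add [simp]: "\<lbrakk>arr f; arr g; dm f = dm g; cd f = cd g\<rbrakk> \<Longrightarrow> neg (f \<oplus> g) = neg f \<oplus> neg g"
proof (rule neg_unique)
  assume a: "arr f" "arr g" "dm f = dm g" "cd f = cd g"
  have "f \<oplus> g \<oplus> (neg f \<oplus> neg g) = (f \<oplus> neg f) \<oplus> (g \<oplus> neg g)"
    using a by (simp only: add_assoc add_left_comm add_type neg_type)
  then show "f \<oplus> g \<oplus> (neg f \<oplus> neg g) = Zm (dm (neg f \<oplus> neg g)) (cd (neg f \<oplus> neg g))" using a by simp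
qed auto

lemmas comp_add = comp_add_left comp_add_right

lemma sum_zero_iff:
  "\<lbrakk>arr f; arr g; dm f = dm g; cd f = cd g\<rbrakk> \<Longrightarrow> f \<oplus> g = Zm (dm g) (cd g) \<longleftrightarrow> f = neg g"
  using eq_zero_iff[of f "neg g"] by simp

lemma eq_add_iff:
  assumes "arr f" "arr g" "arr h" "dm f = dm g" "dm g = dm h" "cd f = cd g" "cd g = cd h"
  shows "f = g \<oplus> h \<longleftrightarrow> f \<oplus> neg g = h"
proof
  assume "f = g \<oplus> h" then show "f \<oplus> neg g = h" using assms
    by (simp add: add_comm[of "g \<oplus> h"])
next
  assume "f \<oplus> neg g = h"
  then have "g \<oplus> h = g \<oplus> (neg g \<oplus> f)" using assms by (simp add: add_comm[of f])
  then show "f = g \<oplus> h" using assms by simp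
qed

section \<open>Biproducts and matrices of morphisms\<close>

lemma biprod_ex:
  assumes "A \<in> Ob" "B \<in> Ob"
  shows "is_biproduct \<C> A B (dsum \<C> A B) (in1 A B) (in2 A B) (pr1 A B) (pr2 A B)"
proof -
  have "\<exists>x. case x of (S, i1, i2, p1, p2) \<Rightarrow> is_biproduct \<C> A B S i1 i2 p1 p2"
    using biproduct_exists[OF assms] by auto
  then have "case biprod \<C> A B of (S, i1, i2, p1, p2) \<Rightarrow> is_biproduct \<C> A B S i1 i2 p1 p2"
    unfolding biprod_def by (rule someI_ex)
  then show ?thesis by (auto simp: dsum_def inj1_def inj2_def prj1_def prj2_def split: prod.splits)
qed

lemma dsum_simps [simp]:
  assumes "A \<in> Ob" "B \<in> Ob"
  shows "dsum \<C> A B \<in> Ob"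
    "arr (in1 A B)" "dm (in1 A B) = A" "cd (in1 A B) = dsum \<C> A B"
    "arr (in2 A B)" "dm (in2 A B) = B" "cd (in2 A B) = dsum \<C> A B"
    "arr (pr1 A B)" "cd (pr1 A B) = A" "dm (pr1 A B) = dsum \<C> A B"
    "arr (pr2 A B)" "cd (pr2 A B) = B" "dm (pr2 A B) = dsum \<C> A B"
    "pr1 A B \<cdot> in1 A B = Id A" "pr2 A B \<cdot> in2 A B = Id B"
    "pr1 A B \<cdot> in2 A B = Zm B A" "pr2 A B \<cdot> in1 A B = Zm A B"
    "in1 A B \<cdot> pr1 A B \<oplus> in2 A B \<cdot> pr2 A B = Id (dsum \<C> A B)"
  using biprod_ex[OF assms] assms by (auto simp: is_biproduct_def)

lemma dsum_simps_assoc [simp]: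
  assumes "A \<in> Ob" "B \<in> Ob"
  shows "\<lbrakk>arr f; cd f = A\<rbrakk> \<Longrightarrow> pr1 A B \<cdot> (in1 A B \<cdot> f) = f"
    "\<lbrakk>arr f; cd f = B\<rbrakk> \<Longrightarrow> pr2 A B \<cdot> (in2 A B \<cdot> f) = f"
    "\<lbrakk>arr f; cd f = B\<rbrakk> \<Longrightarrow> pr1 A B \<cdot> (in2 A B \<cdot> f) = Zm (dm f) A"
    "\<lbrakk>arr f; cd f = A\<rbrakk> \<Longrightarrow> pr2 A B \<cdot> (in1 A B \<cdot> f) = Zm (dm f) B"
  using assms by (simp_all flip: comp_assoc)

lemma dsum_ext:
  assumes "arr f" "arr g" "dm f = dm g" "cd f = dsum \<C> A B" "cd g = dsum \<C> A B"
    "A \<in> Ob" "B \<in> Ob"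
    "pr1 A B \<cdot> f = pr1 A B \<cdot> g" "pr2 A B \<cdot> f = pr2 A B \<cdot> g"
  shows "f = g"
proof -
  have "h = in1 A B \<cdot> (pr1 A B \<cdot> h) \<oplus> in2 A B \<cdot> (pr2 A B \<cdot> h)"
    if "arr h" "cd h = dsum \<C> A B" for h
    using that assms(6,7) by (simp flip: comp_assoc comp_add_left)
  from this[of f] this[of g] show ?thesis using assms by metis
qed

lemma dsum_coext:
  assumes "arr f" "arr g" "cd f = cd g" "dm f = dsum \<C> A B" "dm g = dsum \<C> A B"
    "A \<in> Ob" "B \<in> Ob"
    "f \<cdot> in1 A B = g \<cdot> in1 A B" "f \<cdot> in2 A B = g \<cdot> in2 A B"
  shows "f = g"
proof -
  have "h = h \<cdot> in1 A B \<cdot> pr1 A B \<oplus> h \<cdot> in2 A B \<cdot> pr2 A B"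
    if "arr h" "dm h = dsum \<C> A B" for h
    using that assms(6,7) by (simp add: comp_assoc flip: comp_add_right)
  from this[of f] this[of g] show ?thesis using assms by metis
qed

lemma col_simps [simp]:
  assumes "arr f" "arr g" "dm f = W" "dm g = W" "cd f = A" "cd g = B"
  shows "arr (col W A B f g)" "dm (col W A B f g) = W"
    "cd (col W A B f g) = dsum \<C> A B"
    "pr1 A B \<cdot> col W A B f g = f" "pr2 A B \<cdot> col W A B f g = g"
  using assms arr_cd[of f] arr_cd[of g] arr_dm[of f] by (auto simp: col_mor_def comp_add)

lemma row_simps [simp]:
  assumes "arr f" "arr g" "cd f = W" "cd g = W" "dm f = A" "dm g = B"
  shows "arr (row A B W f g)" "cd (row A B W f g) = W"
    "dm (row A B W f g) = dsum \<C> A B"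
    "row A B W f g \<cdot> in1 A B = f" "row A B W f g \<cdot> in2 A B = g"
  using assms arr_dm[of f] arr_dm[of g] arr_cd[of f] by (auto simp: row_mor_def comp_add comp_assoc)

lemma row_comp:
  assumes "arr f" "arr g" "cd f = W" "cd g = W" "dm f = A" "dm g = B" "arr u" "cd u = dsum \<C> A B"
  shows "row A B W f g \<cdot> u = f \<cdot> (pr1 A B \<cdot> u) \<oplus> g \<cdot> (pr2 A B \<cdot> u)"
  using assms arr_dm[of f] arr_dm[of g] arr_cd[of f] by (auto simp: row_mor_def comp_add comp_assoc)

lemma comp_col:
  assumes "arr f" "arr g" "dm f = W" "dm g = W" "cd f = A" "cd g = B" "arr u" "dm u = dsum \<C> A B"
  shows "u \<cdot> col W A B f g = u \<cdot> in1 A B \<cdot> f \<oplus> u \<cdot> in2 A B \<cdot> g"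
  using assms arr_cd[of f] arr_cd[of g] arr_dm[of f] by (auto simp: col_mor_def comp_add comp_assoc)

lemma col_comp_assoc [simp]:
  assumes "arr f" "arr g" "dm f = W" "dm g = W" "cd f = A" "cd g = B" "arr u" "cd u = W"
  shows "pr1 A B \<cdot> (col W A B f g \<cdot> u) = f \<cdot> u"
    "pr2 A B \<cdot> (col W A B f g \<cdot> u) = g \<cdot> u"
  using assms arr_cd[of f] arr_cd[of g] arr_dm[of f] by (auto simp flip: comp_assoc)

lemma mat_simps [simp]:
  assumes "arr p" "arr q" "arr r" "arr s" "dm p = A" "dm r = A" "dm q = B" "dm s = B"
    "cd p = A'" "cd q = A'" "cd r = B'" "cd s = B'"
  shows "arr (mat A B A' B' p q r s)" "dm (mat A B A' B' p q r s) = dsum \<C> A B"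
    "cd (mat A B A' B' p q r s) = dsum \<C> A' B'"
    "pr1 A' B' \<cdot> mat A B A' B' p q r s = row A B A' p q"
    "pr2 A' B' \<cdot> mat A B A' B' p q r s = row A B B' r s"
    "mat A B A' B' p q r s \<cdot> in1 A B = col A A' B' p r"
    "mat A B A' B' p q r s \<cdot> in2 A B = col B A' B' q s"
proof -
  have o: "A \<in> Ob" "B \<in> Ob" "A' \<in> Ob" "B' \<in> Ob" using assms by auto
  show "arr (mat A B A' B' p q r s)" "dm (mat A B A' B' p q r s) = dsum \<C> A B"
    "cd (mat A B A' B' p q r s) = dsum \<C> A' B'"
    "pr1 A' B' \<cdot> mat A B A' B' p q r s = row A B A' p q"
    "pr2 A' B' \<cdot> mat A B A' B' p q r s = row A B B' r s"
    using assms o by (simp_all add: mat_mor_def)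
  show "mat A B A' B' p q r s \<cdot> in1 A B = col A A' B' p r"
    by (rule dsum_ext[of _ _ A' B']) (use assms o in \<open>simp_all add: mat_mor_def\<close>)
  show "mat A B A' B' p q r s \<cdot> in2 A B = col B A' B' q s"
    by (rule dsum_ext[of _ _ A' B']) (use assms o in \<open>simp_all add: mat_mor_def\<close>)
qed

lemma prj_comp_assoc [simp]:
  assumes "arr p" "arr q" "arr r" "arr s" "dm p = A" "dm r = A" "dm q = B" "dm s = B"
    "cd p = A'" "cd q = A'" "cd r = B'" "cd s = B'" "arr u" "cd u = dsum \<C> A B"
  shows "pr1 A' B' \<cdot> (mat A B A' B' p q r s \<cdot> u) = p \<cdot> (pr1 A B \<cdot> u) \<oplus> q \<cdot> (pr2 A B \<cdot> u)"
    "pr2 A' B' \<cdot> (mat A B A' B' p q r s \<cdot> u) = r \<cdot> (pr1 A B \<cdot> u) \<oplus> s \<cdot> (pr2 A B \<cdot> u)"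
  using assms by (simp_all add: mat_mor_def row_comp)

end

section \<open>The opposite category and complexes\<close>

text \<open>The Hom groups keep their operation, so sums, negatives and zero morphisms are literally
  those of \<C>, and reversing twice returns \<C> on the nose.\<close>

definition opc :: "('o, 'm) precat \<Rightarrow> ('o, 'm) precat" where
  "opc \<C> = \<lparr>Obj = Obj \<C>, Hom = (\<lambda>A B. Hom \<C> B A), Comp = (\<lambda>g f. Comp \<C> f g), Idt = Idt \<C>\<rparr>"

definition opx :: "nat \<Rightarrow> ('o, 'm) cpx \<Rightarrow> ('o, 'm) cpx" where
  "opx n X = \<lparr>ob = (\<lambda>i. ob X (n + 1 - i)), df = (\<lambda>i. df X (n - i))\<rparr>"

text \<open>Retains only the end components of a chain map. Extension classes see nothing else, and
  in this form composition and duality require no bookkeeping in the middle degrees.\<close>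

definition erel :: "nat \<Rightarrow> ('o, 'm) precat \<Rightarrow> ('o, 'm) cpx \<Rightarrow> ('o, 'm) cpx \<Rightarrow> 'm \<Rightarrow> 'm \<Rightarrow> bool" where
  "erel n \<C> X Y a c \<longleftrightarrow> (\<exists>f. chain_map n \<C> X Y f \<and> f 0 = a \<and> f (n + 1) = c)"

lemma opc_simps [simp]:
  "Obj (opc \<C>) = Obj \<C>" "Hom (opc \<C>) A B = Hom \<C> B A" "Comp (opc \<C>) g = (\<lambda>f. Comp \<C> f g)"
  "Idt (opc \<C>) = Idt \<C>" "opc (opc \<C>) = \<C>"
  by (simp_all add: opc_def)

lemma opx_simps [simp]: "ob (opx n X) i = ob X (Suc n - i)" "df (opx n X) i = df X (n - i)"
  by (simp_all add: opx_def)

lemma is_biproduct_opc: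
  assumes "additive_category \<C>" "A \<in> Obj \<C>" "B \<in> Obj \<C>"
  shows "is_biproduct (opc \<C>) A B S i1 i2 p1 p2 \<longleftrightarrow> is_biproduct \<C> A B S p1 p2 i1 i2"
  by (auto simp: is_biproduct_def)

lemma additive_category_opc:
  assumes "additive_category \<C>" shows "additive_category (opc \<C>)"
proof -
  interpret additive_category \<C> by fact
  show ?thesis
  proof (rule additive_category.intro)
    fix A B assume "A \<in> Obj (opc \<C>)" "B \<in> Obj (opc \<C>)"
    then have AB: "A \<in> Obj \<C>" "B \<in> Obj \<C>" by auto
    show "comm_group (Hom (opc \<C>) A B)" using AB Hom_comm_group by simp
    show "\<exists>S i1 i2 p1 p2. is_biproduct (opc \<C>) A B S i1 i2 p1 p2"
      using biproduct_exists[OF AB] is_biproduct_opc[OF assms AB] by metis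
  next
    obtain Z where "is_zero_object \<C> Z" using zero_object_exists by blast
    then have "is_zero_object (opc \<C>) Z" by (simp add: is_zero_object_def del: Mor_iff)
    then show "\<exists>Z. is_zero_object (opc \<C>) Z" by blast
  qed (auto simp: comp_assoc comp_add)
qed

lemma complexes_opx: "X \<in> complexes n \<C> \<Longrightarrow> opx n X \<in> complexes n (opc \<C>)"
proof -
  assume X: "X \<in> complexes n \<C>"
  have "df X (n - Suc i) \<in> Mor \<C> (ob X (n - Suc i)) (ob X (n - i))" if "i < n" for i
    using X that unfolding complexes_def by (auto dest!: spec[of _ "n - Suc i"] simp: Suc_diff_Suc)
  moreover have "df X (n - i) \<in> Mor \<C> (ob X (n - i)) (ob X (Suc n - i))" if "i \<le> n" for i
    using X that unfolding complexes_def by (auto simp: Suc_diff_le)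
  moreover have "df X (n - i) \<cdot>\<^bsub>\<C>\<^esub> df X (n - Suc i) = zero_mor \<C> (ob X (n - Suc i)) (ob X (Suc n - i))"
    if "i < n" for i
  proof -
    \<comment> \<open>The composite in degree \<open>i\<close> of the reversed complex is the one in
      degree \<open>n - Suc i\<close> of \<open>X\<close>; these equations remove the truncated
      subtraction.\<close>
    have "n - Suc i < n" "Suc (n - Suc i) = n - i" "Suc n - i = Suc (n - i)" using that by auto
    then show ?thesis using X unfolding complexes_def by (auto dest!: spec[of _ "n - Suc i"])
  qed
  moreover have "ob X (Suc n - i) \<in> Obj \<C>" for i
    using X unfolding complexes_def by simp
  ultimately show ?thesis unfolding complexes_def by auto
qed

lemma exact_opx:
  assumes "n_kernel_seq n \<C> X" shows "n_cokernel_seq n (opc \<C>) (opx n X)"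
proof -
  have "exact_at (Hom \<C> W (ob X (n - Suc i))) (Hom \<C> W (ob X (n - i))) (Hom \<C> W (ob X (Suc n - i)))
          (\<lambda>f. df X (n - Suc i) \<cdot>\<^bsub>\<C>\<^esub> f) (\<lambda>f. df X (n - i) \<cdot>\<^bsub>\<C>\<^esub> f)" if "i < n" "W \<in> Obj \<C>" for i W
  proof -
    have "n - Suc i < n" "Suc (n - Suc i) = n - i" "Suc n - i = Suc (n - i)" using that by auto
    then show ?thesis using assms that unfolding n_kernel_seq_def
      by (auto dest!: bspec[of _ _ W] spec[of _ "n - Suc i"])
  qed
  then show ?thesis using assms complexes_opx unfolding n_kernel_seq_def n_cokernel_seq_def
    by auto
qed

lemma coexact_opx:
  assumes "n_cokernel_seq n \<C> X" shows "n_kernel_seq n (opc \<C>) (opx n X)"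
proof -
  have "exact_at (Hom \<C> (ob X (Suc n - i)) W) (Hom \<C> (ob X (n - i)) W) (Hom \<C> (ob X (n - Suc i)) W)
          (\<lambda>f. f \<cdot>\<^bsub>\<C>\<^esub> df X (n - i)) (\<lambda>f. f \<cdot>\<^bsub>\<C>\<^esub> df X (n - Suc i))" if "i < n" "W \<in> Obj \<C>" for i W
  proof -
    have "n - Suc i < n" "Suc (n - Suc i) = n - i" "Suc n - i = Suc (n - i)" using that by auto
    then show ?thesis using assms that unfolding n_cokernel_seq_def
      by (auto dest!: bspec[of _ _ W] spec[of _ "n - Suc i"])
  qed
  then show ?thesis using assms complexes_opx unfolding n_kernel_seq_def n_cokernel_seq_def
    by auto
qed

lemma n_exact_opx: "n_exact_seq n \<C> X \<Longrightarrow> n_exact_seq n (opc \<C>) (opx n X)"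
  by (simp add: n_exact_seq_def exact_opx coexact_opx)

lemma chain_map_opx:
  assumes "chain_map n \<C> X Y f"
  shows "chain_map n (opc \<C>) (opx n Y) (opx n X) (\<lambda>i. f (Suc n - i))"
proof -
  have "df Y (n - i) \<cdot>\<^bsub>\<C>\<^esub> f (n - i) = f (Suc n - i) \<cdot>\<^bsub>\<C>\<^esub> df X (n - i)" if "i \<le> n" for i
    using assms that unfolding chain_map_def by (simp add: Suc_diff_le)
  then show ?thesis using assms unfolding chain_map_def by auto
qed

text \<open>
  Reversing a complex twice only restores the degrees up to \<open>n + 1\<close>, because the subtraction in \<open>opx\<close>
  is truncated.
\<close>

definition cpx_eq :: "nat \<Rightarrow> ('o, 'm) cpx \<Rightarrow> ('o, 'm) cpx \<Rightarrow> bool" where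
  "cpx_eq n X Y \<longleftrightarrow> (\<forall>i\<le>Suc n. ob X i = ob Y i) \<and> (\<forall>i\<le>n. df X i = df Y i)"

lemma opx_opx: "cpx_eq n (opx n (opx n X)) X"
  by (auto simp: cpx_eq_def)

lemma chain_map_cong:
  assumes "cpx_eq n X X'" "cpx_eq n Y Y'" "\<And>i. i \<le> Suc n \<Longrightarrow> f i = g i"
  shows "chain_map n \<C> X Y f \<longleftrightarrow> chain_map n \<C> X' Y' g"
  using assms unfolding chain_map_def cpx_eq_def by auto

lemma rel_cong: "\<lbrakk>cpx_eq n X X'; cpx_eq n Y Y'\<rbrakk> \<Longrightarrow> erel n \<C> X Y a c \<longleftrightarrow> erel n \<C> X' Y' a c"
  unfolding erel_def using chain_map_cong by metis

lemma rel_opx: "erel n \<C> X Y a c \<Longrightarrow> erel n (opc \<C>) (opx n Y) (opx n X) c a"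
  unfolding erel_def by (metis chain_map_opx diff_zero diff_self_eq_0 Suc_eq_plus1)

lemma rel_opx_iff: "erel n (opc \<C>) (opx n Y) (opx n X) c a \<longleftrightarrow> erel n \<C> X Y a c"
  using rel_opx[of n "opc \<C>" "opx n Y" "opx n X" c a] rel_opx[of n \<C> X Y a c]
    rel_cong[OF opx_opx opx_opx, of n \<C> X Y a c] by auto

lemma kernel_cong:
  assumes "cpx_eq n X X'" "n_kernel_seq n \<C> X" shows "n_kernel_seq n \<C> X'"
  using assms unfolding cpx_eq_def n_kernel_seq_def complexes_def by auto

lemma cokernel_cong:
  assumes "cpx_eq n X X'" "n_cokernel_seq n \<C> X" shows "n_cokernel_seq n \<C> X'"
  using assms unfolding cpx_eq_def n_cokernel_seq_def complexes_def by auto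

section \<open>Complexes, chain maps and exactness over an additive category\<close>

locale add_cat_n = additive_category \<C>
  for n :: nat and \<C> :: "('o, 'm) precat" (structure) +
  assumes n_pos: "1 \<le> n"
begin

abbreviation cpxs where "cpxs \<equiv> complexes n \<C>"
abbreviation chm where "chm \<equiv> chain_map n \<C>"
abbreviation rel where "rel \<equiv> erel n \<C>"
abbreviation kerseq where "kerseq \<equiv> n_kernel_seq n \<C>"
abbreviation cokseq where "cokseq \<equiv> n_cokernel_seq n \<C>"
abbreviation exseq where "exseq \<equiv> n_exact_seq n \<C>"
abbreviation cocone where "cocone \<equiv> mcocone n \<C>"
abbreviation cone where "cone \<equiv> mcone n \<C>"
abbreviation cdsum where "cdsum \<equiv> cpx_dsum \<C>"
abbreviation \<D> where "\<D> \<equiv> opc \<C>"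

lemma cpx_simps [simp]:
  assumes "X \<in> cpxs"
  shows "i \<le> Suc n \<Longrightarrow> ob X i \<in> Ob" "i \<le> n \<Longrightarrow> arr (df X i)"
    "i \<le> n \<Longrightarrow> dm (df X i) = ob X i" "i \<le> n \<Longrightarrow> cd (df X i) = ob X (Suc i)"
    "i < n \<Longrightarrow> df X (Suc i) \<cdot> df X i = Zm (ob X i) (ob X (Suc (Suc i)))"
    "\<lbrakk>i < n; arr u; cd u = ob X i\<rbrakk> \<Longrightarrow> df X (Suc i) \<cdot> (df X i \<cdot> u) = Zm (dm u) (ob X (Suc (Suc i)))"
proof -
  show o: "i \<le> Suc n \<Longrightarrow> ob X i \<in> Ob" for i using assms by (auto simp: complexes_def)
  have "df X i \<in> Mor \<C> (ob X i) (ob X (Suc i))" if "i \<le> n" for i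
    using assms that by (auto simp: complexes_def)
  then have d: "arr (df X i) \<and> dm (df X i) = ob X i \<and> cd (df X i) = ob X (Suc i)" if "i \<le> n" for i
    using that o by simp
  show "i \<le> n \<Longrightarrow> arr (df X i)" "i \<le> n \<Longrightarrow> dm (df X i) = ob X i" "i \<le> n \<Longrightarrow> cd (df X i) = ob X (Suc i)"
    using d by auto
  show c: "i < n \<Longrightarrow> df X (Suc i) \<cdot> df X i = Zm (ob X i) (ob X (Suc (Suc i)))"
    using assms by (auto simp: complexes_def)
  show "\<lbrakk>i < n; arr u; cd u = ob X i\<rbrakk> \<Longrightarrow> df X (Suc i) \<cdot> (df X i \<cdot> u) = Zm (dm u) (ob X (Suc (Suc i)))"
    using c d o by (simp flip: comp_assoc)
qed

lemma complexesI:
  assumes "\<And>i. i \<le> Suc n \<Longrightarrow> ob X i \<in> Ob"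
    "\<And>i. i \<le> n \<Longrightarrow> arr (df X i) \<and> dm (df X i) = ob X i \<and> cd (df X i) = ob X (Suc i)"
    "\<And>i. i < n \<Longrightarrow> df X (Suc i) \<cdot> df X i = Zm (ob X i) (ob X (Suc (Suc i)))"
  shows "X \<in> cpxs"
  unfolding complexes_def by (simp add: assms del: cpx_simps)

lemma chm_simps:
  assumes "chm X Y f" "X \<in> cpxs" "Y \<in> cpxs"
  shows "i \<le> Suc n \<Longrightarrow> arr (f i)" "i \<le> Suc n \<Longrightarrow> dm (f i) = ob X i" "i \<le> Suc n \<Longrightarrow> cd (f i) = ob Y i"
    "i \<le> n \<Longrightarrow> f (Suc i) \<cdot> df X i = df Y i \<cdot> f i"
    "\<lbrakk>i \<le> n; arr u; cd u = ob X i\<rbrakk> \<Longrightarrow> f (Suc i) \<cdot> (df X i \<cdot> u) = df Y i \<cdot> (f i \<cdot> u)"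
proof -
  have "f i \<in> Mor \<C> (ob X i) (ob Y i)" if "i \<le> Suc n" for i using assms that by (auto simp: chain_map_def)
  then have t: "arr (f i) \<and> dm (f i) = ob X i \<and> cd (f i) = ob Y i" if "i \<le> Suc n" for i
    using that assms by simp
  then show "i \<le> Suc n \<Longrightarrow> arr (f i)" "i \<le> Suc n \<Longrightarrow> dm (f i) = ob X i" "i \<le> Suc n \<Longrightarrow> cd (f i) = ob Y i"
    by auto
  show c: "i \<le> n \<Longrightarrow> f (Suc i) \<cdot> df X i = df Y i \<cdot> f i" using assms by (auto simp: chain_map_def)
  show "\<lbrakk>i \<le> n; arr u; cd u = ob X i\<rbrakk> \<Longrightarrow> f (Suc i) \<cdot> (df X i \<cdot> u) = df Y i \<cdot> (f i \<cdot> u)"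
    using c t assms by (simp flip: comp_assoc)
qed

lemma chmI:
  assumes "X \<in> cpxs" "Y \<in> cpxs"
    "\<And>i. i \<le> Suc n \<Longrightarrow> arr (f i) \<and> dm (f i) = ob X i \<and> cd (f i) = ob Y i"
    "\<And>i. i \<le> n \<Longrightarrow> f (Suc i) \<cdot> df X i = df Y i \<cdot> f i"
  shows "chm X Y f"
  by (simp add: chain_map_def assms)

lemma chm_id: "X \<in> cpxs \<Longrightarrow> chm X X (\<lambda>i. Id (ob X i))"
  by (rule chmI) auto

lemma chm_comp:
  assumes "chm X Y f" "chm Y Z g"
    "X \<in> cpxs" "Y \<in> cpxs" "Z \<in> cpxs"
  shows "chm X Z (\<lambda>i. g i \<cdot> f i)"
proof -
  note [simp] = assms(3-) chm_simps[OF assms(1,3,4)] chm_simps[OF assms(2,4,5)]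
  show ?thesis by (rule chmI) (auto simp: comp_assoc)
qed

lemma chm_diff:
  assumes "chm X Y f" "chm X Y g" "X \<in> cpxs" "Y \<in> cpxs"
  shows "chm X Y (\<lambda>i. f i \<oplus> neg (g i))"
proof -
  note [simp] = assms(3-) chm_simps[OF assms(1,3,4)] chm_simps[OF assms(2-4)]
  show ?thesis by (rule chmI) (auto simp: comp_add)
qed

lemma ncok_cpx [simp]: "cokseq X \<Longrightarrow> X \<in> cpxs"
  and nker_cpx [simp]: "kerseq X \<Longrightarrow> X \<in> cpxs"
  and nex_cpx [simp]: "exseq X \<Longrightarrow> X \<in> cpxs"
  by (auto simp: n_cokernel_seq_def n_kernel_seq_def n_exact_seq_def)

text \<open>Exactness read on one morphism \<open>y\<close> into an arbitrary object. This form
  keeps Hom groups, kernels and images out of all later arguments.\<close>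

lemma ncok_ex:
  assumes "cokseq X" "i < n" "arr y" "dm y = ob X (Suc i)" "y \<cdot> df X i = Zm (ob X i) (cd y)"
  obtains z where "arr z" "dm z = ob X (Suc (Suc i))" "cd z = cd y" "z \<cdot> df X (Suc i) = y"
proof -
  have X: "X \<in> cpxs" using assms by simp
  have "y \<in> kernel (Hom \<C> (ob X (Suc i)) (cd y)) (Hom \<C> (ob X i) (cd y)) (\<lambda>f. f \<cdot> df X i)"
    using assms X by (simp add: kernel_def)
  then have "y \<in> (\<lambda>f. f \<cdot> df X (Suc i)) ` Mor \<C> (ob X (Suc (Suc i))) (cd y)"
    using assms unfolding n_cokernel_seq_def exact_at_def by (auto dest!: bspec[of _ _ "cd y"])
  then obtain z where z: "z \<in> Mor \<C> (ob X (Suc (Suc i))) (cd y)" "y = z \<cdot> df X (Suc i)" by blast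
  have "arr z \<and> dm z = ob X (Suc (Suc i)) \<and> cd z = cd y" using z(1) X assms(2,3) by simp
  then show ?thesis using that z(2) by blast
qed

lemma ncok_inj:
  assumes "cokseq X" "arr y" "arr z" "dm y = ob X (Suc n)" "dm z = ob X (Suc n)"
    "cd y = cd z" "y \<cdot> df X n = z \<cdot> df X n"
  shows "y = z"
  using assms unfolding n_cokernel_seq_def inj_on_def by (auto dest!: bspec[of _ _ "cd y"])

lemma ncokI:
  assumes X: "X \<in> cpxs"
    and i: "\<And>y. \<lbrakk>arr y; dm y = ob X (Suc n); y \<cdot> df X n = Zm (ob X n) (cd y)\<rbrakk> \<Longrightarrow> y = Zm (ob X (Suc n)) (cd y)"
    and e: "\<And>i y. \<lbrakk>i < n; arr y; dm y = ob X (Suc i); y \<cdot> df X i = Zm (ob X i) (cd y)\<rbrakk>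
       \<Longrightarrow> \<exists>z. arr z \<and> dm z = ob X (Suc (Suc i)) \<and> cd z = cd y \<and> z \<cdot> df X (Suc i) = y"
  shows "cokseq X"
proof -
  have "inj_on (\<lambda>f. f \<cdot> df X n) (Mor \<C> (ob X (n + 1)) W)" if "W \<in> Ob" for W
  proof (rule inj_onI)
    fix y z assume a: "y \<in> Mor \<C> (ob X (n + 1)) W" "z \<in> Mor \<C> (ob X (n + 1)) W" "y \<cdot> df X n = z \<cdot> df X n"
    \<comment> \<open>A trivial kernel suffices for injectivity: it is applied to the
      difference.\<close>
    then have "y \<oplus> neg z = Zm (ob X (Suc n)) (cd (y \<oplus> neg z))"
      using that X by (intro i) (auto simp: comp_add)
    then show "y = z" using a that X eq_zero_iff[of y z] by simp
  qed
  moreover have "exact_at (Hom \<C> (ob X (i+2)) W) (Hom \<C> (ob X (i+1)) W) (Hom \<C> (ob X i) W)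
                 (\<lambda>f. f \<cdot>\<^bsub>\<C>\<^esub> df X (i+1)) (\<lambda>f. f \<cdot>\<^bsub>\<C>\<^esub> df X i)" if "W \<in> Ob" "i < n" for W i
    unfolding exact_at_def
  proof (intro equalityI subsetI)
    fix y assume "y \<in> (\<lambda>f. f \<cdot> df X (i+1)) ` Mor \<C> (ob X (i+2)) W"
    then obtain z where "z \<in> Mor \<C> (ob X (Suc (Suc i))) W" "y = z \<cdot> df X (Suc i)" by auto
    then show "y \<in> kernel (Hom \<C> (ob X (i+1)) W) (Hom \<C> (ob X i) W) (\<lambda>f. f \<cdot> df X i)"
      using that X by (simp add: kernel_def comp_assoc)
  next
    fix y assume "y \<in> kernel (Hom \<C> (ob X (i+1)) W) (Hom \<C> (ob X i) W) (\<lambda>f. f \<cdot> df X i)"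
    then have y: "arr y \<and> dm y = ob X (Suc i) \<and> cd y = W \<and> y \<cdot> df X i = Zm (ob X i) (cd y)"
      using that X by (simp add: kernel_def)
    with e[of i y] that obtain z where
      z: "arr z" "dm z = ob X (Suc (Suc i))" "cd z = cd y" "z \<cdot> df X (Suc i) = y" by blast
    then show "y \<in> (\<lambda>f. f \<cdot> df X (i+1)) ` Mor \<C> (ob X (i+2)) W"
      using y that X by (intro image_eqI[of _ _ z]) simp_all
  qed
  ultimately show ?thesis using X by (auto simp: n_cokernel_seq_def)
qed

lemma nker_ex:
  assumes "kerseq X" "i < n" "arr y" "cd y = ob X (Suc i)"
    "df X (Suc i) \<cdot> y = Zm (dm y) (ob X (Suc (Suc i)))"
  obtains z where "arr z" "cd z = ob X i" "dm z = dm y" "df X i \<cdot> z = y"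
proof -
  have X: "X \<in> cpxs" using assms by simp
  have "y \<in> kernel (Hom \<C> (dm y) (ob X (Suc i))) (Hom \<C> (dm y) (ob X (Suc (Suc i)))) (\<lambda>f. df X (Suc i) \<cdot> f)"
    using assms X by (simp add: kernel_def)
  then have "y \<in> (\<lambda>f. df X i \<cdot> f) ` Mor \<C> (dm y) (ob X i)"
    using assms unfolding n_kernel_seq_def exact_at_def by (auto dest!: bspec[of _ _ "dm y"])
  then obtain z where z: "z \<in> Mor \<C> (dm y) (ob X i)" "y = df X i \<cdot> z" by blast
  have "arr z \<and> cd z = ob X i \<and> dm z = dm y" using z(1) X assms(2,3) by simp
  then show ?thesis using that z(2) by blast
qed

lemma nker_inj:
  assumes "kerseq X" "arr y" "arr z" "cd y = ob X 0" "cd z = ob X 0"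
    "dm y = dm z" "df X 0 \<cdot> y = df X 0 \<cdot> z"
  shows "y = z"
  using assms unfolding n_kernel_seq_def inj_on_def by (auto dest!: bspec[of _ _ "dm y"])

lemma nkerI:
  assumes X: "X \<in> cpxs"
    and i: "\<And>y. \<lbrakk>arr y; cd y = ob X 0; df X 0 \<cdot> y = Zm (dm y) (ob X (Suc 0))\<rbrakk> \<Longrightarrow> y = Zm (dm y) (ob X 0)"
    and e: "\<And>i y. \<lbrakk>i < n; arr y; cd y = ob X (Suc i); df X (Suc i) \<cdot> y = Zm (dm y) (ob X (Suc (Suc i)))\<rbrakk>
       \<Longrightarrow> \<exists>z. arr z \<and> cd z = ob X i \<and> dm z = dm y \<and> df X i \<cdot> z = y"
  shows "kerseq X"
proof -
  have "inj_on (\<lambda>f. df X 0 \<cdot> f) (Mor \<C> W (ob X 0))" if "W \<in> Ob" for W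
  proof (rule inj_onI)
    fix y z assume a: "y \<in> Mor \<C> W (ob X 0)" "z \<in> Mor \<C> W (ob X 0)" "df X 0 \<cdot> y = df X 0 \<cdot> z"
    then have "y \<oplus> neg z = Zm (dm (y \<oplus> neg z)) (ob X 0)"
      using that X by (intro i) (auto simp: comp_add)
    then show "y = z" using a that X eq_zero_iff[of y z] by simp
  qed
  moreover have "exact_at (Hom \<C> W (ob X i)) (Hom \<C> W (ob X (i+1))) (Hom \<C> W (ob X (i+2)))
                 (\<lambda>f. df X i \<cdot>\<^bsub>\<C>\<^esub> f) (\<lambda>f. df X (i+1) \<cdot>\<^bsub>\<C>\<^esub> f)" if "W \<in> Ob" "i < n" for W i
    unfolding exact_at_def
  proof (intro equalityI subsetI)
    fix y assume "y \<in> (\<lambda>f. df X i \<cdot> f) ` Mor \<C> W (ob X i)"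
    then obtain z where "z \<in> Mor \<C> W (ob X i)" "y = df X i \<cdot> z" by auto
    then show "y \<in> kernel (Hom \<C> W (ob X (i+1))) (Hom \<C> W (ob X (i+2))) (\<lambda>f. df X (i+1) \<cdot> f)"
      using that X by (simp add: kernel_def)
  next
    fix y assume "y \<in> kernel (Hom \<C> W (ob X (i+1))) (Hom \<C> W (ob X (i+2))) (\<lambda>f. df X (i+1) \<cdot> f)"
    then have y: "arr y \<and> cd y = ob X (Suc i) \<and> dm y = W \<and> df X (Suc i) \<cdot> y = Zm (dm y) (ob X (Suc (Suc i)))"
      using that X by (simp add: kernel_def)
    with e[of i y] that obtain z where
      z: "arr z" "cd z = ob X i" "dm z = dm y" "df X i \<cdot> z = y" by blast
    then show "y \<in> (\<lambda>f. df X i \<cdot> f) ` Mor \<C> W (ob X i)"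
      using y that X by (intro image_eqI[of _ _ z]) simp_all
  qed
  ultimately show ?thesis using X by (auto simp: n_kernel_seq_def)
qed

end

section \<open>Null homotopies and comparison of exact complexes\<close>

text \<open>A homotopy from \<open>h\<close> to zero with its components exposed. The existential
  \<open>homotopic\<close> would hide them, but later arguments prescribe the first or last
  component and read off the other end.\<close>

definition null_htpy :: "nat \<Rightarrow> ('o, 'm) precat \<Rightarrow> ('o, 'm) cpx \<Rightarrow> ('o, 'm) cpx \<Rightarrow>
    (nat \<Rightarrow> 'm) \<Rightarrow> (nat \<Rightarrow> 'm) \<Rightarrow> bool" where
  "null_htpy n \<C> X Y h \<phi> \<longleftrightarrow> (\<forall>i\<le>n. \<phi> i \<in> Mor \<C> (ob X (Suc i)) (ob Y i)) \<and>
     h 0 = \<phi> 0 \<cdot>\<^bsub>\<C>\<^esub> df X 0 \<and>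
     (\<forall>i<n. h (Suc i) = (df Y i \<cdot>\<^bsub>\<C>\<^esub> \<phi> i) \<otimes>\<^bsub>Hom \<C> (ob X (Suc i)) (ob Y (Suc i))\<^esub>
        (\<phi> (Suc i) \<cdot>\<^bsub>\<C>\<^esub> df X (Suc i))) \<and>
     h (Suc n) = df Y n \<cdot>\<^bsub>\<C>\<^esub> \<phi> n"

context add_cat_n
begin

lemma add_cat_n_opc: "add_cat_n n \<D>"
  using n_pos additive_category_opc additive_category_axioms
  by (simp add: add_cat_n_def add_cat_n_axioms_def)

lemma null_htpyD:
  assumes "null_htpy n \<C> X Y h \<phi>" "X \<in> cpxs" "Y \<in> cpxs"
  shows "i \<le> n \<Longrightarrow> arr (\<phi> i)" "i \<le> n \<Longrightarrow> dm (\<phi> i) = ob X (Suc i)" "i \<le> n \<Longrightarrow> cd (\<phi> i) = ob Y i"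
    "h 0 = \<phi> 0 \<cdot> df X 0"
    "i < n \<Longrightarrow> h (Suc i) = df Y i \<cdot> \<phi> i \<oplus> \<phi> (Suc i) \<cdot> df X (Suc i)"
    "h (Suc n) = df Y n \<cdot> \<phi> n"
proof -
  have t: "arr (\<phi> i) \<and> dm (\<phi> i) = ob X (Suc i) \<and> cd (\<phi> i) = ob Y i" if "i \<le> n" for i
  proof -
    have "\<phi> i \<in> Mor \<C> (ob X (Suc i)) (ob Y i)" using assms(1) that by (simp add: null_htpy_def)
    then show ?thesis using assms(2,3) that by simp
  qed
  then show "i \<le> n \<Longrightarrow> arr (\<phi> i)" "i \<le> n \<Longrightarrow> dm (\<phi> i) = ob X (Suc i)" "i \<le> n \<Longrightarrow> cd (\<phi> i) = ob Y i"
    by auto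
  show "h 0 = \<phi> 0 \<cdot> df X 0" "h (Suc n) = df Y n \<cdot> \<phi> n" using assms(1) by (simp_all add: null_htpy_def)
  show "i < n \<Longrightarrow> h (Suc i) = df Y i \<cdot> \<phi> i \<oplus> \<phi> (Suc i) \<cdot> df X (Suc i)"
    using assms t by (simp add: null_htpy_def)
qed

lemma null_htpyI:
  assumes "X \<in> cpxs" "Y \<in> cpxs"
    "\<And>i. i \<le> n \<Longrightarrow> arr (\<phi> i) \<and> dm (\<phi> i) = ob X (Suc i) \<and> cd (\<phi> i) = ob Y i"
    "h 0 = \<phi> 0 \<cdot> df X 0"
    "\<And>i. i < n \<Longrightarrow> h (Suc i) = df Y i \<cdot> \<phi> i \<oplus> \<phi> (Suc i) \<cdot> df X (Suc i)"
    "h (Suc n) = df Y n \<cdot> \<phi> n"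
  shows "null_htpy n \<C> X Y h \<phi>"
  unfolding null_htpy_def by (simp add: assms)

text \<open>The usual comparison argument: once \<open>s\<close> handles degree 0, what remains in
  each degree kills the preceding differential of \<open>Q\<close> and so factors through the next
  one.\<close>

lemma null_htpy_up:
  assumes Q: "cokseq Q" and X: "X \<in> cpxs" and h: "chm Q X h"
    and s: "arr s" "dm s = ob Q 1" "cd s = ob X 0" "h 0 = s \<cdot> df Q 0"
  obtains \<phi> where "null_htpy n \<C> Q X h \<phi>" "\<phi> 0 = s"
proof -
  have Qc: "Q \<in> cpxs" using Q by simp
  note [simp] = X Qc chm_simps(1-3)[OF h Qc X]
  \<comment> \<open>The last conjunct is what survives of the homotopy equation in degree
    \<open>k\<close> after composing with \<open>df X k\<close>, where the summand coming from the
    preceding homotopy component drops out. It makes the next remainder vanish on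
    \<open>df Q k\<close>.\<close>
  have *: "\<exists>\<phi>. \<phi> 0 = s \<and> (\<forall>i\<le>k. arr (\<phi> i) \<and> dm (\<phi> i) = ob Q (Suc i) \<and> cd (\<phi> i) = ob X i) \<and>
     (\<forall>i<k. h (Suc i) = df X i \<cdot> \<phi> i \<oplus> \<phi> (Suc i) \<cdot> df Q (Suc i)) \<and>
     df X k \<cdot> h k = df X k \<cdot> (\<phi> k \<cdot> df Q k)" if "k \<le> n" for k
    using that
  proof (induction k)
    case 0
    show ?case by (rule exI[of _ "\<lambda>_. s"]) (use s in auto)
  next
    case (Suc k)
    then obtain \<phi> where \<phi>: "\<phi> 0 = s"
      "\<And>i. i \<le> k \<Longrightarrow> arr (\<phi> i) \<and> dm (\<phi> i) = ob Q (Suc i) \<and> cd (\<phi> i) = ob X i"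
      "\<And>i. i < k \<Longrightarrow> h (Suc i) = df X i \<cdot> \<phi> i \<oplus> \<phi> (Suc i) \<cdot> df Q (Suc i)"
      "df X k \<cdot> h k = df X k \<cdot> (\<phi> k \<cdot> df Q k)" by auto
    have kn: "k < n" and [simp]: "k \<le> n" using Suc by auto
    have [simp]: "arr (\<phi> k)" "dm (\<phi> k) = ob Q (Suc k)" "cd (\<phi> k) = ob X k" using \<phi>(2)[of k] by auto
    \<comment> \<open>What the next homotopy component has to account for.\<close>
    define r where "r = h (Suc k) \<oplus> neg (df X k \<cdot> \<phi> k)"
    have r: "arr r" "dm r = ob Q (Suc k)" "cd r = ob X (Suc k)" using kn by (simp_all add: r_def)
    have "r \<cdot> df Q k = df X k \<cdot> h k \<oplus> neg (df X k \<cdot> (\<phi> k \<cdot> df Q k))"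
      using kn chm_simps(4)[OF h Qc X, of k] by (simp add: r_def comp_add comp_assoc)
    also have "\<dots> = Zm (ob Q k) (cd r)" using \<phi>(4) kn r by simp
    finally obtain t where t: "arr t" "dm t = ob Q (Suc (Suc k))" "cd t = ob X (Suc k)" "t \<cdot> df Q (Suc k) = r"
      using ncok_ex[OF Q kn r(1,2)] r(3) by metis
    have e: "h (Suc k) = df X k \<cdot> \<phi> k \<oplus> t \<cdot> df Q (Suc k)"
      using kn by (simp add: t(4) eq_add_iff r) (simp add: r_def)
    have c: "df X (Suc k) \<cdot> h (Suc k) = df X (Suc k) \<cdot> (t \<cdot> df Q (Suc k))"
      unfolding e using kn t(1-3) Suc.prems by (simp add: comp_add)
    have "\<forall>i<Suc k. h (Suc i) = df X i \<cdot> (\<phi>(Suc k := t)) i \<oplus> (\<phi>(Suc k := t)) (Suc i) \<cdot> df Q (Suc i)"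
      using \<phi>(3) e by (auto simp: less_Suc_eq)
    then show ?case using \<phi>(1,2) t c by (intro exI[of _ "\<phi>(Suc k := t)"]) (auto simp: le_Suc_eq)
  qed
  obtain \<phi> where \<phi>: "\<phi> 0 = s"
      "\<And>i. i \<le> n \<Longrightarrow> arr (\<phi> i) \<and> dm (\<phi> i) = ob Q (Suc i) \<and> cd (\<phi> i) = ob X i"
      "\<And>i. i < n \<Longrightarrow> h (Suc i) = df X i \<cdot> \<phi> i \<oplus> \<phi> (Suc i) \<cdot> df Q (Suc i)"
      "df X n \<cdot> h n = df X n \<cdot> (\<phi> n \<cdot> df Q n)" using *[of n] by auto
  \<comment> \<open>In degree n+1 there is no further component to choose; injectivity of
    precomposition with \<open>df Q n\<close> gives the equation.\<close>
  have "h (Suc n) \<cdot> df Q n = df X n \<cdot> \<phi> n \<cdot> df Q n"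
    using \<phi>(2)[of n] \<phi>(4) chm_simps(4)[OF h Qc X, of n] by (simp add: comp_assoc)
  then have "h (Suc n) = df X n \<cdot> \<phi> n" using ncok_inj[OF Q] \<phi>(2)[of n] by simp
  then show ?thesis using \<phi> s X Qc by (intro that[of \<phi>] null_htpyI) auto
qed

text \<open>The same induction as for homotopies: \<open>df X (Suc k) \<cdot> f (Suc k)\<close>
  vanishes on \<open>df Q k\<close> and hence extends over \<open>df Q (Suc k)\<close>.\<close>

lemma chm_extend_up:
  assumes Q: "cokseq Q" and X: "X \<in> cpxs"
    and a: "arr a" "dm a = ob Q 0" "cd a = ob X 0" and b: "arr b" "dm b = ob Q 1" "cd b = ob X 1"
    and ab: "b \<cdot> df Q 0 = df X 0 \<cdot> a"
  obtains f where "chm Q X f" "f 0 = a" "f 1 = b"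
proof -
  have Qc: "Q \<in> cpxs" using Q by simp
  note [simp] = X Qc
  have *: "\<exists>f. f 0 = a \<and> f 1 = b \<and> (\<forall>i\<le>Suc k. arr (f i) \<and> dm (f i) = ob Q i \<and> cd (f i) = ob X i) \<and>
     (\<forall>i\<le>k. f (Suc i) \<cdot> df Q i = df X i \<cdot> f i)" if "k \<le> n" for k
    using that
  proof (induction k)
    case 0
    show ?case by (rule exI[of _ "\<lambda>i. if i = 0 then a else b"]) (use a b ab in \<open>auto simp: le_Suc_eq\<close>)
  next
    case (Suc k)
    then obtain f where f: "f 0 = a" "f 1 = b"
      "\<And>i. i \<le> Suc k \<Longrightarrow> arr (f i) \<and> dm (f i) = ob Q i \<and> cd (f i) = ob X i"
      "\<And>i. i \<le> k \<Longrightarrow> f (Suc i) \<cdot> df Q i = df X i \<cdot> f i" by auto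
    have kn: "k < n" using Suc by auto
    have "df X (Suc k) \<cdot> f (Suc k) \<cdot> df Q k = df X (Suc k) \<cdot> (df X k \<cdot> f k)"
      using f(3)[of "Suc k"] f(4)[of k] kn by (simp add: comp_assoc)
    also have "\<dots> = Zm (ob Q k) (ob X (Suc (Suc k)))" using f(3)[of k] kn by simp
    finally obtain t where t: "arr t" "dm t = ob Q (Suc (Suc k))" "cd t = ob X (Suc (Suc k))"
        "t \<cdot> df Q (Suc k) = df X (Suc k) \<cdot> f (Suc k)"
      using ncok_ex[OF Q kn, of "df X (Suc k) \<cdot> f (Suc k)"] f(3)[of "Suc k"] kn by auto
    have "(f(Suc (Suc k) := t)) (Suc i) \<cdot> df Q i = df X i \<cdot> (f(Suc (Suc k) := t)) i" if "i \<le> Suc k" for i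
      using that f(4)[of i] t(4) by (auto simp: le_Suc_eq)
    then show ?case using f t by (intro exI[of _ "f(Suc (Suc k) := t)"]) (auto simp: le_Suc_eq)
  qed
  obtain f where "f 0 = a \<and> f 1 = b \<and> (\<forall>i\<le>Suc n. arr (f i) \<and> dm (f i) = ob Q i \<and> cd (f i) = ob X i) \<and>
     (\<forall>i\<le>n. f (Suc i) \<cdot> df Q i = df X i \<cdot> f i)" using *[of n] by auto
  then show ?thesis using X Qc by (intro that[of f] chmI) auto
qed

lemma homotopic_idD:
  assumes "homotopic n \<C> X X g (\<lambda>i. Id (ob X i))" "X \<in> cpxs"
  obtains \<phi> where "\<And>i. i \<le> n \<Longrightarrow> arr (\<phi> i)" "\<And>i. i \<le> n \<Longrightarrow> dm (\<phi> i) = ob X (Suc i)"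
    "\<And>i. i \<le> n \<Longrightarrow> cd (\<phi> i) = ob X i"
    "\<And>i. i < n \<Longrightarrow> g (Suc i) = Id (ob X (Suc i)) \<oplus> (df X i \<cdot> \<phi> i \<oplus> \<phi> (Suc i) \<cdot> df X (Suc i))"
proof -
  note [simp] = assms(2)
  obtain \<phi> where \<phi>: "\<forall>i\<le>n. \<phi> i \<in> Mor \<C> (ob X (i+1)) (ob X i)"
    "\<forall>i<n. g (i+1) = Id (ob X (i+1)) \<otimes>\<^bsub>Hom \<C> (ob X (i+1)) (ob X (i+1))\<^esub>
           ((df X i \<cdot> \<phi> i) \<otimes>\<^bsub>Hom \<C> (ob X (i+1)) (ob X (i+1))\<^esub> (\<phi> (i+1) \<cdot> df X (i+1)))"
    using assms(1) unfolding homotopic_def by blast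
  have t: "arr (\<phi> i) \<and> dm (\<phi> i) = ob X (Suc i) \<and> cd (\<phi> i) = ob X i" if "i \<le> n" for i
    using \<phi>(1) that by auto
  moreover have "g (Suc i) = Id (ob X (Suc i)) \<oplus> (df X i \<cdot> \<phi> i \<oplus> \<phi> (Suc i) \<cdot> df X (Suc i))" if "i < n" for i
    using \<phi>(2) that t[of i] t[of "Suc i"] by simp
  ultimately show ?thesis using that by blast
qed

text \<open>A cocycle \<open>y\<close> composed with \<beta> extends over the next term of
  \<open>Z\<close>; composing with \<alpha> extends \<open>y\<close> up to a homotopy term, which is
  then subtracted. In the last degree \<open>top\<close> recovers \<open>y\<close> from its
  composite with \<beta>.\<close>

lemma transfer_cok:
  assumes X: "X \<in> cpxs" and Z: "cokseq Z"
    and \<alpha>: "chm X Z \<alpha>" and \<beta>: "chm Z X \<beta>"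
    and hom: "homotopic n \<C> X X (\<lambda>i. \<beta> i \<cdot> \<alpha> i) (\<lambda>i. Id (ob X i))"
    and top: "\<beta> (Suc n) \<cdot> \<alpha> (Suc n) = Id (ob X (Suc n))"
  shows "cokseq X"
proof -
  have Zc: "Z \<in> cpxs" using Z by simp
  note [simp] = X Zc chm_simps(1-3)[OF \<alpha> X Zc] chm_simps(1-3)[OF \<beta> Zc X]
  obtain \<phi> where [simp]: "\<And>i. i \<le> n \<Longrightarrow> arr (\<phi> i)" "\<And>i. i \<le> n \<Longrightarrow> dm (\<phi> i) = ob X (Suc i)"
    "\<And>i. i \<le> n \<Longrightarrow> cd (\<phi> i) = ob X i"
    and \<phi>: "\<And>i. i < n \<Longrightarrow> \<beta> (Suc i) \<cdot> \<alpha> (Suc i) = Id (ob X (Suc i)) \<oplus> (df X i \<cdot> \<phi> i \<oplus> \<phi> (Suc i) \<cdot> df X (Suc i))"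
    using homotopic_idD[OF hom X] by metis
  show ?thesis
  proof (rule ncokI[OF X])
    fix y assume y [simp]: "arr y" "dm y = ob X (Suc n)" and yd: "y \<cdot> df X n = Zm (ob X n) (cd y)"
    have "y \<cdot> \<beta> (Suc n) \<cdot> df Z n = Zm (ob Z n) (cd y)"
      by (simp add: comp_assoc chm_simps(4)[OF \<beta> Zc X]) (simp add: yd flip: comp_assoc)
    also have "\<dots> = Zm (ob Z (Suc n)) (cd y) \<cdot> df Z n" by simp
    finally have "y \<cdot> \<beta> (Suc n) = Zm (ob Z (Suc n)) (cd y)" by (rule ncok_inj[OF Z, rotated -1]) simp_all
    then have "y \<cdot> \<beta> (Suc n) \<cdot> \<alpha> (Suc n) = Zm (ob X (Suc n)) (cd y)" by simp
    then show "y = Zm (ob X (Suc n)) (cd y)" using top by (simp add: comp_assoc)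
  next
    fix i y assume i: "i < n" and y [simp]: "arr y" "dm y = ob X (Suc i)" and yd: "y \<cdot> df X i = Zm (ob X i) (cd y)"
    have "y \<cdot> \<beta> (Suc i) \<cdot> df Z i = Zm (ob Z i) (cd (y \<cdot> \<beta> (Suc i)))"
      using i by (simp add: comp_assoc chm_simps(4)[OF \<beta> Zc X]) (simp add: yd flip: comp_assoc)
    then obtain z where z [simp]: "arr z" "dm z = ob Z (Suc (Suc i))" "cd z = cd y"
       and zd: "z \<cdot> df Z (Suc i) = y \<cdot> \<beta> (Suc i)"
      using ncok_ex[OF Z i, of "y \<cdot> \<beta> (Suc i)"] i by auto
    have ydu: "y \<cdot> (df X i \<cdot> u) = Zm (dm u) (cd y)" if "arr u" "cd u = ob X i" for u
      using that i yd by (simp flip: comp_assoc)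
    \<comment> \<open>As \<open>y\<close> kills \<open>df X i\<close>, the homotopy gives
      \<open>y \<beta> \<alpha> = y + y \<phi> d\<close>; the subtracted term cancels the second
      summand.\<close>
    let ?z = "z \<cdot> \<alpha> (Suc (Suc i)) \<oplus> neg (y \<cdot> \<phi> (Suc i))"
    have "y \<oplus> y \<cdot> (\<phi> (Suc i) \<cdot> df X (Suc i)) = y \<cdot> (\<beta> (Suc i) \<cdot> \<alpha> (Suc i))"
      using i by (simp add: \<phi> comp_add ydu)
    also have "\<dots> = z \<cdot> df Z (Suc i) \<cdot> \<alpha> (Suc i)" using i by (simp add: zd comp_assoc)
    also have "\<dots> = z \<cdot> (\<alpha> (Suc (Suc i)) \<cdot> df X (Suc i))" using i by (simp add: comp_assoc chm_simps(4)[OF \<alpha> X Zc])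
    finally have "y \<cdot> (\<phi> (Suc i) \<cdot> df X (Suc i)) \<oplus> y = z \<cdot> (\<alpha> (Suc (Suc i)) \<cdot> df X (Suc i))"
      using i by (subst add_comm) simp_all
    then have "?z \<cdot> df X (Suc i) = y"
      using i eq_add_iff[of "z \<cdot> (\<alpha> (Suc (Suc i)) \<cdot> df X (Suc i))" "y \<cdot> (\<phi> (Suc i) \<cdot> df X (Suc i))" y]
      by (simp add: comp_add comp_assoc)
    moreover have "arr ?z \<and> dm ?z = ob X (Suc (Suc i)) \<and> cd ?z = cd y" using i by simp
    ultimately show "\<exists>z. arr z \<and> dm z = ob X (Suc (Suc i)) \<and> cd z = cd y \<and> z \<cdot> df X (Suc i) = y" by blast
  qed
qed

text \<open>Typing facts in the opposite category reduce to those of \<C>, so the side conditions of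
  dualized lemmas fall to the same simplification rules.\<close>

lemma opc_arr [simp]: "additive_category.arr \<D> f \<longleftrightarrow> arr f"
  and opc_dm [simp]: "additive_category.dm \<D> f = cd f"
  and opc_cd [simp]: "additive_category.cd \<D> f = dm f"
  unfolding additive_category.arr_def[OF additive_category_opc[OF additive_category_axioms]]
    additive_category.dm_def[OF additive_category_opc[OF additive_category_axioms]]
    additive_category.cd_def[OF additive_category_opc[OF additive_category_axioms]]
    arr_def dm_def cd_def opc_simps by blast+

lemma null_htpy_opx:
  assumes n: "null_htpy n \<D> (opx n Y) (opx n X) (\<lambda>i. h (Suc n - i)) \<phi>"
    and X [simp]: "X \<in> cpxs" and Y [simp]: "Y \<in> cpxs"
  shows "null_htpy n \<C> X Y h (\<lambda>i. \<phi> (n - i))"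
proof -
  have "\<phi> i \<in> Mor \<C> (ob X (Suc n - i)) (ob Y (n - i))" if "i \<le> n" for i
    using n that unfolding null_htpy_def by simp
  then have t [simp]: "arr (\<phi> i)" "dm (\<phi> i) = ob X (Suc (n - i))" "cd (\<phi> i) = ob Y (n - i)" if "i \<le> n" for i
    using that by (simp_all add: Suc_diff_le)
  show ?thesis
  proof (rule null_htpyI[OF X Y])
    show "h 0 = \<phi> (n - 0) \<cdot> df X 0" "h (Suc n) = df Y n \<cdot> \<phi> (n - n)"
      using n unfolding null_htpy_def by simp_all
    fix i assume i: "i < n"
    \<comment> \<open>Degree \<open>Suc i\<close> of \<open>h\<close> is degree
      \<open>Suc ?j\<close> of the reversed map. Reversal also exchanges the two summands of the
      homotopy equation, hence the commutation at the end.\<close>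
    let ?j = "n - Suc i"
    have j: "?j < n" "Suc ?j = n - i" "n - ?j = Suc i" "n - (n - i) = i" "Suc n - (n - i) = Suc i" "Suc n - ?j = Suc (Suc i)"
      using i by auto
    have "h (Suc n - Suc ?j) = (\<phi> ?j \<cdot> df X (n - ?j)) \<otimes>\<^bsub>Hom \<C> (ob X (n - ?j)) (ob Y (n - ?j))\<^esub>
        (df Y (n - Suc ?j) \<cdot> \<phi> (Suc ?j))"
      using n j(1) unfolding null_htpy_def by simp
    then have "h (Suc i) = (\<phi> ?j \<cdot> df X (Suc i)) \<otimes>\<^bsub>Hom \<C> (ob X (Suc i)) (ob Y (Suc i))\<^esub>
        (df Y i \<cdot> \<phi> (n - i))"
      unfolding j .
    also have "\<dots> = \<phi> ?j \<cdot> df X (Suc i) \<oplus> df Y i \<cdot> \<phi> (n - i)"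
      using i t[of "n - Suc i"] t[of "n - i"] j by simp
    also have "\<dots> = df Y i \<cdot> \<phi> (n - i) \<oplus> \<phi> ?j \<cdot> df X (Suc i)"
      using i t[of "n - Suc i"] t[of "n - i"] j by (intro add_comm) simp_all
    finally show "h (Suc i) = df Y i \<cdot> \<phi> (n - i) \<oplus> \<phi> (n - Suc i) \<cdot> df X (Suc i)" .
  qed simp
qed

text \<open>This is \<open>null_htpy_up\<close> for the reversed map from \<open>opx n Y\<close> to
  \<open>opx n X\<close>, where the top component becomes the first one.\<close>

lemma null_htpy_down:
  assumes Y: "kerseq Y" and X: "X \<in> cpxs" and h: "chm X Y h"
    and s: "arr s" "dm s = ob X (Suc n)" "cd s = ob Y n" "h (Suc n) = df Y n \<cdot> s"
  obtains \<phi> where "null_htpy n \<C> X Y h \<phi>" "\<phi> n = s"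
proof -
  obtain \<phi> where "null_htpy n \<D> (opx n Y) (opx n X) (\<lambda>i. h (Suc n - i)) \<phi>" "\<phi> 0 = s"
    by (rule add_cat_n.null_htpy_up[OF add_cat_n_opc exact_opx[OF Y] complexes_opx[OF X] chain_map_opx[OF h], of s])
      (use s in auto)
  then show ?thesis using that null_htpy_opx[of Y X h \<phi>] X Y by simp
qed

lemma chm_extend_down:
  assumes Y: "kerseq Y" and X: "X \<in> cpxs"
    and a: "arr a" "dm a = ob X n" "cd a = ob Y n" and b: "arr b" "dm b = ob X (Suc n)" "cd b = ob Y (Suc n)"
    and ab: "b \<cdot> df X n = df Y n \<cdot> a"
  obtains f where "chm X Y f" "f n = a" "f (Suc n) = b"
proof -
  obtain f where f: "chain_map n \<D> (opx n Y) (opx n X) f" "f 0 = b" "f 1 = a"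
    by (rule add_cat_n.chm_extend_up[OF add_cat_n_opc exact_opx[OF Y] complexes_opx[OF X], of b a])
      (use a b ab in auto)
  have "chm X Y (\<lambda>i. f (Suc n - i))"
    using chain_map_opx[OF f(1)] chain_map_cong[OF opx_opx opx_opx refl] by fastforce
  then show ?thesis using that f by force
qed

lemma homotopic_opx:
  assumes "homotopic n \<C> X Y f g" "X \<in> cpxs" "Y \<in> cpxs"
  shows "homotopic n \<D> (opx n Y) (opx n X) (\<lambda>i. f (Suc n - i)) (\<lambda>i. g (Suc n - i))"
proof -
  note [simp] = assms(2,3)
  obtain \<phi> where \<phi>: "\<forall>i\<le>n. \<phi> i \<in> Mor \<C> (ob X (i+1)) (ob Y i)"
    "f 0 = g 0 \<otimes>\<^bsub>Hom \<C> (ob X 0) (ob Y 0)\<^esub> (\<phi> 0 \<cdot> df X 0)"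
    "\<forall>i<n. f (i+1) = g (i+1) \<otimes>\<^bsub>Hom \<C> (ob X (i+1)) (ob Y (i+1))\<^esub>
           ((df Y i \<cdot> \<phi> i) \<otimes>\<^bsub>Hom \<C> (ob X (i+1)) (ob Y (i+1))\<^esub> (\<phi> (i+1) \<cdot> df X (i+1)))"
    "f (n+1) = g (n+1) \<otimes>\<^bsub>Hom \<C> (ob X (n+1)) (ob Y (n+1))\<^esub> (df Y n \<cdot> \<phi> n)"
    using assms(1) unfolding homotopic_def by blast
  have t [simp]: "arr (\<phi> i)" "dm (\<phi> i) = ob X (Suc i)" "cd (\<phi> i) = ob Y i" if "i \<le> n" for i
    using \<phi>(1) that by auto
  have "f (n - i) = g (n - i) \<otimes>\<^bsub>Hom \<C> (ob X (n - i)) (ob Y (n - i))\<^esub>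
      ((\<phi> (n - i) \<cdot> df X (n - i)) \<otimes>\<^bsub>Hom \<C> (ob X (n - i)) (ob Y (n - i))\<^esub> (df Y (n - Suc i) \<cdot> \<phi> (n - Suc i)))"
    if i: "i < n" for i
  proof -
    obtain j where j: "n - i = Suc j" "n - Suc i = j" "j < n"
      using i by (metis Suc_diff_Suc diff_Suc_less gr_implies_not0 not_gr_zero)
    have "(df Y j \<cdot> \<phi> j) \<oplus> (\<phi> (Suc j) \<cdot> df X (Suc j)) = (\<phi> (Suc j) \<cdot> df X (Suc j)) \<oplus> (df Y j \<cdot> \<phi> j)"
      using j(3) by (intro add_comm) simp_all
    then show ?thesis unfolding j using \<phi>(3) j(3) by simp
  qed
  then show ?thesis unfolding homotopic_def
    by (intro exI[of _ "\<lambda>i. \<phi> (n - i)"]) (use \<phi>(2,4) in \<open>auto simp: Suc_diff_le\<close>)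
qed

lemma transfer_ker:
  assumes X: "X \<in> cpxs" and Z: "kerseq Z"
    and \<alpha>: "chm X Z \<alpha>" and \<beta>: "chm Z X \<beta>"
    and hom: "homotopic n \<C> X X (\<lambda>i. \<beta> i \<cdot> \<alpha> i) (\<lambda>i. Id (ob X i))"
    and bot: "\<beta> 0 \<cdot> \<alpha> 0 = Id (ob X 0)"
  shows "kerseq X"
proof -
  have "n_cokernel_seq n \<D> (opx n X)"
    by (rule add_cat_n.transfer_cok[OF add_cat_n_opc complexes_opx[OF X] exact_opx[OF Z]
          chain_map_opx[OF \<beta>] chain_map_opx[OF \<alpha>]])
      (use homotopic_opx[OF hom X X] bot in auto)
  then show ?thesis using kernel_cong[OF opx_opx] coexact_opx[of n "\<D>"] by fastforce
qed

lemma homotopic_of_null_htpy: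
  assumes N: "null_htpy n \<C> X Y (\<lambda>i. f i \<oplus> neg (g i)) \<phi>" and f: "chm X Y f" and g: "chm X Y g"
    and X: "X \<in> cpxs" and Y: "Y \<in> cpxs"
  shows "homotopic n \<C> X Y f g"
proof -
  note [simp] = X Y chm_simps(1-3)[OF f X Y] chm_simps(1-3)[OF g X Y] null_htpyD(1-3)[OF N X Y]
  note e = null_htpyD(4-6)[OF N X Y]
  have *: "f i = g i \<oplus> h" if "f i \<oplus> neg (g i) = h" "i \<le> Suc n" for i h
  proof -
    have "arr h" "dm h = ob X i" "cd h = ob Y i" using that by auto
    then show ?thesis using that eq_add_iff[of "f i" "g i" h] by simp
  qed
  show ?thesis unfolding homotopic_def
  proof (intro exI[of _ \<phi>] conjI allI impI)
    show "f 0 = g 0 \<otimes>\<^bsub>Hom \<C> (ob X 0) (ob Y 0)\<^esub> (\<phi> 0 \<cdot> df X 0)" using *[OF e(1)] by simp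
    show "f (n+1) = g (n+1) \<otimes>\<^bsub>Hom \<C> (ob X (n+1)) (ob Y (n+1))\<^esub> (df Y n \<cdot> \<phi> n)"
      using *[OF e(3)] by simp
    fix i assume "i < n"
    then show "f (i+1) = g (i+1) \<otimes>\<^bsub>Hom \<C> (ob X (i+1)) (ob Y (i+1))\<^esub>
           ((df Y i \<cdot> \<phi> i) \<otimes>\<^bsub>Hom \<C> (ob X (i+1)) (ob Y (i+1))\<^esub> (\<phi> (i+1) \<cdot> df X (i+1)))"
      using *[OF e(2)] by simp
  qed simp
qed

text \<open>Repairs a weakness of (E2op), which only says that the last map is admissible. Two
  n-kernel sequences with the same last map have chain maps both ways that are identities in degrees
  n and n+1; the composite on \<open>X\<close> is homotopic to the identity, and so the cokernel
  property moves from \<open>Z\<close> to \<open>X\<close>.\<close>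

lemma kernel_swap:
  assumes X: "kerseq X" and Z: "exseq Z"
    and eq: "df X n = df Z n" "ob X n = ob Z n" "ob X (Suc n) = ob Z (Suc n)"
  obtains \<alpha> where "exseq X" "chm X Z \<alpha>" "\<alpha> n = Id (ob X n)" "\<alpha> (Suc n) = Id (ob X (Suc n))"
proof -
  have Zk: "kerseq Z" and Zc: "cokseq Z" using Z by (auto simp: n_exact_seq_def)
  have Xc: "X \<in> cpxs" and Zx: "Z \<in> cpxs" using X Z by simp_all
  note [simp] = Xc Zx
  obtain \<alpha> where \<alpha>: "chm X Z \<alpha>" "\<alpha> n = Id (ob X n)" "\<alpha> (Suc n) = Id (ob X (Suc n))"
    by (rule chm_extend_down[OF Zk Xc, of "Id (ob X n)" "Id (ob X (Suc n))"]) (use eq in auto)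
  obtain \<beta> where \<beta>: "chm Z X \<beta>" "\<beta> n = Id (ob X n)" "\<beta> (Suc n) = Id (ob X (Suc n))"
    by (rule chm_extend_down[OF X Zx, of "Id (ob X n)" "Id (ob X (Suc n))"]) (use eq in auto)
  note c = chm_comp[OF \<alpha>(1) \<beta>(1) Xc Zx Xc]
  \<comment> \<open>The composite is the identity in degree n+1, so the homotopy may start there
    from zero.\<close>
  obtain \<phi> where "null_htpy n \<C> X X (\<lambda>i. \<beta> i \<cdot> \<alpha> i \<oplus> neg (Id (ob X i))) \<phi>"
    by (rule null_htpy_down[OF X Xc chm_diff[OF c chm_id[OF Xc] Xc Xc], of "Zm (ob X (Suc n)) (ob X n)"])
       (use \<alpha> \<beta> in auto)
  from homotopic_of_null_htpy[OF this c chm_id[OF Xc] Xc Xc]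
  have "cokseq X"
    by (rule transfer_cok[OF Xc Zc \<alpha>(1) \<beta>(1)]) (use \<alpha> \<beta> in auto)
  then show ?thesis using X \<alpha> that by (simp add: n_exact_seq_def)
qed

text \<open>With fixed end terms the composite is strictly the identity in degrees 0 and n+1, which
  is what the two transfer lemmas ask for beyond the homotopy.\<close>

lemma n_exact_htpy:
  assumes X: "exseq X" and Y: "Y \<in> complexes_betw n \<C> (ob X 0) (ob X (n+1))"
    and "htpy_equiv_betw n \<C> X Y"
  shows "exseq Y"
proof -
  obtain f g where fg: "chm X Y f" "chm Y X g"
    "f 0 = Id (ob X 0)" "f (Suc n) = Id (ob X (Suc n))" "g 0 = Id (ob Y 0)" "g (Suc n) = Id (ob Y (Suc n))"
    "homotopic n \<C> Y Y (\<lambda>i. f i \<cdot> g i) (\<lambda>i. Id (ob Y i))"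
    using assms(3) unfolding htpy_equiv_betw_def chain_map_betw_def by auto
  have Yc: "Y \<in> cpxs" "ob Y 0 = ob X 0" "ob Y (Suc n) = ob X (Suc n)"
    using Y by (auto simp: complexes_betw_def)
  have Xc: "X \<in> cpxs" using X by simp
  have "cokseq Y"
    by (rule transfer_cok[OF Yc(1) _ fg(2,1,7)]) (use X Xc fg Yc in \<open>auto simp: n_exact_seq_def\<close>)
  moreover have "kerseq Y"
    by (rule transfer_ker[OF Yc(1) _ fg(2,1,7)]) (use X Xc fg Yc in \<open>auto simp: n_exact_seq_def\<close>)
  ultimately show ?thesis by (simp add: n_exact_seq_def)
qed

section \<open>Mapping cones\<close>

text \<open>The degrees \<open>1, \<dots>, n + 1\<close> of a chain map; axiom (E2\<open>\<^sup>o\<^sup>p\<close>) provides no degree \<open>0\<close>.\<close>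

definition pullback_data :: "('o, 'm) cpx \<Rightarrow> ('o, 'm) cpx \<Rightarrow> (nat \<Rightarrow> 'm) \<Rightarrow> bool" where
  "pullback_data X Y f \<longleftrightarrow> (\<forall>i. 1 \<le> i \<and> i \<le> n+1 \<longrightarrow>
        ob X i \<in> Ob \<and> ob Y i \<in> Ob \<and> f i \<in> Mor \<C> (ob X i) (ob Y i)) \<and>
     (\<forall>i. 1 \<le> i \<and> i \<le> n \<longrightarrow>
        df X i \<in> Mor \<C> (ob X i) (ob X (i+1)) \<and> df Y i \<in> Mor \<C> (ob Y i) (ob Y (i+1)) \<and>
        f (i+1) \<cdot> df X i = df Y i \<cdot> f i)"

lemma n_pullback_iff: "n_pullback n \<C> X Y f \<longleftrightarrow> pullback_data X Y f \<and> kerseq (cone X Y f)"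
  by (auto simp only: n_pullback_def pullback_data_def)

lemma pullback_data_obj:
  assumes "pullback_data X Y f" "1 \<le> i" "i \<le> Suc n"
  shows "ob X i \<in> Ob \<and> ob Y i \<in> Ob \<and> arr (f i) \<and> dm (f i) = ob X i \<and> cd (f i) = ob Y i"
  using assms unfolding pullback_data_def by auto

lemma pullback_data_diff:
  assumes "pullback_data X Y f" "1 \<le> i" "i \<le> n"
  shows "arr (df X i) \<and> dm (df X i) = ob X i \<and> cd (df X i) = ob X (Suc i) \<and>
    arr (df Y i) \<and> dm (df Y i) = ob Y i \<and> cd (df Y i) = ob Y (Suc i) \<and> f (Suc i) \<cdot> df X i = df Y i \<cdot> f i"
proof -
  have "df X i \<in> Mor \<C> (ob X i) (ob X (Suc i)) \<and> df Y i \<in> Mor \<C> (ob Y i) (ob Y (Suc i)) \<and> f (Suc i) \<cdot> df X i = df Y i \<cdot> f i"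
    using assms unfolding pullback_data_def by auto
  then show ?thesis using pullback_data_obj[OF assms(1), of i] pullback_data_obj[OF assms(1), of "Suc i"] assms(2,3) by simp
qed

lemma pullback_data_simps:
  assumes "pullback_data X Y f"
  shows "\<lbrakk>1 \<le> i; i \<le> Suc n\<rbrakk> \<Longrightarrow> ob X i \<in> Ob" "\<lbrakk>1 \<le> i; i \<le> Suc n\<rbrakk> \<Longrightarrow> ob Y i \<in> Ob"
    "\<lbrakk>1 \<le> i; i \<le> Suc n\<rbrakk> \<Longrightarrow> arr (f i)" "\<lbrakk>1 \<le> i; i \<le> Suc n\<rbrakk> \<Longrightarrow> dm (f i) = ob X i"
    "\<lbrakk>1 \<le> i; i \<le> Suc n\<rbrakk> \<Longrightarrow> cd (f i) = ob Y i"
    "\<lbrakk>1 \<le> i; i \<le> n\<rbrakk> \<Longrightarrow> arr (df X i)" "\<lbrakk>1 \<le> i; i \<le> n\<rbrakk> \<Longrightarrow> dm (df X i) = ob X i"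
    "\<lbrakk>1 \<le> i; i \<le> n\<rbrakk> \<Longrightarrow> cd (df X i) = ob X (Suc i)"
    "\<lbrakk>1 \<le> i; i \<le> n\<rbrakk> \<Longrightarrow> arr (df Y i)" "\<lbrakk>1 \<le> i; i \<le> n\<rbrakk> \<Longrightarrow> dm (df Y i) = ob Y i"
    "\<lbrakk>1 \<le> i; i \<le> n\<rbrakk> \<Longrightarrow> cd (df Y i) = ob Y (Suc i)"
    "\<lbrakk>1 \<le> i; i \<le> n\<rbrakk> \<Longrightarrow> f (Suc i) \<cdot> df X i = df Y i \<cdot> f i"
    "\<lbrakk>1 \<le> i; i \<le> n; arr u; cd u = ob X i\<rbrakk> \<Longrightarrow> f (Suc i) \<cdot> (df X i \<cdot> u) = df Y i \<cdot> (f i \<cdot> u)"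
  using pullback_data_obj[OF assms] pullback_data_diff[OF assms] by (auto simp flip: comp_assoc)

lemma pullback_dataI:
  assumes X: "X \<in> cpxs" and Y: "Y \<in> cpxs" and f: "chm X Y f"
  shows "pullback_data X Y f"
  using X Y chm_simps(1-4)[OF f X Y] unfolding pullback_data_def by simp

text \<open>In the last clause \<open>i < n\<close> and \<open>n \<le> Suc i\<close> together say
  \<open>Suc i = n\<close>; as inequalities they do not make the simplifier substitute for
  \<open>n\<close>. The same device recurs below wherever the top degree is special.\<close>

lemma mcone_ob:
  "ob (cone X Y f) 0 = ob X (Suc 0)"
  "i < n \<Longrightarrow> ob (cone X Y f) (Suc i) = dsum \<C> (ob X (Suc (Suc i))) (ob Y (Suc i))"
  "ob (cone X Y f) (Suc n) = ob Y (Suc n)"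
  "\<lbrakk>i < n; n \<le> Suc i\<rbrakk> \<Longrightarrow> ob (cone X Y f) (Suc (Suc i)) = ob Y (Suc (Suc i))"
  by (auto simp: mcone_def le_Suc_eq)

lemma mcone_df:
  assumes "pullback_data X Y f"
  shows
  "df (cone X Y f) 0 = col (ob X 1) (ob X (Suc (Suc 0))) (ob Y 1) (neg (df X 1)) (f 1)"
  "Suc i < n \<Longrightarrow> df (cone X Y f) (Suc i) =
     mat (ob X (Suc (Suc i))) (ob Y (Suc i)) (ob X (Suc (Suc (Suc i)))) (ob Y (Suc (Suc i)))
       (neg (df X (Suc (Suc i)))) (Zm (ob Y (Suc i)) (ob X (Suc (Suc (Suc i))))) (f (Suc (Suc i))) (df Y (Suc i))"
  "df (cone X Y f) n = row (ob X (Suc n)) (ob Y n) (ob Y (Suc n)) (f (Suc n)) (df Y n)"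
  using pullback_data_simps[OF assms] n_pos by (simp_all add: mcone_def numeral_2_eq_2)

lemma mcone_type:
  assumes p: "pullback_data X Y f"
  shows "i \<le> Suc n \<Longrightarrow> ob (cone X Y f) i \<in> Ob"
    "i \<le> n \<Longrightarrow> arr (df (cone X Y f) i) \<and> dm (df (cone X Y f) i) = ob (cone X Y f) i \<and> cd (df (cone X Y f) i) = ob (cone X Y f) (Suc i)"
proof -
  note [simp] = pullback_data_simps[OF p] mcone_ob
  show "i \<le> Suc n \<Longrightarrow> ob (cone X Y f) i \<in> Ob"
  proof (cases i)
    case (Suc j) then show "i \<le> Suc n \<Longrightarrow> ob (cone X Y f) i \<in> Ob" by (cases "j = n") simp_all
  qed (use n_pos in simp)
  show "arr (df (cone X Y f) i) \<and> dm (df (cone X Y f) i) = ob (cone X Y f) i \<and>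
     cd (df (cone X Y f) i) = ob (cone X Y f) (Suc i)" if i: "i \<le> n"
  proof (cases i)
    case 0 then show ?thesis using n_pos by (simp add: mcone_df[OF p])
  next
    case (Suc j)
    show ?thesis
    proof (cases "i = n")
      case True
      then have "ob (cone X Y f) n = dsum \<C> (ob X (Suc n)) (ob Y n)" using Suc mcone_ob(2)[of j] by simp
      then show ?thesis using True n_pos by (simp add: mcone_df[OF p])
    next
      case False then show ?thesis using Suc i by (simp add: mcone_df[OF p])
    qed
  qed
qed

text \<open>Matrices are never multiplied: the cone differential is applied to a generalized element
  \<open>u\<close> and read off one component at a time.\<close>

lemma mcone_df_elem:
  assumes p: "pullback_data X Y f"
  shows "\<lbrakk>arr u; cd u = ob X (Suc 0)\<rbrakk> \<Longrightarrow>
      pr1 (ob X (Suc (Suc 0))) (ob Y (Suc 0)) \<cdot> (df (cone X Y f) 0 \<cdot> u) = neg (df X (Suc 0) \<cdot> u)"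
    "\<lbrakk>arr u; cd u = ob X (Suc 0)\<rbrakk> \<Longrightarrow>
      pr2 (ob X (Suc (Suc 0))) (ob Y (Suc 0)) \<cdot> (df (cone X Y f) 0 \<cdot> u) = f (Suc 0) \<cdot> u"
    "\<lbrakk>Suc i < n; arr u; cd u = dsum \<C> (ob X (Suc (Suc i))) (ob Y (Suc i))\<rbrakk> \<Longrightarrow>
      pr1 (ob X (Suc (Suc (Suc i)))) (ob Y (Suc (Suc i))) \<cdot> (df (cone X Y f) (Suc i) \<cdot> u) =
      neg (df X (Suc (Suc i)) \<cdot> (pr1 (ob X (Suc (Suc i))) (ob Y (Suc i)) \<cdot> u))"
    "\<lbrakk>Suc i < n; arr u; cd u = dsum \<C> (ob X (Suc (Suc i))) (ob Y (Suc i))\<rbrakk> \<Longrightarrow>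
      pr2 (ob X (Suc (Suc (Suc i)))) (ob Y (Suc (Suc i))) \<cdot> (df (cone X Y f) (Suc i) \<cdot> u) =
      f (Suc (Suc i)) \<cdot> (pr1 (ob X (Suc (Suc i))) (ob Y (Suc i)) \<cdot> u) \<oplus>
      df Y (Suc i) \<cdot> (pr2 (ob X (Suc (Suc i))) (ob Y (Suc i)) \<cdot> u)"
    "\<lbrakk>arr u; cd u = dsum \<C> (ob X (Suc n)) (ob Y n)\<rbrakk> \<Longrightarrow>
      df (cone X Y f) n \<cdot> u =
      f (Suc n) \<cdot> (pr1 (ob X (Suc n)) (ob Y n) \<cdot> u) \<oplus> df Y n \<cdot> (pr2 (ob X (Suc n)) (ob Y n) \<cdot> u)"
  using pullback_data_simps[OF p] mcone_df[OF p] n_pos by (simp_all add: row_comp)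

lemma mcone_df_top:
  assumes p: "pullback_data X Y f" and i: "i < n" "n \<le> Suc i" and u: "arr u" "cd u = dsum \<C> (ob X (Suc (Suc i))) (ob Y (Suc i))"
  shows "df (cone X Y f) (Suc i) \<cdot> u =
      f (Suc (Suc i)) \<cdot> (pr1 (ob X (Suc (Suc i))) (ob Y (Suc i)) \<cdot> u) \<oplus>
      df Y (Suc i) \<cdot> (pr2 (ob X (Suc (Suc i))) (ob Y (Suc i)) \<cdot> u)"
proof -
  have e: "Suc i = n" using i by simp
  show ?thesis unfolding e using u[unfolded e] by (rule mcone_df_elem(5)[OF p])
qed

lemma mcone_df_coelem:
  assumes p: "pullback_data X Y f"
  shows "\<lbrakk>arr u; dm u = dsum \<C> (ob X (Suc (Suc 0))) (ob Y (Suc 0))\<rbrakk> \<Longrightarrow>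
      u \<cdot> df (cone X Y f) 0 = neg (u \<cdot> in1 (ob X (Suc (Suc 0))) (ob Y (Suc 0)) \<cdot> df X (Suc 0))
        \<oplus> u \<cdot> in2 (ob X (Suc (Suc 0))) (ob Y (Suc 0)) \<cdot> f (Suc 0)"
    "\<lbrakk>Suc i < n; arr u; dm u = dsum \<C> (ob X (Suc (Suc (Suc i)))) (ob Y (Suc (Suc i)))\<rbrakk> \<Longrightarrow>
      u \<cdot> (df (cone X Y f) (Suc i) \<cdot> in1 (ob X (Suc (Suc i))) (ob Y (Suc i))) =
      neg (u \<cdot> in1 (ob X (Suc (Suc (Suc i)))) (ob Y (Suc (Suc i))) \<cdot> df X (Suc (Suc i)))
      \<oplus> u \<cdot> in2 (ob X (Suc (Suc (Suc i)))) (ob Y (Suc (Suc i))) \<cdot> f (Suc (Suc i))"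
    "\<lbrakk>Suc i < n; arr u; dm u = dsum \<C> (ob X (Suc (Suc (Suc i)))) (ob Y (Suc (Suc i)))\<rbrakk> \<Longrightarrow>
      u \<cdot> (df (cone X Y f) (Suc i) \<cdot> in2 (ob X (Suc (Suc i))) (ob Y (Suc i))) =
      u \<cdot> in2 (ob X (Suc (Suc (Suc i)))) (ob Y (Suc (Suc i))) \<cdot> df Y (Suc i)"
    "df (cone X Y f) n \<cdot> in1 (ob X (Suc n)) (ob Y n) = f (Suc n)"
    "df (cone X Y f) n \<cdot> in2 (ob X (Suc n)) (ob Y n) = df Y n"
  using pullback_data_simps[OF p] mcone_df[OF p] n_pos by (simp_all add: comp_col)

lemma mcone_ob_n: "ob (cone X Y f) n = dsum \<C> (ob X (Suc n)) (ob Y n)"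
  using n_pos by (simp add: mcone_def)

lemma mcone_cpx:
  assumes X: "X \<in> cpxs" and Y: "Y \<in> cpxs" and f: "chm X Y f"
  shows "cone X Y f \<in> cpxs"
proof -
  note p = pullback_dataI[OF X Y f]
  let ?M = "cone X Y f"
  note [simp] = X Y chm_simps[OF f X Y] mcone_type[OF p] mcone_ob mcone_ob_n mcone_df_elem[OF p] mcone_df_top[OF p]
  \<comment> \<open>Tested on an arbitrary \<open>u\<close>, because the component rules describe
    the differential only when it is applied to something; an identity for \<open>u\<close> then
    gives the claim.\<close>
  have *: "df ?M (Suc i) \<cdot> (df ?M i \<cdot> u) = Zm (dm u) (ob ?M (Suc (Suc i)))"
    if i: "i < n" and u: "arr u" "cd u = ob ?M i" for i u
  proof (cases "Suc i < n")
    case False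
    then show ?thesis using i u by (cases i) (simp_all add: comp_add)
  next
    case True
    note i' = True
    show ?thesis
    proof (rule dsum_ext[of _ _ "ob X (Suc (Suc (Suc i)))" "ob Y (Suc (Suc i))"])
      show "pr1 (ob X (Suc (Suc (Suc i)))) (ob Y (Suc (Suc i))) \<cdot> (df ?M (Suc i) \<cdot> (df ?M i \<cdot> u)) =
          pr1 (ob X (Suc (Suc (Suc i)))) (ob Y (Suc (Suc i))) \<cdot> Zm (dm u) (ob ?M (Suc (Suc i)))"
        using u i' by (cases i) (simp_all add: comp_add)
      show "pr2 (ob X (Suc (Suc (Suc i)))) (ob Y (Suc (Suc i))) \<cdot> (df ?M (Suc i) \<cdot> (df ?M i \<cdot> u)) =
          pr2 (ob X (Suc (Suc (Suc i)))) (ob Y (Suc (Suc i))) \<cdot> Zm (dm u) (ob ?M (Suc (Suc i)))"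
        using u i' by (cases i) (simp_all add: comp_add)
    qed (use u i i' in simp_all)
  qed
  show ?thesis
  proof (rule complexesI)
    fix i assume i: "i < n"
    show "df ?M (Suc i) \<cdot> df ?M i = Zm (ob ?M i) (ob ?M (Suc (Suc i)))"
      using *[OF i, of "Id (ob ?M i)"] i mcone_type[OF p] by (simp del: mcone_ob)
  qed simp_all
qed

text \<open>In a cycle \<open>(u, v)\<close> of the cone, \<open>u\<close> is a cycle of
  \<open>X\<close>, so \<open>u = d a\<close>; then \<open>f a + v\<close> is a cycle of
  \<open>Y\<close>, say \<open>d b\<close>, and the boundary of \<open>(-a, b)\<close> is
  \<open>(u, v)\<close>. In the last step \<open>u\<close> lies in degree n+1 of \<open>X\<close>,
  where exactness is silent, and \<open>lift\<close> supplies \<open>a\<close>.\<close>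

lemma mcone_ker:
  assumes X: "kerseq X" and Y: "kerseq Y" and f: "chm X Y f"
    and f0: "f 0 = Id (ob X 0)"
    and lift: "\<And>w v. \<lbrakk>arr w; cd w = ob X (Suc n); arr v; cd v = ob Y n; dm v = dm w; f (Suc n) \<cdot> w = df Y n \<cdot> v\<rbrakk>
      \<Longrightarrow> \<exists>u. arr u \<and> cd u = ob X n \<and> dm u = dm w \<and> df X n \<cdot> u = w"
  shows "kerseq (cone X Y f)"
proof -
  have Xc: "X \<in> cpxs" and Yc: "Y \<in> cpxs" using X Y by simp_all
  note p = pullback_dataI[OF Xc Yc f]
  let ?M = "cone X Y f"
  note [simp] = Xc Yc chm_simps[OF f Xc Yc] mcone_type[OF p] mcone_ob mcone_df_elem[OF p]
  have ob0: "ob Y 0 = ob X 0" using chm_simps(3)[OF f Xc Yc, of 0] f0 by simp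
  show ?thesis
  proof (rule nkerI[OF mcone_cpx[OF Xc Yc f]])
    fix y assume y: "arr y" "cd y = ob ?M 0" and dy: "df ?M 0 \<cdot> y = Zm (dm y) (ob ?M (Suc 0))"
    have y' [simp]: "arr y" "cd y = ob X (Suc 0)" using y by simp_all
    have n0: "0 < n" using n_pos by simp
    have "neg (df X (Suc 0) \<cdot> y) = Zm (dm y) (ob X (Suc (Suc 0)))"
      using mcone_df_elem(1)[OF p y'] n0 unfolding dy by simp
    from arg_cong[OF this, of neg] have a: "df X (Suc 0) \<cdot> y = Zm (dm y) (ob X (Suc (Suc 0)))"
      using n0 by simp
    have b: "f (Suc 0) \<cdot> y = Zm (dm y) (ob Y (Suc 0))"
      using mcone_df_elem(2)[OF p y'] n0 unfolding dy by simp
    obtain z where z [simp]: "arr z" "cd z = ob X 0" "dm z = dm y" and dz: "df X 0 \<cdot> z = y"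
      using nker_ex[OF X n0 y' a] by metis
    have "df Y 0 \<cdot> (f 0 \<cdot> z) = df Y 0 \<cdot> Zm (dm y) (ob Y 0)"
      using b chm_simps(5)[OF f Xc Yc, of 0 z] dz by simp
    then have "f 0 \<cdot> z = Zm (dm y) (ob Y 0)" by (rule nker_inj[OF Y, rotated -1]) simp_all
    then have "z = Zm (dm y) (ob X 0)" using f0 ob0 by simp
    then show "y = Zm (dm y) (ob ?M 0)" using dz by simp
  next
    fix i y assume i: "i < n" and y0: "arr y" "cd y = ob ?M (Suc i)"
      and dy: "df ?M (Suc i) \<cdot> y = Zm (dm y) (ob ?M (Suc (Suc i)))"
    let ?A = "ob X (Suc (Suc i))" and ?B = "ob Y (Suc i)"
    have y [simp]: "arr y" "cd y = dsum \<C> ?A ?B" using y0 i by simp_all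
    define u where "u = pr1 ?A ?B \<cdot> y"
    define v where "v = pr2 ?A ?B \<cdot> y"
    have uv [simp]: "arr u" "cd u = ?A" "dm u = dm y" "arr v" "cd v = ?B" "dm v = dm y"
      using i by (simp_all add: u_def v_def)
    have "f (Suc (Suc i)) \<cdot> u \<oplus> df Y (Suc i) \<cdot> v = Zm (dm y) (ob Y (Suc (Suc i))) \<and>
      (\<exists>a. arr a \<and> cd a = ob X (Suc i) \<and> dm a = dm y \<and> df X (Suc i) \<cdot> a = u)"
    proof (cases "Suc i < n")
      case False
      then have i': "n \<le> Suc i" by simp
      have e: "f (Suc (Suc i)) \<cdot> u \<oplus> df Y (Suc i) \<cdot> v = Zm (dm y) (ob Y (Suc (Suc i)))"
        using mcone_df_top[OF p i i' y] i i' unfolding u_def v_def dy by simp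
      then have "f (Suc (Suc i)) \<cdot> u = df Y (Suc i) \<cdot> neg v"
        using i sum_zero_iff[of "f (Suc (Suc i)) \<cdot> u" "df Y (Suc i) \<cdot> v"] uv by simp
      then have "\<exists>a. arr a \<and> cd a = ob X (Suc i) \<and> dm a = dm u \<and> df X (Suc i) \<cdot> a = u"
        using lift[of u "neg v"] uv le_antisym[OF i' Suc_leI[OF i]] by simp
      then show ?thesis using e by simp
    next
      case True
      note i' = True
      have e: "f (Suc (Suc i)) \<cdot> u \<oplus> df Y (Suc i) \<cdot> v = Zm (dm y) (ob Y (Suc (Suc i)))"
        using mcone_df_elem(4)[OF p i' y] i' unfolding dy u_def v_def by simp
      have "neg (df X (Suc (Suc i)) \<cdot> u) = Zm (dm y) (ob X (Suc (Suc (Suc i))))"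
        using mcone_df_elem(3)[OF p i' y] i' unfolding dy u_def by simp
      from arg_cong[OF this, of neg] have "df X (Suc (Suc i)) \<cdot> u = Zm (dm u) (ob X (Suc (Suc (Suc i))))"
        using i' by simp
      then show ?thesis using e nker_ex[OF X i' uv(1,2)] by (metis uv(3))
    qed
    then obtain a where e: "f (Suc (Suc i)) \<cdot> u \<oplus> df Y (Suc i) \<cdot> v = Zm (dm y) (ob Y (Suc (Suc i)))"
      and a [simp]: "arr a" "cd a = ob X (Suc i)" "dm a = dm y" and da: "df X (Suc i) \<cdot> a = u" by blast
    define v2 where "v2 = f (Suc i) \<cdot> a \<oplus> v"
    have v2 [simp]: "arr v2" "cd v2 = ?B" "dm v2 = dm y" using i by (simp_all add: v2_def)
    have "df Y (Suc i) \<cdot> v2 = f (Suc (Suc i)) \<cdot> u \<oplus> df Y (Suc i) \<cdot> v"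
      using i chm_simps(5)[OF f Xc Yc, of "Suc i" a] da by (simp add: v2_def comp_add)
    then obtain b where b [simp]: "arr b" "cd b = ob Y i" "dm b = dm y" and db: "df Y i \<cdot> b = v2"
      using nker_ex[OF Y i v2(1,2)] e v2(3) by metis
    show "\<exists>z. arr z \<and> cd z = ob ?M i \<and> dm z = dm y \<and> df ?M i \<cdot> z = y"
    proof (cases i)
      case 0
      note [simp] = 0
      have n0: "0 < n" using n_pos by simp
      \<comment> \<open>The cone starts with degree 1 of \<open>X\<close> alone, so \<open>b\<close>
        has no summand of its own. As \<open>f 0\<close> is an identity, it can enter through
        \<open>df X 0\<close>: \<open>f 1\<close> sends \<open>df X 0 \<cdot> b\<close> to
        \<open>df Y 0 \<cdot> b\<close>.\<close>
      let ?z = "neg a \<oplus> df X 0 \<cdot> b"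
      have z [simp]: "arr ?z" "cd ?z = ob X (Suc 0)" "dm ?z = dm y" using ob0 a b by simp_all
      have "df ?M 0 \<cdot> ?z = y"
      proof (rule dsum_ext[of _ _ ?A ?B])
        show "pr1 ?A ?B \<cdot> (df ?M 0 \<cdot> ?z) = pr1 ?A ?B \<cdot> y"
          using mcone_df_elem(1)[OF p z(1,2)] n0 a b da ob0 unfolding u_def[symmetric] by (simp add: comp_add)
        have "f (Suc 0) \<cdot> ?z = neg (f (Suc 0) \<cdot> a) \<oplus> v2"
          using n0 a b db ob0 f0 chm_simps(5)[OF f Xc Yc, of 0 b] by (simp add: comp_add)
        then show "pr2 ?A ?B \<cdot> (df ?M 0 \<cdot> ?z) = pr2 ?A ?B \<cdot> y"
          using mcone_df_elem(2)[OF p z(1,2)] n0 a uv unfolding v_def[symmetric] v2_def by simp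
      qed (use z n0 y in simp_all)
      then show ?thesis using z by (intro exI[of _ ?z]) simp
    next
      case (Suc j)
      let ?z = "col (dm y) (ob X (Suc i)) (ob Y i) (neg a) b"
      have z [simp]: "arr ?z" "cd ?z = dsum \<C> (ob X (Suc (Suc j))) (ob Y (Suc j))" "dm ?z = dm y"
        using a b Suc i by simp_all
      have pz: "pr1 (ob X (Suc (Suc j))) (ob Y (Suc j)) \<cdot> ?z = neg a"
         "pr2 (ob X (Suc (Suc j))) (ob Y (Suc j)) \<cdot> ?z = b" using a b Suc i by simp_all
      have j: "Suc j < n" using i Suc by simp
      have "df ?M i \<cdot> ?z = y"
      proof (rule dsum_ext[of _ _ ?A ?B])
        show "pr1 ?A ?B \<cdot> (df ?M i \<cdot> ?z) = pr1 ?A ?B \<cdot> y"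
          using mcone_df_elem(3)[OF p j z(1,2)] i a b da Suc unfolding u_def[symmetric] pz by (simp add: comp_add)
        have "f (Suc i) \<cdot> neg a \<oplus> df Y i \<cdot> b = neg (f (Suc i) \<cdot> a) \<oplus> v2"
          using i db by simp
        then show "pr2 ?A ?B \<cdot> (df ?M i \<cdot> ?z) = pr2 ?A ?B \<cdot> y"
          using mcone_df_elem(4)[OF p j z(1,2)] i a uv Suc unfolding v_def[symmetric] v2_def pz by simp
      qed (use z i Suc y in simp_all)
      then show ?thesis using z Suc j by (intro exI[of _ ?z]) simp
    qed
  qed
qed

lemma mcone_df_coelem_top:
  assumes p: "pullback_data X Y f" and i: "i < n" "n \<le> Suc i"
  shows "df (cone X Y f) (Suc i) \<cdot> in1 (ob X (Suc (Suc i))) (ob Y (Suc i)) = f (Suc (Suc i))"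
    "df (cone X Y f) (Suc i) \<cdot> in2 (ob X (Suc (Suc i))) (ob Y (Suc i)) = df Y (Suc i)"
proof -
  have e: "Suc i = n" using i by simp
  show "df (cone X Y f) (Suc i) \<cdot> in1 (ob X (Suc (Suc i))) (ob Y (Suc i)) = f (Suc (Suc i))"
    "df (cone X Y f) (Suc i) \<cdot> in2 (ob X (Suc (Suc i))) (ob Y (Suc i)) = df Y (Suc i)"
    unfolding e using mcone_df_coelem(4,5)[OF p] by simp_all
qed

text \<open>For a cocycle \<open>(u, v)\<close>, \<open>v\<close> kills the differential of
  \<open>Y\<close> and extends to \<open>r\<close>; then \<open>u - r f\<close> kills that of
  \<open>X\<close> and extends to \<open>s\<close>, and \<open>(-s, r)\<close> extends
  \<open>(u, v)\<close>. In the last step there is no room for \<open>s\<close>, but there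
  \<open>u - r f\<close> vanishes, because precomposition with the last map of \<open>X\<close> is
  injective.\<close>

lemma mcone_cok:
  assumes X: "cokseq X" and Y: "cokseq Y" and f: "chm X Y f"
    and f0: "f 0 = Id (ob X 0)"
  shows "cokseq (cone X Y f)"
proof -
  have Xc: "X \<in> cpxs" and Yc: "Y \<in> cpxs" using X Y by simp_all
  note p = pullback_dataI[OF Xc Yc f]
  let ?M = "cone X Y f"
  note [simp] = Xc Yc chm_simps(1-3)[OF f Xc Yc] mcone_type[OF p] mcone_ob
  note sq = chm_simps(4)[OF f Xc Yc]
  have ob0: "ob Y 0 = ob X 0" using chm_simps(3)[OF f Xc Yc, of 0] f0 by simp
  show ?thesis
  proof (rule ncokI[OF mcone_cpx[OF Xc Yc f]])
    fix y assume y: "arr y" "dm y = ob ?M (Suc n)" and dy: "y \<cdot> df ?M n = Zm (ob ?M n) (cd y)"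
    have y' [simp]: "arr y" "dm y = ob Y (Suc n)" using y by simp_all
    have "y \<cdot> df Y n = y \<cdot> df ?M n \<cdot> in2 (ob X (Suc n)) (ob Y n)"
      using mcone_df_coelem(5)[OF p] n_pos by (simp add: comp_assoc mcone_ob_n)
    also have "\<dots> = Zm (ob Y n) (cd y)" unfolding dy by (simp add: mcone_ob_n)
    also have "\<dots> = Zm (ob Y (Suc n)) (cd y) \<cdot> df Y n" by simp
    finally have "y = Zm (ob Y (Suc n)) (cd y)" by (rule ncok_inj[OF Y, rotated -1]) simp_all
    then show "y = Zm (ob ?M (Suc n)) (cd y)" by simp
  next
    fix i y assume i: "i < n" and y0: "arr y" "dm y = ob ?M (Suc i)" and dy: "y \<cdot> df ?M i = Zm (ob ?M i) (cd y)"
    let ?A = "ob X (Suc (Suc i))" and ?B = "ob Y (Suc i)"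
    have y [simp]: "arr y" "dm y = dsum \<C> ?A ?B" using y0 i by simp_all
    define u where "u = y \<cdot> in1 ?A ?B"
    define v where "v = y \<cdot> in2 ?A ?B"
    have uv [simp]: "arr u" "dm u = ?A" "cd u = cd y" "arr v" "dm v = ?B" "cd v = cd y"
      using i by (simp_all add: u_def v_def)
    have e: "neg (u \<cdot> df X (Suc i)) \<oplus> v \<cdot> f (Suc i) = Zm (ob X (Suc i)) (cd y) \<and> v \<cdot> df Y i = Zm (ob Y i) (cd y)"
    proof (cases i)
      \<comment> \<open>The cone has no summand from \<open>Y\<close> in degree 0 that would give
        \<open>v \<cdot> df Y 0 = 0\<close>. With \<open>f 0\<close> an identity, this composite
        equals \<open>v \<cdot> f 1 \<cdot> df X 0\<close>, and so
        \<open>u \<cdot> df X 1 \<cdot> df X 0\<close>.\<close>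
      case 0
      have e1: "neg (u \<cdot> df X (Suc i)) \<oplus> v \<cdot> f (Suc i) = Zm (ob X (Suc i)) (cd y)"
        using mcone_df_coelem(1)[OF p, of y] dy 0 by (simp add: u_def v_def)
      have "v \<cdot> f (Suc i) = neg (neg (u \<cdot> df X (Suc i)))"
        by (rule neg_unique[symmetric]) (use i e1 in simp_all)
      then have e2: "v \<cdot> f (Suc i) = u \<cdot> df X (Suc i)" using i by simp
      have "v \<cdot> df Y i = v \<cdot> (df Y 0 \<cdot> f 0)" using 0 f0 ob0 by simp
      also have "\<dots> = v \<cdot> f (Suc i) \<cdot> df X 0" using sq[of 0] 0 i by (simp add: comp_assoc)
      also have "\<dots> = Zm (ob Y i) (cd y)" unfolding e2 using 0 i ob0 by (simp add: comp_assoc)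
      finally show ?thesis using e1 by simp
    next
      case (Suc j)
      have j: "Suc j < n" using i Suc by simp
      let ?C = "ob X (Suc (Suc j))" and ?D = "ob Y (Suc j)"
      have "y \<cdot> (df ?M (Suc j) \<cdot> in1 ?C ?D) = y \<cdot> df ?M i \<cdot> in1 ?C ?D"
        using j Suc by (simp add: comp_assoc)
      also have "\<dots> = Zm ?C (cd y)" unfolding dy using j Suc by simp
      finally have e1: "y \<cdot> (df ?M (Suc j) \<cdot> in1 ?C ?D) = Zm ?C (cd y)" .
      have "y \<cdot> (df ?M (Suc j) \<cdot> in2 ?C ?D) = y \<cdot> df ?M i \<cdot> in2 ?C ?D"
        using j Suc by (simp add: comp_assoc)
      also have "\<dots> = Zm ?D (cd y)" unfolding dy using j Suc by simp
      finally have e2: "y \<cdot> (df ?M (Suc j) \<cdot> in2 ?C ?D) = Zm ?D (cd y)" .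
      show ?thesis using mcone_df_coelem(2,3)[OF p j, of y] e1 e2 y unfolding u_def v_def Suc by simp
    qed
    then have e1: "neg (u \<cdot> df X (Suc i)) \<oplus> v \<cdot> f (Suc i) = Zm (ob X (Suc i)) (cd y)"
      and e2: "v \<cdot> df Y i = Zm (ob Y i) (cd v)" by auto
    obtain r where r [simp]: "arr r" "dm r = ob Y (Suc (Suc i))" "cd r = cd y" and dr: "r \<cdot> df Y (Suc i) = v"
      using ncok_ex[OF Y i uv(4,5) e2] uv(6) by metis
    \<comment> \<open>The \<open>X\<close>-part that is left once \<open>r\<close> accounts for
      \<open>v\<close>.\<close>
    define t where "t = u \<oplus> neg (r \<cdot> f (Suc (Suc i)))"
    have t [simp]: "arr t" "dm t = ?A" "cd t = cd y" using i by (simp_all add: t_def)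
    have "r \<cdot> f (Suc (Suc i)) \<cdot> df X (Suc i) = v \<cdot> f (Suc i)"
      unfolding dr[symmetric] using i sq[of "Suc i"] by (simp add: comp_assoc)
    then have "neg (t \<cdot> df X (Suc i)) = Zm (ob X (Suc i)) (cd y)"
      using i e1 by (simp add: t_def comp_add)
    from arg_cong[OF this, of neg] have dt: "t \<cdot> df X (Suc i) = Zm (ob X (Suc i)) (cd t)" using i by simp
    have "u = r \<cdot> f (Suc (Suc i)) \<oplus> t"
      by (rule iffD2[OF eq_add_iff]) (use i t_def in simp_all)
    also have "\<dots> = t \<oplus> r \<cdot> f (Suc (Suc i))" by (rule add_comm) (use i in simp_all)
    finally have ut: "u = t \<oplus> r \<cdot> f (Suc (Suc i))" .
    show "\<exists>z. arr z \<and> dm z = ob ?M (Suc (Suc i)) \<and> cd z = cd y \<and> z \<cdot> df ?M (Suc i) = y"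
    proof (cases "Suc i < n")
      case False
      then have i': "n \<le> Suc i" by simp
      have n: "Suc i = n" using i i' by simp
      have "t = Zm (ob X (Suc n)) (cd y)"
        by (rule ncok_inj[OF X]) (use dt[unfolded n] t[unfolded n] in simp_all)
      then have u: "u = r \<cdot> f (Suc (Suc i))" using ut i n[symmetric] by simp
      have "r \<cdot> df ?M (Suc i) = y"
        by (rule dsum_coext[of _ _ ?A ?B])
          (use i i' u dr mcone_df_coelem_top[OF p i i'] in \<open>simp_all add: comp_assoc flip: u_def v_def\<close>)
      then show ?thesis using i i' by (intro exI[of _ r]) simp
    next
      case True
      obtain s where s [simp]: "arr s" "dm s = ob X (Suc (Suc (Suc i)))" "cd s = cd y" and ds: "s \<cdot> df X (Suc (Suc i)) = t"
        using ncok_ex[OF X True t(1,2) dt] t(3) by metis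
      let ?z = "row (ob X (Suc (Suc (Suc i)))) (ob Y (Suc (Suc i))) (cd y) (neg s) r"
      have z: "arr ?z" "dm ?z = dsum \<C> (ob X (Suc (Suc (Suc i)))) (ob Y (Suc (Suc i)))" "cd ?z = cd y"
        by simp_all
      have "?z \<cdot> df ?M (Suc i) = y"
        by (rule dsum_coext[of _ _ ?A ?B])
          (use i True ds dr ut mcone_df_coelem(2,3)[OF p True z(1,2)] in \<open>simp_all add: comp_assoc flip: u_def v_def\<close>)
      then show ?thesis using z True by (intro exI[of _ ?z]) simp
    qed
  qed
qed

text \<open>The inclusion of the second summand; in degree 0, where the cone is degree 1 of
  \<open>X\<close>, the map \<open>df X 0\<close> takes its place because \<open>f 0\<close> is an
  identity. Its end components also show which class the cone represents: the pushout of
  \<open>[Y]\<close> along \<open>df X 0\<close>.\<close>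

lemma chm_to_mcone:
  assumes X: "X \<in> cpxs" and Y: "Y \<in> cpxs" and f: "chm X Y f"
    and f0: "f 0 = Id (ob X 0)"
  obtains j where "chm Y (cone X Y f) j" "j 0 = df X 0" "j (Suc n) = Id (ob Y (Suc n))"
    "\<And>i. i < n \<Longrightarrow> j (Suc i) = in2 (ob X (Suc (Suc i))) (ob Y (Suc i))"
proof -
  note p = pullback_dataI[OF X Y f]
  let ?M = "cone X Y f"
  note [simp] = X Y chm_simps(1-3)[OF f X Y] mcone_type[OF p] mcone_ob
  have ob0: "ob Y 0 = ob X 0" using chm_simps(3)[OF f X Y, of 0] f0 by simp
  let ?j = "\<lambda>i. if i = 0 then df X 0 else if i \<le> n then in2 (ob X (Suc i)) (ob Y i) else Id (ob Y (Suc n))"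
  have "chm Y ?M ?j"
  proof (rule chmI[OF Y mcone_cpx[OF X Y f]])
    fix i assume i: "i \<le> Suc n"
    show "arr (?j i) \<and> dm (?j i) = ob Y i \<and> cd (?j i) = ob ?M i"
    proof (cases i)
      case (Suc k) then show ?thesis using i ob0 by (cases "k = n") simp_all
    qed (use ob0 in simp)
  next
    fix i assume i: "i \<le> n"
    show "?j (Suc i) \<cdot> df Y i = df ?M i \<cdot> ?j i"
    proof (cases i)
      case 0
      then show ?thesis
        using n_pos ob0 chm_simps(4)[OF f X Y, of 0] f0 mcone_df_elem(1,2)[OF p, of "df X 0"]
        by - (rule dsum_ext[of _ _ "ob X (Suc (Suc 0))" "ob Y (Suc 0)"]; simp)
    next
      case (Suc k)
      show ?thesis
      proof (cases "Suc k < n")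
        case True
        then have "df ?M (Suc k) \<cdot> in2 (ob X (Suc (Suc k))) (ob Y (Suc k)) =
            col (ob Y (Suc k)) (ob X (Suc (Suc (Suc k)))) (ob Y (Suc (Suc k)))
             (Zm (ob Y (Suc k)) (ob X (Suc (Suc (Suc k))))) (df Y (Suc k))"
          by (simp add: mcone_df[OF p])
        also have "\<dots> = in2 (ob X (Suc (Suc (Suc k)))) (ob Y (Suc (Suc k))) \<cdot> df Y (Suc k)"
          using True by - (rule dsum_ext[of _ _ "ob X (Suc (Suc (Suc k)))" "ob Y (Suc (Suc k))"]; simp)
        finally show ?thesis using True Suc by simp
      next
        case False
        then have k: "k < n" "n \<le> Suc k" using Suc i by auto
        then have n: "n = Suc k" by simp
        have "Id (ob Y (Suc n)) = Id (ob Y (Suc (Suc k)))" unfolding n ..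
        then show ?thesis using Suc k mcone_df_coelem_top(2)[OF p k] by simp
      qed
    qed
  qed
  then show ?thesis using n_pos by (intro that[of ?j]) auto
qed

lemma pullback_universal:
  assumes X: "X \<in> cpxs" and Y: "Y \<in> cpxs" and q: "chm X Y q"
    and q0: "q 0 = Id (ob X 0)" and M: "kerseq (cone X Y q)"
    and V: "V \<in> cpxs" and f: "chm V Y f"
    and w: "arr w" "dm w = ob V (Suc n)" "cd w = ob X (Suc n)" "f (Suc n) = q (Suc n) \<cdot> w"
  shows "rel V X (f 0) w"
proof -
  note p = pullback_dataI[OF X Y q]
  let ?M = "cone X Y q"
  have Mc: "?M \<in> cpxs" using M by simp
  note [simp] = X Y V chm_simps(1-3)[OF q X Y] chm_simps(1-3)[OF f V Y] mcone_type[OF p] mcone_ob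
  have ob0: "ob Y 0 = ob X 0" using chm_simps(3)[OF q X Y, of 0] q0 by simp
  obtain j where j: "chm Y ?M j" "j 0 = df X 0" "j (Suc n) = Id (ob Y (Suc n))"
    and ji: "\<And>i. i < n \<Longrightarrow> j (Suc i) = in2 (ob X (Suc (Suc i))) (ob Y (Suc i))"
    using chm_to_mcone[OF X Y q q0] by metis
  \<comment> \<open>The last component of the map into the cone is
    \<open>q (Suc n) \<cdot> w\<close>, the last cone differential applied to \<open>(w, 0)\<close>;
    the homotopy starts from this column.\<close>
  let ?s = "col (ob V (Suc n)) (ob X (Suc n)) (ob Y n) w (Zm (ob V (Suc n)) (ob Y n))"
  obtain \<phi> where \<phi>: "null_htpy n \<C> V ?M (\<lambda>i. j i \<cdot> f i) \<phi>" "\<phi> n = ?s"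
    by (rule null_htpy_down[OF M V chm_comp[OF f j(1) V Y Mc], of ?s])
      (use w j(3) mcone_df_elem(5)[OF p, of ?s] in \<open>simp_all add: mcone_ob_n\<close>)
  note [simp] = null_htpyD(1-3)[OF \<phi>(1) V Mc]
  have e0: "df X 0 \<cdot> f 0 = \<phi> 0 \<cdot> df V 0" using null_htpyD(4)[OF \<phi>(1) V Mc] j(2) by simp
  have e: "in2 (ob X (Suc (Suc i))) (ob Y (Suc i)) \<cdot> f (Suc i) = df ?M i \<cdot> \<phi> i \<oplus> \<phi> (Suc i) \<cdot> df V (Suc i)"
    if "i < n" for i using null_htpyD(5)[OF \<phi>(1) V Mc that] ji[OF that] by simp
  \<comment> \<open>The homotopy component \<open>\<phi> (i - 1)\<close> lands in degree
    \<open>i - 1\<close> of the cone, whose first summand is degree \<open>i\<close> of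
    \<open>X\<close>. For \<open>i = 1\<close> there is no second summand to project away, and
    degree 0 keeps the given \<open>f 0\<close>.\<close>
  let ?g = "\<lambda>i. if i = 0 then f 0 else if i = 1 then \<phi> 0 else pr1 (ob X i) (ob Y (i - 1)) \<cdot> \<phi> (i - 1)"
  have gS: "?g (Suc (Suc i)) = pr1 (ob X (Suc (Suc i))) (ob Y (Suc i)) \<cdot> \<phi> (Suc i)" for i by simp
  have gt [simp]: "arr (?g i) \<and> dm (?g i) = ob V i \<and> cd (?g i) = ob X i" if "i \<le> Suc n" for i
  proof (cases i)
    case 0 then show ?thesis using ob0 by simp
  next
    case (Suc k) then show ?thesis using that by (cases k) simp_all
  qed
  have "chm V X ?g"
  proof (rule chmI[OF V X])
    fix i assume i: "i \<le> n"
    show "?g (Suc i) \<cdot> df V i = df X i \<cdot> ?g i"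
    proof (cases i)
      case 0 then show ?thesis using e0 by simp
    next
      case (Suc k)
      have k: "k < n" using i Suc by simp
      let ?P = "pr1 (ob X (Suc (Suc k))) (ob Y (Suc k))"
      have dk: "?P \<cdot> (df ?M k \<cdot> \<phi> k) = neg (df X (Suc k) \<cdot> ?g (Suc k))"
      proof (cases k)
        case 0 then show ?thesis using k mcone_df_elem(1)[OF p, of "\<phi> 0"] by simp
      next
        case (Suc l) then show ?thesis using k mcone_df_elem(3)[OF p, of l "\<phi> (Suc l)"] by simp
      qed
      \<comment> \<open>The map into the cone has values in the \<open>Y\<close>-summand, so the
        \<open>X\<close>-component of the homotopy equation is zero; the minus sign at
        \<open>df X\<close> in the cone turns this into compatibility with the
        differentials.\<close>
      have "Zm (ob V (Suc k)) (ob X (Suc (Suc k))) = ?P \<cdot> (df ?M k \<cdot> \<phi> k \<oplus> \<phi> (Suc k) \<cdot> df V (Suc k))"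
        unfolding e[OF k, symmetric] using k by simp
      also have "\<dots> = neg (df X (Suc k) \<cdot> ?g (Suc k)) \<oplus> ?P \<cdot> (\<phi> (Suc k) \<cdot> df V (Suc k))"
        unfolding dk[symmetric] using k by (subst comp_add_right) simp_all
      also have "?P \<cdot> (\<phi> (Suc k) \<cdot> df V (Suc k)) = ?g (Suc (Suc k)) \<cdot> df V (Suc k)"
        unfolding gS using k by (simp add: comp_assoc)
      finally have z: "neg (df X (Suc k) \<cdot> ?g (Suc k)) \<oplus> ?g (Suc (Suc k)) \<cdot> df V (Suc k) =
         Zm (ob V (Suc k)) (ob X (Suc (Suc k)))" by simp
      have "?g (Suc (Suc k)) \<cdot> df V (Suc k) = neg (neg (df X (Suc k) \<cdot> ?g (Suc k)))"
        by (rule neg_unique[symmetric]) (use k gt[of "Suc k"] gt[of "Suc (Suc k)"] z in \<open>simp_all del: gt\<close>)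
      then show ?thesis using Suc k gt[of "Suc k"] by (simp del: gt)
    qed
  qed (rule gt)
  moreover have "?g (Suc n) = w"
  proof -
    obtain m where n: "n = Suc m" using n_pos by (cases n) auto
    have "?g (Suc n) = pr1 (ob X (Suc n)) (ob Y n) \<cdot> \<phi> n" using n by simp
    then show ?thesis unfolding \<phi>(2) using w by simp
  qed
  ultimately show ?thesis unfolding erel_def using n_pos by (intro exI[of _ ?g]) simp
qed

section \<open>Pullbacks\<close>

text \<open>The missing first map lifts \<open>(0, d\<^sub>Y\<^sup>0)\<close> along the first differential of the mapping cone.\<close>

lemma extend_pullback:
  assumes Y: "kerseq Y" and p: "pullback_data X Y q" and M: "kerseq (cone X Y q)"
  obtains X' q' where "kerseq X'" "chm X' Y q'" "q' 0 = Id (ob Y 0)" "ob X' 0 = ob Y 0"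
    "\<And>i. 0 < i \<Longrightarrow> ob X' i = ob X i" "\<And>i. 0 < i \<Longrightarrow> df X' i = df X i" "\<And>i. 0 < i \<Longrightarrow> q' i = q i"
    "cone X' Y q' = cone X Y q"
proof -
  let ?M = "cone X Y q"
  have Yc: "Y \<in> cpxs" and Mc: "?M \<in> cpxs" using Y M by simp_all
  have n0: "0 < n" using n_pos by simp
  note [simp] = Yc pullback_data_simps[OF p] mcone_ob mcone_df_elem[OF p] mcone_df_top[OF p]
  let ?A = "ob X (Suc (Suc 0))" and ?B = "ob Y (Suc 0)"
  let ?y = "col (ob Y 0) ?A ?B (Zm (ob Y 0) ?A) (df Y 0)"
  have y: "arr ?y" "cd ?y = ob ?M (Suc 0)" "dm ?y = ob Y 0" using n0 by simp_all
  have "df ?M (Suc 0) \<cdot> ?y = Zm (dm ?y) (ob ?M (Suc (Suc 0)))"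
  proof (cases "Suc 0 < n")
    case True
    show ?thesis
      by (rule dsum_ext[of _ _ "ob X (Suc (Suc (Suc 0)))" "ob Y (Suc (Suc 0))"])
        (use True Mc mcone_type[OF p] in \<open>simp_all\<close>)
  next
    case False
    then show ?thesis using n0 by simp
  qed
  then obtain e where e0: "arr e" "cd e = ob ?M 0" "dm e = dm ?y" and de: "df ?M 0 \<cdot> e = ?y"
    using nker_ex[OF M n0 y(1,2)] by metis
  have e [simp]: "arr e" "cd e = ob X (Suc 0)" "dm e = ob Y 0" using e0 n0 by simp_all
  have "neg (df X (Suc 0) \<cdot> e) = Zm (ob Y 0) ?A"
    using mcone_df_elem(1)[OF p e(1,2)] n0 unfolding de by simp
  from arg_cong[OF this, of neg] have de1: "df X (Suc 0) \<cdot> e = Zm (ob Y 0) ?A" using n0 by simp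
  have qe: "q (Suc 0) \<cdot> e = df Y 0"
    using mcone_df_elem(2)[OF p e(1,2)] n0 unfolding de by simp
  define X' where "X' = \<lparr>ob = (ob X)(0 := ob Y 0), df = (df X)(0 := e)\<rparr>"
  define q' where "q' = q(0 := Id (ob Y 0))"
  have X'_simps [simp]: "ob X' 0 = ob Y 0" "ob X' (Suc i) = ob X (Suc i)" "df X' 0 = e" "df X' (Suc i) = df X (Suc i)"
    "q' 0 = Id (ob Y 0)" "q' (Suc i) = q (Suc i)" for i
    by (simp_all add: X'_def q'_def)
  \<comment> \<open>The data of an n-pullback do not say that differentials of \<open>X\<close>
    compose to zero; the first component of the corresponding equation in the cone does.\<close>
  have dd: "df X (Suc (Suc k)) \<cdot> df X (Suc k) = Zm (ob X (Suc k)) (ob X (Suc (Suc (Suc k))))" if k: "Suc k < n" for k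
  proof -
    let ?P = "pr1 (ob X (Suc (Suc (Suc k)))) (ob Y (Suc (Suc k)))"
    have z: "?P \<cdot> (df ?M (Suc k) \<cdot> (df ?M k \<cdot> u)) = Zm (dm u) (ob X (Suc (Suc (Suc k))))"
      if "arr u" "cd u = ob ?M k" for u
      using cpx_simps(6)[OF Mc _ that] k that by simp
    show ?thesis
    proof (cases k)
      case 0
      have [simp]: "arr (df ?M 0)" "dm (df ?M 0) = ob X (Suc 0)" "cd (df ?M 0) = dsum \<C> ?A ?B"
        using Mc n0 by simp_all
      show ?thesis using z[of "Id (ob X (Suc 0))"] k 0
          mcone_df_elem(1)[OF p, of "Id (ob X (Suc 0))"] by simp
    next
      case (Suc l)
      let ?J = "in1 (ob X (Suc (Suc l))) (ob Y (Suc l))"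
      have [simp]: "arr (df ?M (Suc l))" "dm (df ?M (Suc l)) = dsum \<C> (ob X (Suc (Suc l))) (ob Y (Suc l))"
          "cd (df ?M (Suc l)) = dsum \<C> (ob X (Suc (Suc (Suc l)))) (ob Y (Suc (Suc l)))"
        using Mc k Suc by simp_all
      show ?thesis using z[of ?J] k Suc mcone_df_elem(3)[OF p, of l ?J]
          mcone_df_elem(3)[OF p, of "Suc l" "df ?M (Suc l) \<cdot> ?J"] by simp
    qed
  qed
  have X'c: "X' \<in> cpxs"
  proof (rule complexesI)
    show "ob X' i \<in> Ob" if "i \<le> Suc n" for i using that by (cases i) simp_all
    show "arr (df X' i) \<and> dm (df X' i) = ob X' i \<and> cd (df X' i) = ob X' (Suc i)" if "i \<le> n" for i
      using that by (cases i) simp_all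
    show "df X' (Suc i) \<cdot> df X' i = Zm (ob X' i) (ob X' (Suc (Suc i)))" if "i < n" for i
      using that de1 dd by (cases i) simp_all
  qed
  have q'c: "chm X' Y q'"
  proof (rule chmI[OF X'c Yc])
    show "arr (q' i) \<and> dm (q' i) = ob X' i \<and> cd (q' i) = ob Y i" if "i \<le> Suc n" for i
      using that by (cases i) simp_all
    show "q' (Suc i) \<cdot> df X' i = df Y i \<cdot> q' i" if "i \<le> n" for i
      using that qe by (cases i) simp_all
  qed
  have Meq: "cone X' Y q' = cone X Y q"
    by (simp add: mcone_def X'_def q'_def fun_eq_iff)
  have "kerseq X'"
  proof (rule nkerI[OF X'c])
    fix y assume y: "arr y" "cd y = ob X' 0" "df X' 0 \<cdot> y = Zm (dm y) (ob X' (Suc 0))"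
    have "df Y 0 \<cdot> y = q (Suc 0) \<cdot> (e \<cdot> y)" unfolding qe[symmetric] using y by (simp add: comp_assoc)
    also have "\<dots> = df Y 0 \<cdot> Zm (dm y) (ob Y 0)" using y by simp
    finally show "y = Zm (dm y) (ob X' 0)"
      using y by - (rule nker_inj[OF Y]; simp)
  next
    fix i y assume i: "i < n" and y0: "arr y" "cd y = ob X' (Suc i)"
      and dy: "df X' (Suc i) \<cdot> y = Zm (dm y) (ob X' (Suc (Suc i)))"
    have y [simp]: "arr y" "cd y = ob X (Suc i)" using y0 by simp_all
    have dy: "df X (Suc i) \<cdot> y = Zm (dm y) (ob X (Suc (Suc i)))" using dy by simp
    \<comment> \<open>The composite \<open>q y\<close> is a cycle of \<open>Y\<close>, say
      \<open>d t\<close>. Then \<open>(y, -t)\<close> is a cycle of the cone, and the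
      \<open>X\<close>-component of a preimage bounds \<open>y\<close> up to sign; for
      \<open>i = 0\<close>, instead, \<open>y - e t\<close> is killed by the injective first cone
      differential.\<close>
    have "df Y (Suc i) \<cdot> (q (Suc i) \<cdot> y) = q (Suc (Suc i)) \<cdot> (df X (Suc i) \<cdot> y)"
      using i by simp
    also have "\<dots> = Zm (dm y) (ob Y (Suc (Suc i)))" unfolding dy using i by simp
    finally obtain t where t [simp]: "arr t" "cd t = ob Y i" "dm t = dm y" and dt: "df Y i \<cdot> t = q (Suc i) \<cdot> y"
      using nker_ex[OF Y i, of "q (Suc i) \<cdot> y"] i by auto
    show "\<exists>z. arr z \<and> cd z = ob X' i \<and> dm z = dm y \<and> df X' i \<cdot> z = y"
    proof (cases i)
      case 0
      note [simp] = 0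
      have [simp]: "arr y" "cd y = ob X (Suc 0)" "cd t = ob Y 0" using y t by simp_all
      let ?u = "y \<oplus> neg (e \<cdot> t)"
      have u: "arr ?u" "cd ?u = ob X (Suc 0)" by simp_all
      have q: "q (Suc 0) \<cdot> ?u = Zm (dm y) ?B"
        using dt n0 by (simp add: comp_add qe flip: comp_assoc)
      have d: "df X (Suc 0) \<cdot> ?u = Zm (dm y) ?A"
        using dy n0 by (simp add: comp_add de1 flip: comp_assoc)
      have tM: "arr (df ?M 0)" "dm (df ?M 0) = ob X (Suc 0)" "cd (df ?M 0) = dsum \<C> ?A ?B"
        using Mc n0 by simp_all
      have "df ?M 0 \<cdot> ?u = df ?M 0 \<cdot> Zm (dm y) (ob X (Suc 0))"
        by (rule dsum_ext[of _ _ ?A ?B])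
          (use u tM n0 mcone_df_elem(1,2)[OF p u] q d in simp_all)
      then have z: "?u = Zm (dm y) (ob X (Suc 0))"
        by - (rule nker_inj[OF M]; use n0 in simp)
      have "e \<cdot> t = y" by (rule iffD1[OF eq_zero_iff, symmetric]) (simp_all add: z)
      then show ?thesis using t by (intro exI[of _ t]) simp
    next
      case (Suc k)
      have k: "k < n" "Suc k < n" using i Suc by auto
      let ?C = "ob X (Suc (Suc k))" and ?D = "ob Y (Suc k)"
      note [simp] = Suc
      let ?u = "col (dm y) ?C ?D y (neg t)"
      have u: "arr ?u" "cd ?u = dsum \<C> ?C ?D" "dm ?u = dm y" using k by simp_all
      have tM: "arr (df ?M (Suc k))" "dm (df ?M (Suc k)) = dsum \<C> ?C ?D"
        "cd (df ?M (Suc k)) = dsum \<C> (ob X (Suc (Suc (Suc k)))) (ob Y (Suc (Suc k)))"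
        using Mc k by simp_all
      have "df ?M (Suc k) \<cdot> ?u = Zm (dm ?u) (ob ?M (Suc (Suc k)))"
        by (rule dsum_ext[of _ _ "ob X (Suc (Suc (Suc k)))" "ob Y (Suc (Suc k))"])
          (use u tM k dy dt Suc mcone_df_elem(3,4)[OF p k(2) u(1,2)] in simp_all)
      then obtain z where z: "arr z" "cd z = ob ?M k" "dm z = dm y" "df ?M k \<cdot> z = ?u"
        using nker_ex[OF M k(1), of ?u] u k by auto
      have "\<exists>w. arr w \<and> cd w = ob X (Suc k) \<and> dm w = dm y \<and> neg (df X (Suc k) \<cdot> w) = y"
      proof (cases k)
        case 0
        have "neg (df X (Suc k) \<cdot> z) = pr1 ?C ?D \<cdot> ?u" unfolding z(4)[symmetric] using z(1-3) 0 by simp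
        also have "\<dots> = y" using k by simp
        finally show ?thesis using z 0 by (intro exI[of _ z]) simp
      next
        case (Suc l)
        let ?w = "pr1 (ob X (Suc (Suc l))) (ob Y (Suc l)) \<cdot> z"
        have z': "cd z = dsum \<C> (ob X (Suc (Suc l))) (ob Y (Suc l))" using z(2) Suc k by simp
        have "neg (df X (Suc k) \<cdot> ?w) = pr1 ?C ?D \<cdot> ?u" unfolding z(4)[symmetric] using z(1-3) z' Suc k by simp
        also have "\<dots> = y" using k by simp
        finally show ?thesis using z z' Suc k by (intro exI[of _ ?w]) simp
      qed
      then obtain w where w: "arr w" "cd w = ob X (Suc k)" "dm w = dm y" "neg (df X (Suc k) \<cdot> w) = y" by blast
      then show ?thesis using Suc k by (intro exI[of _ "neg w"]) simp
    qed
  qed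
  with q'c Meq show ?thesis using that[of X' q'] by (simp add: X'_def q'_def)
qed

section \<open>Calculus of end components\<close>

lemma is_iso_Id: "A \<in> Ob \<Longrightarrow> is_iso \<C> A A (Id A)"
  unfolding is_iso_def by auto

lemma relI: "chm X Y f \<Longrightarrow> f 0 = a \<Longrightarrow> f (Suc n) = c \<Longrightarrow> rel X Y a c"
  unfolding erel_def by auto

lemma relE:
  assumes "rel X Y a c" obtains f where "chm X Y f" "f 0 = a" "f (Suc n) = c"
  using assms unfolding erel_def by auto

lemma rel_refl: "X \<in> cpxs \<Longrightarrow> rel X X (Id (ob X 0)) (Id (ob X (Suc n)))"
  by (rule relI[OF chm_id]) auto

lemma rel_trans:
  assumes "rel X Y a c" "rel Y Z a' c'" "X \<in> cpxs" "Y \<in> cpxs" "Z \<in> cpxs"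
  shows "rel X Z (a' \<cdot> a) (c' \<cdot> c)"
  using assms by (auto elim!: relE intro!: relI[OF chm_comp])

lemma rel_type:
  assumes "rel X Y a c" "X \<in> cpxs" "Y \<in> cpxs"
  shows "arr a" "dm a = ob X 0" "cd a = ob Y 0" "arr c" "dm c = ob X (Suc n)" "cd c = ob Y (Suc n)"
  using assms by (auto elim!: relE simp: chm_simps(1-3)[OF _ assms(2,3)])

lemma cpx_eq_exact: "cpx_eq n X X' \<Longrightarrow> exseq X \<Longrightarrow> exseq X'"
  using kernel_cong cokernel_cong unfolding n_exact_seq_def by blast

end

text \<open>The half of the axioms that concerns pullbacks, isolated so that it can be instantiated
  at the opposite category, where \<open>E2_op\<close> is the axiom (E2) of the original
  one.\<close>

locale pullback_category = add_cat_n n \<C>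
  for n :: nat and \<C> :: "('o, 'm) precat" (structure) +
  fixes \<X> :: "('o, 'm) cpx set"
  assumes X_ex: "X \<in> \<X> \<Longrightarrow> n_exact_seq n \<C> X"
    and EC: "\<lbrakk>n_exact_seq n \<C> X; n_exact_seq n \<C> Y; chain_map n \<C> X Y h;
        (\<exists>k\<le>n. is_iso \<C> (ob X k) (ob Y k) (h k) \<and>
                 is_iso \<C> (ob X (k+1)) (ob Y (k+1)) (h (k+1))) \<or>
        (is_iso \<C> (ob X 0) (ob Y 0) (h 0) \<and>
         is_iso \<C> (ob X (n+1)) (ob Y (n+1)) (h (n+1)))\<rbrakk> \<Longrightarrow> X \<in> \<X> \<longleftrightarrow> Y \<in> \<X>"
    and E2_op: "\<lbrakk>Y \<in> \<X>; D \<in> Obj \<C>; c \<in> Mor \<C> D (ob Y (n+1))\<rbrakk> \<Longrightarrow>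
        \<exists>X f. ob X (n+1) = D \<and> f (n+1) = c \<and> n_pullback n \<C> X Y f \<and>
          admissible_epi n \<X> (df X n)"
begin

lemma X_simps [simp]:
  assumes "X \<in> \<X>"
  shows "exseq X" "kerseq X" "cokseq X" "X \<in> cpxs"
  using X_ex[OF assms] by (auto simp: n_exact_seq_def)

text \<open>Identities form a chain map, so (EC) makes \<X> blind to values outside the degrees 0 to
  n+1. Double reversal can change only those.\<close>

lemma X_cong:
  assumes "X \<in> \<X>" "cpx_eq n X X'" shows "X' \<in> \<X>"
proof -
  have X: "X \<in> cpxs" using assms by simp
  have "chm X X' (\<lambda>i. Id (ob X i))"
    using chm_id[OF X] chain_map_cong[OF _ assms(2) refl, of X X \<C> "\<lambda>i. Id (ob X i)"] by (simp add: cpx_eq_def)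
  moreover have "is_iso \<C> (ob X 0) (ob X' 0) (Id (ob X 0)) \<and> is_iso \<C> (ob X (0+1)) (ob X' (0+1)) (Id (ob X (0+1)))"
  proof -
    have "ob X' 0 = ob X 0" "ob X' (0+1) = ob X (0+1)" using assms(2) by (auto simp: cpx_eq_def)
    moreover have "ob X 0 \<in> Ob" "ob X (0+1) \<in> Ob" using X by simp_all
    ultimately show ?thesis using is_iso_Id by metis
  qed
  ultimately show ?thesis
    using EC[OF X_ex[OF assms(1)] cpx_eq_exact[OF assms(2) X_ex[OF assms(1)]], of "\<lambda>i. Id (ob X i)"]
      assms(1) le0[of n] by blast
qed

text \<open>Completes the output of (E2op): degree 0 comes from \<open>extend_pullback\<close>, the
  cokernel property from \<open>kernel_swap\<close> against a member with the same last map, and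
  membership from (EC) for the identities in degrees n and n+1.\<close>

lemma pull_exists:
  assumes Y: "Y \<in> \<X>" and c: "arr c" "cd c = ob Y (Suc n)"
  obtains X q where "X \<in> \<X>" "chm X Y q" "q 0 = Id (ob Y 0)" "ob X 0 = ob Y 0"
    "q (Suc n) = c" "ob X (Suc n) = dm c" "kerseq (cone X Y q)"
proof -
  have Yc: "Y \<in> cpxs" using Y by simp
  obtain X q where X: "ob X (Suc n) = dm c" "q (Suc n) = c" "n_pullback n \<C> X Y q" "admissible_epi n \<X> (df X n)"
    using E2_op[OF Y, of "dm c" c] c Y by auto
  have p: "pullback_data X Y q" and M: "kerseq (cone X Y q)" using X(3) n_pullback_iff by auto
  have "kerseq Y" using Y by simp
  from this p M obtain X' q' where X': "kerseq X'" "chm X' Y q'" "q' 0 = Id (ob Y 0)"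
    "ob X' 0 = ob Y 0" "\<And>i. 0 < i \<Longrightarrow> ob X' i = ob X i" "\<And>i. 0 < i \<Longrightarrow> df X' i = df X i" "\<And>i. 0 < i \<Longrightarrow> q' i = q i"
    "cone X' Y q' = cone X Y q" by (rule extend_pullback) blast
  have n0: "0 < n" using n_pos by simp
  obtain Z where Z: "Z \<in> \<X>" "df X n = df Z n" using X(4) unfolding admissible_epi_def by auto
  have Zc: "Z \<in> cpxs" and X'c: "X' \<in> cpxs" using Z X' by simp_all
  have eq: "df X' n = df Z n" using X'(6)[OF n0] Z by simp
  have "ob X' n = ob Z n" "ob X' (Suc n) = ob Z (Suc n)"
    using cpx_simps(3,4)[OF Zc, of n] cpx_simps(3,4)[OF X'c, of n] eq by auto
  from kernel_swap[OF X'(1) X_ex[OF Z(1)] eq this]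
  obtain \<alpha> where \<alpha>: "exseq X'" "chm X' Z \<alpha>" "\<alpha> n = Id (ob X' n)" "\<alpha> (Suc n) = Id (ob X' (Suc n))" by metis
  have "is_iso \<C> (ob X' n) (ob Z n) (\<alpha> n) \<and> is_iso \<C> (ob X' (n + 1)) (ob Z (n + 1)) (\<alpha> (n + 1))"
    using \<alpha>(3,4) is_iso_Id[of "ob Z n"] is_iso_Id[of "ob Z (Suc n)"] Zc
      \<open>ob X' n = ob Z n\<close> \<open>ob X' (Suc n) = ob Z (Suc n)\<close> by simp
  then have "X' \<in> \<X>" using EC[OF \<alpha>(1) X_ex[OF Z(1)] \<alpha>(2)] Z(1) by blast
  then show ?thesis using X' X(1,2) M by (intro that[of X' q']) auto
qed

text \<open>Every morphism of extensions into a member splits into one with an identity at the right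
  end followed by one with an identity at the left end. This is what will equate a pushout class
  with a pullback class.\<close>

lemma rel_pull_factor:
  assumes Y: "Y \<in> \<X>" and V: "V \<in> cpxs" and r: "rel V Y a c"
  obtains P where "P \<in> \<X>" "rel V P a (Id (ob V (Suc n)))" "rel P Y (Id (ob Y 0)) c"
    "ob P 0 = ob Y 0" "ob P (Suc n) = ob V (Suc n)"
proof -
  have Yc: "Y \<in> cpxs" using Y by simp
  obtain f where f: "chm V Y f" "f 0 = a" "f (Suc n) = c" using r by (rule relE)
  note t = rel_type[OF r V Yc]
  obtain X q where X: "X \<in> \<X>" "chm X Y q" "q 0 = Id (ob Y 0)" "ob X 0 = ob Y 0"
    "q (Suc n) = c" "ob X (Suc n) = dm c" "kerseq (cone X Y q)"
    using pull_exists[OF Y t(4,6)] by metis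
  have Xc: "X \<in> cpxs" using X by simp
  have "rel V X (f 0) (Id (ob V (Suc n)))"
    by (rule pullback_universal[OF Xc Yc X(2) _ X(7) V f(1)]) (use X f t V in auto)
  then show ?thesis using that[of X] X f t relI[OF X(2)] by auto
qed

text \<open>Factoring through the pullback \<open>P\<close> along \<open>c\<close> turns the right
  end component into an identity; with \<open>a\<close> invertible, the second alternative of (EC)
  compares \<open>V\<close> with \<open>P\<close>. Together with its dual this is the standard
  membership test from here on.\<close>

lemma closed_pull:
  assumes V: "exseq V" and Y: "Y \<in> \<X>" and r: "rel V Y a c" and a: "is_iso \<C> (ob V 0) (ob Y 0) a"
  shows "V \<in> \<X>"
proof -
  have Vc: "V \<in> cpxs" using V by simp
  obtain P where P: "P \<in> \<X>" "rel V P a (Id (ob V (Suc n)))" "ob P 0 = ob Y 0" "ob P (Suc n) = ob V (Suc n)"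
    using rel_pull_factor[OF Y Vc r] by metis
  obtain g where g: "chm V P g" "g 0 = a" "g (Suc n) = Id (ob V (Suc n))" using P(2) by (rule relE)
  show ?thesis
    using EC[OF V X_ex[OF P(1)] g(1)] a g P is_iso_Id[of "ob V (Suc n)"] Vc by auto
qed

text \<open>Extending the left end component over the first differential of \<open>Q\<close> and
  lifting the right one through the last differential of \<open>X\<close> are the two ends of one
  null homotopy. With \<open>factor_down\<close> this exchange of ends drives the splitting
  criterion and the long exact sequences.\<close>

lemma factor_up:
  assumes Q: "cokseq Q" and X: "X \<in> cpxs" and r: "rel Q X a c"
    and s: "arr s" "dm s = ob Q 1" "cd s = ob X 0" "a = s \<cdot> df Q 0"
  shows "\<exists>t. arr t \<and> dm t = ob Q (Suc n) \<and> cd t = ob X n \<and> c = df X n \<cdot> t"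
proof -
  obtain f where f: "chm Q X f" "f 0 = a" "f (Suc n) = c" using r by (rule relE)
  have Qc: "Q \<in> cpxs" using Q by simp
  obtain \<phi> where \<phi>: "null_htpy n \<C> Q X f \<phi>" by (rule null_htpy_up[OF Q X f(1) s(1-3)]) (use f s in auto)
  show ?thesis using null_htpyD[OF \<phi> Qc X] f by (intro exI[of _ "\<phi> n"]) auto
qed

lemma factor_down:
  assumes X: "kerseq X" and Q: "Q \<in> cpxs" and r: "rel Q X a c"
    and t: "arr t" "dm t = ob Q (Suc n)" "cd t = ob X n" "c = df X n \<cdot> t"
  shows "\<exists>s. arr s \<and> dm s = ob Q 1 \<and> cd s = ob X 0 \<and> a = s \<cdot> df Q 0"
proof -
  obtain f where f: "chm Q X f" "f 0 = a" "f (Suc n) = c" using r by (rule relE)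
  have Xc: "X \<in> cpxs" using X by simp
  obtain \<phi> where \<phi>: "null_htpy n \<C> Q X f \<phi>" by (rule null_htpy_down[OF X Q f(1) t(1-3)]) (use f t in auto)
  show ?thesis using null_htpyD[OF \<phi> Q Xc] f by (intro exI[of _ "\<phi> 0"]) auto
qed

lemma mcone_exact:
  assumes X: "X \<in> \<X>" and Y: "Y \<in> \<X>" and f: "chm X Y f" and f0: "f 0 = Id (ob X 0)"
  shows "exseq (cone X Y f)"
proof -
  have Xc: "X \<in> cpxs" and Yc: "Y \<in> cpxs" using X Y by simp_all
  note [simp] = Xc Yc chm_simps(1-3)[OF f Xc Yc]
  have ob0: "ob Y 0 = ob X 0" using chm_simps(3)[OF f Xc Yc, of 0] f0 by simp
  have "kerseq (cone X Y f)"
  proof (rule mcone_ker[OF _ _ f f0])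
    fix w v assume w: "arr w" "cd w = ob X (Suc n)" and v: "arr v" "cd v = ob Y n" "dm v = dm w"
      and fw: "f (Suc n) \<cdot> w = df Y n \<cdot> v"
    obtain Q q where Q: "Q \<in> \<X>" "chm Q X q" "q 0 = Id (ob X 0)" "ob Q 0 = ob X 0"
      "q (Suc n) = w" "ob Q (Suc n) = dm w" using pull_exists[OF X w] by metis
    have Qc: "Q \<in> cpxs" using Q by simp
    have r1: "rel Q X (Id (ob X 0)) w" using relI[OF Q(2,3,5)] .
    have "rel Q Y (f 0 \<cdot> Id (ob X 0)) (f (Suc n) \<cdot> w)"
      by (rule rel_trans[OF r1 relI[OF f]]) (use Qc in auto)
    then have r2: "rel Q Y (Id (ob X 0)) (f (Suc n) \<cdot> w)" using f0 by simp
    \<comment> \<open>By the exchange of ends the first map of \<open>Q\<close> splits, since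
      \<open>f w\<close> lifts through \<open>df Y n\<close>. The same splitting, read back along
      the map from \<open>Q\<close> to \<open>X\<close>, lifts \<open>w\<close> itself.\<close>
    have "\<exists>s. arr s \<and> dm s = ob Q 1 \<and> cd s = ob Y 0 \<and> Id (ob X 0) = s \<cdot> df Q 0"
      by (rule factor_down[OF _ Qc r2, of v]) (use Y v Q fw in auto)
    then obtain s where s: "arr s" "dm s = ob Q 1" "cd s = ob X 0" "Id (ob X 0) = s \<cdot> df Q 0" using ob0 by auto
    have "\<exists>t. arr t \<and> dm t = ob Q (Suc n) \<and> cd t = ob X n \<and> w = df X n \<cdot> t"
      by (rule factor_up[OF _ Xc r1 s]) (use Q in auto)
    then show "\<exists>u. arr u \<and> cd u = ob X n \<and> dm u = dm w \<and> df X n \<cdot> u = w" using Q(6) by metis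
  qed (use X Y in auto)
  moreover have "cokseq (cone X Y f)" by (rule mcone_cok[OF _ _ f f0]) (use X Y in auto)
  ultimately show ?thesis by (simp add: n_exact_seq_def)
qed

text \<open>The universal property on end components. The cone condition is automatic by
  \<open>mcone_exact\<close>, so every member over \<open>Y\<close> with left end identity serves as
  the pullback.\<close>

lemma rel_pull_universal:
  assumes X: "X \<in> \<X>" and Y: "Y \<in> \<X>" and V: "V \<in> cpxs"
    and r: "rel X Y (Id (ob X 0)) c" and s: "rel V Y a (c \<cdot> w)"
    and w: "arr w" "dm w = ob V (Suc n)" "cd w = ob X (Suc n)"
  shows "rel V X a w"
proof -
  have Xc: "X \<in> cpxs" and Yc: "Y \<in> cpxs" using X Y by simp_all
  obtain q where q: "chm X Y q" "q 0 = Id (ob X 0)" "q (Suc n) = c" using r by (rule relE)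
  obtain f where f: "chm V Y f" "f 0 = a" "f (Suc n) = c \<cdot> w" using s by (rule relE)
  have "kerseq (cone X Y q)" using mcone_exact[OF X Y q(1,2)] by (simp add: n_exact_seq_def)
  from pullback_universal[OF Xc Yc q(1,2) this V f(1) w] f q show ?thesis by simp
qed

text \<open>The universal property of \<open>X\<close> over \<open>Y\<close> yields the map back;
  for both composites the homotopy starts with the zero component, which requires control in degree
  0 alone.\<close>

lemma rel_id_htpy:
  assumes X: "X \<in> \<X>" and Y: "Y \<in> \<X>" and r: "rel X Y (Id (ob X 0)) (Id (ob X (Suc n)))"
  shows "htpy_equiv_betw n \<C> X Y"
proof -
  have Xc: "X \<in> cpxs" and Yc: "Y \<in> cpxs" using X Y by simp_all
  note t = rel_type[OF r Xc Yc]
  have o: "ob Y 0 = ob X 0" "ob Y (Suc n) = ob X (Suc n)" using t Xc by simp_all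
  have "rel Y X (Id (ob X 0)) (Id (ob X (Suc n)))"
    by (rule rel_pull_universal[OF X Y Yc r]) (use rel_refl[OF Yc] o Xc in auto)
  then obtain g where g: "chm Y X g" "g 0 = Id (ob X 0)" "g (Suc n) = Id (ob X (Suc n))" by (rule relE)
  obtain f where f: "chm X Y f" "f 0 = Id (ob X 0)" "f (Suc n) = Id (ob X (Suc n))" using r by (rule relE)
  have h: "homotopic n \<C> V V k (\<lambda>i. Id (ob V i))" if V: "V \<in> \<X>" and k: "chm V V k" "k 0 = Id (ob V 0)" for V k
  proof -
    have Vc: "V \<in> cpxs" using V by simp
    note [simp] = Vc
    obtain \<phi> where "null_htpy n \<C> V V (\<lambda>i. k i \<oplus> neg (Id (ob V i))) \<phi>"
      by (rule null_htpy_up[OF _ Vc chm_diff[OF k(1) chm_id[OF Vc] Vc Vc], of "Zm (ob V 1) (ob V 0)"])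
        (use V k in auto)
    from homotopic_of_null_htpy[OF this k(1) chm_id[OF Vc] Vc Vc] show ?thesis .
  qed
  have "homotopic n \<C> X X (\<lambda>i. g i \<cdot> f i) (\<lambda>i. Id (ob X i))"
    by (rule h[OF X chm_comp[OF f(1) g(1) Xc Yc Xc]]) (use f g Xc in auto)
  moreover have "homotopic n \<C> Y Y (\<lambda>i. f i \<cdot> g i) (\<lambda>i. Id (ob Y i))"
    by (rule h[OF Y chm_comp[OF g(1) f(1) Yc Xc Yc]]) (use f g Xc o in auto)
  ultimately show ?thesis unfolding htpy_equiv_betw_def chain_map_betw_def
    using f g o by (intro exI[of _ f] exI[of _ g]) simp
qed

end

context add_cat_n
begin

section \<open>Mapping cocones\<close>

lemma homotopic_eq:
  assumes X [simp]: "X \<in> cpxs" and f: "chm X X f" and e: "\<And>i. i \<le> Suc n \<Longrightarrow> f i = Id (ob X i)"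
  shows "homotopic n \<C> X X f (\<lambda>i. Id (ob X i))"
  unfolding homotopic_def by (rule exI[of _ "\<lambda>i. Zm (ob X (Suc i)) (ob X i)"]) (simp add: e)

text \<open>\<open>Q\<close> is not assumed to be a complex: its differentials are conjugate to
  those of \<open>P\<close>, and that gives the vanishing composites first. The sequences compared
  below come from pushout data, which do not contain this vanishing.\<close>

lemma iso_transfer:
  assumes P [simp]: "P \<in> cpxs" and [simp]: "\<And>i. i \<le> Suc n \<Longrightarrow> ob Q i \<in> Ob"
    and [simp]: "\<And>i. i \<le> n \<Longrightarrow> arr (df Q i)" "\<And>i. i \<le> n \<Longrightarrow> dm (df Q i) = ob Q i"
      "\<And>i. i \<le> n \<Longrightarrow> cd (df Q i) = ob Q (Suc i)"
    and [simp]: "\<And>i. i \<le> Suc n \<Longrightarrow> arr (\<sigma> i)" "\<And>i. i \<le> Suc n \<Longrightarrow> dm (\<sigma> i) = ob P i"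
      "\<And>i. i \<le> Suc n \<Longrightarrow> cd (\<sigma> i) = ob Q i"
    and [simp]: "\<And>i. i \<le> Suc n \<Longrightarrow> arr (\<tau> i)" "\<And>i. i \<le> Suc n \<Longrightarrow> dm (\<tau> i) = ob Q i"
      "\<And>i. i \<le> Suc n \<Longrightarrow> cd (\<tau> i) = ob P i"
    and \<tau>\<sigma>: "\<And>i. i \<le> Suc n \<Longrightarrow> \<tau> i \<cdot> \<sigma> i = Id (ob P i)" and \<sigma>\<tau>: "\<And>i. i \<le> Suc n \<Longrightarrow> \<sigma> i \<cdot> \<tau> i = Id (ob Q i)"
    and sq: "\<And>i. i \<le> n \<Longrightarrow> \<sigma> (Suc i) \<cdot> df P i = df Q i \<cdot> \<sigma> i"
  shows "Q \<in> cpxs" "kerseq P \<Longrightarrow> kerseq Q" "cokseq P \<Longrightarrow> cokseq Q"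
proof -
  have d: "df Q i = \<sigma> (Suc i) \<cdot> (df P i \<cdot> \<tau> i)" if "i \<le> n" for i
  proof -
    have "\<sigma> (Suc i) \<cdot> (df P i \<cdot> \<tau> i) = \<sigma> (Suc i) \<cdot> df P i \<cdot> \<tau> i" using that by (simp add: comp_assoc)
    also have "\<dots> = df Q i \<cdot> \<sigma> i \<cdot> \<tau> i" using sq[OF that] by simp
    also have "\<dots> = df Q i" using that by (simp add: comp_assoc \<sigma>\<tau>)
    finally show ?thesis by simp
  qed
  show Q [simp]: "Q \<in> cpxs"
  proof (rule complexesI)
    fix i assume i: "i < n"
    have "df Q (Suc i) \<cdot> df Q i = df Q (Suc i) \<cdot> \<sigma> (Suc i) \<cdot> (df P i \<cdot> \<tau> i)"
      using i d[of i] by (simp add: comp_assoc)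
    also have "\<dots> = \<sigma> (Suc (Suc i)) \<cdot> df P (Suc i) \<cdot> (df P i \<cdot> \<tau> i)" using i sq[of "Suc i"] by simp
    also have "\<dots> = Zm (ob Q i) (ob Q (Suc (Suc i)))" using i by (simp add: comp_assoc)
    finally show "df Q (Suc i) \<cdot> df Q i = Zm (ob Q i) (ob Q (Suc (Suc i)))" .
  qed simp_all
  have \<sigma>: "chm P Q \<sigma>" by (rule chmI) (simp_all add: sq)
  have \<tau>: "chm Q P \<tau>"
  proof (rule chmI)
    fix i assume i: "i \<le> n"
    have "\<tau> (Suc i) \<cdot> df Q i = \<tau> (Suc i) \<cdot> \<sigma> (Suc i) \<cdot> (df P i \<cdot> \<tau> i)" using i d[OF i] by (simp add: comp_assoc)
    then show "\<tau> (Suc i) \<cdot> df Q i = df P i \<cdot> \<tau> i" using i by (simp add: \<tau>\<sigma>)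
  qed simp_all
  have h: "homotopic n \<C> Q Q (\<lambda>i. \<sigma> i \<cdot> \<tau> i) (\<lambda>i. Id (ob Q i))"
    by (rule homotopic_eq[OF Q chm_comp[OF \<tau> \<sigma> Q P Q] \<sigma>\<tau>])
  show "kerseq P \<Longrightarrow> kerseq Q" by (rule transfer_ker[OF Q _ \<tau> \<sigma> h]) (simp_all add: \<sigma>\<tau>)
  show "cokseq P \<Longrightarrow> cokseq Q" by (rule transfer_cok[OF Q _ \<tau> \<sigma> h]) (simp_all add: \<sigma>\<tau>)
qed

definition pushout_data :: "('o, 'm) cpx \<Rightarrow> ('o, 'm) cpx \<Rightarrow> (nat \<Rightarrow> 'm) \<Rightarrow> bool" where
  "pushout_data X Y f \<longleftrightarrow> (\<forall>i\<le>n. ob X i \<in> Ob \<and> ob Y i \<in> Ob \<and> f i \<in> Mor \<C> (ob X i) (ob Y i)) \<and>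
     (\<forall>i<n. df X i \<in> Mor \<C> (ob X i) (ob X (i+1)) \<and> df Y i \<in> Mor \<C> (ob Y i) (ob Y (i+1)) \<and>
        f (i+1) \<cdot> df X i = df Y i \<cdot> f i)"

lemma n_pushout_iff: "n_pushout n \<C> X Y f \<longleftrightarrow> pushout_data X Y f \<and> cokseq (cocone X Y f)"
  by (auto simp only: n_pushout_def pushout_data_def)

lemma pushout_dataI:
  assumes X: "X \<in> cpxs" and Y: "Y \<in> cpxs" and f: "chm X Y f"
  shows "pushout_data X Y f"
  using X Y chm_simps(1-4)[OF f X Y] unfolding pushout_data_def by simp

lemma pushout_data_obj:
  assumes "pushout_data X Y f" "i \<le> n"
  shows "ob X i \<in> Ob \<and> ob Y i \<in> Ob \<and> arr (f i) \<and> dm (f i) = ob X i \<and> cd (f i) = ob Y i"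
  using assms unfolding pushout_data_def by auto

lemma pushout_data_diff:
  assumes "pushout_data X Y f" "i < n"
  shows "arr (df X i) \<and> dm (df X i) = ob X i \<and> cd (df X i) = ob X (Suc i) \<and>
    arr (df Y i) \<and> dm (df Y i) = ob Y i \<and> cd (df Y i) = ob Y (Suc i)"
proof -
  have "df X i \<in> Mor \<C> (ob X i) (ob X (Suc i)) \<and> df Y i \<in> Mor \<C> (ob Y i) (ob Y (Suc i))"
    using assms unfolding pushout_data_def by auto
  then show ?thesis using pushout_data_obj[OF assms(1), of i] pushout_data_obj[OF assms(1), of "Suc i"] assms(2) by simp
qed

lemma pushout_data_simps:
  assumes "pushout_data X Y f"
  shows "i \<le> n \<Longrightarrow> ob X i \<in> Ob" "i \<le> n \<Longrightarrow> ob Y i \<in> Ob"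
    "i \<le> n \<Longrightarrow> arr (f i)" "i \<le> n \<Longrightarrow> dm (f i) = ob X i" "i \<le> n \<Longrightarrow> cd (f i) = ob Y i"
    "i < n \<Longrightarrow> arr (df X i)" "i < n \<Longrightarrow> dm (df X i) = ob X i" "i < n \<Longrightarrow> cd (df X i) = ob X (Suc i)"
    "i < n \<Longrightarrow> arr (df Y i)" "i < n \<Longrightarrow> dm (df Y i) = ob Y i" "i < n \<Longrightarrow> cd (df Y i) = ob Y (Suc i)"
  using pushout_data_obj[OF assms] pushout_data_diff[OF assms] by auto

text \<open>The biproduct chosen in the opposite category is also a biproduct in \<C>, with
  injections and projections exchanged; it just need not be the one that \<open>biprod \<C>\<close>
  picks.\<close>

lemma dsum_opc [simp]:
  assumes "A \<in> Ob" "B \<in> Ob"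
  shows "dsum \<D> A B \<in> Ob"
    "arr (inj1 \<D> A B)" "cd (inj1 \<D> A B) = A" "dm (inj1 \<D> A B) = dsum \<D> A B"
    "arr (inj2 \<D> A B)" "cd (inj2 \<D> A B) = B" "dm (inj2 \<D> A B) = dsum \<D> A B"
    "arr (prj1 \<D> A B)" "dm (prj1 \<D> A B) = A" "cd (prj1 \<D> A B) = dsum \<D> A B"
    "arr (prj2 \<D> A B)" "dm (prj2 \<D> A B) = B" "cd (prj2 \<D> A B) = dsum \<D> A B"
    "inj1 \<D> A B \<cdot> prj1 \<D> A B = Id A" "inj2 \<D> A B \<cdot> prj2 \<D> A B = Id B"
    "inj2 \<D> A B \<cdot> prj1 \<D> A B = Zm A B" "inj1 \<D> A B \<cdot> prj2 \<D> A B = Zm B A"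
    "prj1 \<D> A B \<cdot> inj1 \<D> A B \<oplus> prj2 \<D> A B \<cdot> inj2 \<D> A B = Id (dsum \<D> A B)"
  using additive_category.biprod_ex[OF additive_category_opc[OF additive_category_axioms], of A B] assms
  by (auto simp: is_biproduct_opc[OF additive_category_axioms assms] is_biproduct_def)

lemma dsum_opc_assoc [simp]:
  assumes "A \<in> Ob" "B \<in> Ob"
  shows "\<lbrakk>arr f; cd f = A\<rbrakk> \<Longrightarrow> inj1 \<D> A B \<cdot> (prj1 \<D> A B \<cdot> f) = f"
    "\<lbrakk>arr f; cd f = B\<rbrakk> \<Longrightarrow> inj2 \<D> A B \<cdot> (prj2 \<D> A B \<cdot> f) = f"
    "\<lbrakk>arr f; cd f = A\<rbrakk> \<Longrightarrow> inj2 \<D> A B \<cdot> (prj1 \<D> A B \<cdot> f) = Zm (dm f) B"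
    "\<lbrakk>arr f; cd f = B\<rbrakk> \<Longrightarrow> inj1 \<D> A B \<cdot> (prj2 \<D> A B \<cdot> f) = Zm (dm f) A"
  using assms by (simp_all flip: comp_assoc)

lemma col_opc:
  assumes "arr f" "arr g" "dm f = A" "dm g = B" "cd f = W" "cd g = W"
  shows "col_mor \<D> W A B f g = f \<cdot> inj1 \<D> A B \<oplus> g \<cdot> inj2 \<D> A B"
proof -
  have "A \<in> Ob" "B \<in> Ob" "W \<in> Ob" using assms by auto
  then show ?thesis using assms by (simp add: col_mor_def)
qed

lemma row_opc:
  assumes "arr f" "arr g" "cd f = A" "cd g = B" "dm f = W" "dm g = W"
  shows "row_mor \<D> A B W f g = prj1 \<D> A B \<cdot> f \<oplus> prj2 \<D> A B \<cdot> g"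
proof -
  have "A \<in> Ob" "B \<in> Ob" "W \<in> Ob" using assms by auto
  then show ?thesis using assms by (simp add: row_mor_def)
qed

lemma mat_opc:
  assumes "arr p" "arr q" "arr r" "arr s" "cd p = A" "cd r = A" "cd q = B" "cd s = B"
    "dm p = A'" "dm q = A'" "dm r = B'" "dm s = B'"
  shows "mat_mor \<D> A B A' B' p q r s =
     (prj1 \<D> A B \<cdot> p \<oplus> prj2 \<D> A B \<cdot> q) \<cdot> inj1 \<D> A' B' \<oplus>
     (prj1 \<D> A B \<cdot> r \<oplus> prj2 \<D> A B \<cdot> s) \<cdot> inj2 \<D> A' B'"
proof -
  have "A \<in> Ob" "B \<in> Ob" "A' \<in> Ob" "B' \<in> Ob" using assms by auto
  then show ?thesis using assms by (simp add: mat_mor_def col_opc row_opc)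
qed

text \<open>
  The direct sums chosen in \<open>\<C>\<close> and in its opposite category are unrelated, so a mapping cocone is
  a mapping cone of the opposite category only up to the isomorphism \<open>swap\<close> in each middle degree.
\<close>

abbreviation ccone where
  "ccone X Y h \<equiv> opx n (mcone n \<D> (opx n Y) (opx n X) (\<lambda>i. h (Suc n - i)))"

lemma ccone_simps:
  "ob (ccone X Y h) 0 = ob X 0"
  "i < n \<Longrightarrow> ob (ccone X Y h) (Suc i) = dsum \<D> (ob Y i) (ob X (Suc i))"
  "ob (ccone X Y h) (Suc n) = ob Y n"
proof -
  show "ob (ccone X Y h) 0 = ob X 0" "ob (ccone X Y h) (Suc n) = ob Y n" by (simp_all add: mcone_def)
  assume "i < n"
  then have "n - i \<noteq> 0" "n - i \<le> n" "Suc n - (n - i + 1) = i" "Suc n - (n - i) = Suc i" by auto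
  then show "ob (ccone X Y h) (Suc i) = dsum \<D> (ob Y i) (ob X (Suc i))"
    by (simp add: mcone_def)
qed

lemma mcocone_simps:
  "ob (cocone X Y h) 0 = ob X 0"
  "i < n \<Longrightarrow> ob (cocone X Y h) (Suc i) = dsum \<C> (ob X (Suc i)) (ob Y i)"
  "ob (cocone X Y h) (Suc n) = ob Y n"
  by (simp_all add: mcocone_def)

lemma mcocone_df:
  assumes p: "pushout_data X Y h"
  shows "df (cocone X Y h) 0 = col (ob X 0) (ob X (Suc 0)) (ob Y 0) (df X 0) (h 0)"
    "Suc i < n \<Longrightarrow> df (cocone X Y h) (Suc i) = mat (ob X (Suc i)) (ob Y i) (ob X (Suc (Suc i))) (ob Y (Suc i))
       (df X (Suc i)) (Zm (ob Y i) (ob X (Suc (Suc i)))) (h (Suc i)) (neg (df Y i))"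
    "\<lbrakk>i < n; n \<le> Suc i\<rbrakk> \<Longrightarrow> df (cocone X Y h) (Suc i) =
       row (ob X (Suc i)) (ob Y i) (ob Y (Suc i)) (h (Suc i)) (neg (df Y i))"
proof -
  note [simp] = pushout_data_simps[OF p]
  show "df (cocone X Y h) 0 = col (ob X 0) (ob X (Suc 0)) (ob Y 0) (df X 0) (h 0)"
    by (simp add: mcocone_def)
  show "Suc i < n \<Longrightarrow> df (cocone X Y h) (Suc i) = mat (ob X (Suc i)) (ob Y i) (ob X (Suc (Suc i))) (ob Y (Suc i))
       (df X (Suc i)) (Zm (ob Y i) (ob X (Suc (Suc i)))) (h (Suc i)) (neg (df Y i))"
    by (simp add: mcocone_def)
  assume i: "i < n" "n \<le> Suc i"
  then have e: "Suc i = n" by simp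
  then have "n - 1 = i" by simp
  then have "df (cocone X Y h) n = row (ob X n) (ob Y i) (ob Y n) (h n) (neg_mor \<C> (ob Y i) (ob Y n) (df Y i))"
    using n_pos by (simp add: mcocone_def)
  moreover have "cd (df Y i) = ob Y n" using pushout_data_simps(11)[OF p i(1)] e by simp
  ultimately show "df (cocone X Y h) (Suc i) =
       row (ob X (Suc i)) (ob Y i) (ob Y (Suc i)) (h (Suc i)) (neg (df Y i))"
    unfolding e using i by simp
qed

lemma ccone_df:
  assumes p: "pushout_data X Y h"
  shows "df (ccone X Y h) 0 = prj1 \<D> (ob Y 0) (ob X (Suc 0)) \<cdot> h 0 \<oplus> prj2 \<D> (ob Y 0) (ob X (Suc 0)) \<cdot> df X 0"
    "Suc i < n \<Longrightarrow> df (ccone X Y h) (Suc i) =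
       (prj1 \<D> (ob Y (Suc i)) (ob X (Suc (Suc i))) \<cdot> neg (df Y i)) \<cdot> inj1 \<D> (ob Y i) (ob X (Suc i)) \<oplus>
       (prj1 \<D> (ob Y (Suc i)) (ob X (Suc (Suc i))) \<cdot> h (Suc i) \<oplus>
        prj2 \<D> (ob Y (Suc i)) (ob X (Suc (Suc i))) \<cdot> df X (Suc i)) \<cdot> inj2 \<D> (ob Y i) (ob X (Suc i))"
    "\<lbrakk>i < n; n \<le> Suc i\<rbrakk> \<Longrightarrow> df (ccone X Y h) (Suc i) =
       neg (df Y i) \<cdot> inj1 \<D> (ob Y i) (ob X (Suc i)) \<oplus> h (Suc i) \<cdot> inj2 \<D> (ob Y i) (ob X (Suc i))"
proof -
  note [simp] = pushout_data_simps[OF p]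
  have n0: "0 < n" using n_pos by simp
  have "df (ccone X Y h) 0 = row_mor \<D> (ob Y 0) (ob X (Suc n - n)) (ob X 0) (h 0) (df X 0)"
    using n0 by (simp add: mcone_def)
  moreover have "Suc n - n = Suc 0" by simp
  ultimately show "df (ccone X Y h) 0 = prj1 \<D> (ob Y 0) (ob X (Suc 0)) \<cdot> h 0 \<oplus> prj2 \<D> (ob Y 0) (ob X (Suc 0)) \<cdot> df X 0"
    using n0 by (simp add: row_opc)
  show "df (ccone X Y h) (Suc i) =
       (prj1 \<D> (ob Y (Suc i)) (ob X (Suc (Suc i))) \<cdot> neg (df Y i)) \<cdot> inj1 \<D> (ob Y i) (ob X (Suc i)) \<oplus>
       (prj1 \<D> (ob Y (Suc i)) (ob X (Suc (Suc i))) \<cdot> h (Suc i) \<oplus>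
        prj2 \<D> (ob Y (Suc i)) (ob X (Suc (Suc i))) \<cdot> df X (Suc i)) \<cdot> inj2 \<D> (ob Y i) (ob X (Suc i))"
    if i: "Suc i < n"
  proof -
    have e: "n - Suc i \<noteq> 0" "n - Suc i < n" "Suc n - (n - Suc i + 1) = Suc i" "Suc n - (n - Suc i) = Suc (Suc i)"
      "Suc n - (n - Suc i + 2) = i" "n - (n - Suc i + 1) = i" "n - (n - Suc i) = Suc i"
      using i by auto
    have "df (ccone X Y h) (Suc i) = mat_mor \<D> (ob Y (Suc i)) (ob X (Suc (Suc i))) (ob Y i) (ob X (Suc i))
       (neg_mor \<C> (ob Y i) (ob Y (Suc i)) (df Y i)) (Zm (ob Y i) (ob X (Suc (Suc i)))) (h (Suc i)) (df X (Suc i))"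
      using e(1,2) unfolding mcone_def by (simp only: opx_simps if_False if_True simp_thms e cpx.simps opc_simps)
    also have "\<dots> = mat_mor \<D> (ob Y (Suc i)) (ob X (Suc (Suc i))) (ob Y i) (ob X (Suc i))
       (neg (df Y i)) (Zm (ob Y i) (ob X (Suc (Suc i)))) (h (Suc i)) (df X (Suc i))"
      using i by simp
    also have "\<dots> = (prj1 \<D> (ob Y (Suc i)) (ob X (Suc (Suc i))) \<cdot> neg (df Y i) \<oplus>
           prj2 \<D> (ob Y (Suc i)) (ob X (Suc (Suc i))) \<cdot> Zm (ob Y i) (ob X (Suc (Suc i)))) \<cdot> inj1 \<D> (ob Y i) (ob X (Suc i)) \<oplus>
       (prj1 \<D> (ob Y (Suc i)) (ob X (Suc (Suc i))) \<cdot> h (Suc i) \<oplus>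
        prj2 \<D> (ob Y (Suc i)) (ob X (Suc (Suc i))) \<cdot> df X (Suc i)) \<cdot> inj2 \<D> (ob Y i) (ob X (Suc i))"
      by (rule mat_opc) (use i in simp_all)
    finally show ?thesis using i by simp
  qed
  show "df (ccone X Y h) (Suc i) =
       neg (df Y i) \<cdot> inj1 \<D> (ob Y i) (ob X (Suc i)) \<oplus> h (Suc i) \<cdot> inj2 \<D> (ob Y i) (ob X (Suc i))"
    if i: "i < n" "n \<le> Suc i"
  proof -
    have e: "n - Suc i = 0" "Suc n - 1 = Suc i" "Suc n - 2 = i" "n - 1 = i" using i by auto
    have "df (ccone X Y h) (Suc i) = col_mor \<D> (ob Y (Suc i)) (ob Y i) (ob X (Suc i))
       (neg_mor \<C> (ob Y i) (ob Y (Suc i)) (df Y i)) (h (Suc i))"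
      unfolding mcone_def by (simp only: opx_simps if_True simp_thms e cpx.simps opc_simps)
    also have "\<dots> = neg (df Y i) \<cdot> inj1 \<D> (ob Y i) (ob X (Suc i)) \<oplus> h (Suc i) \<cdot> inj2 \<D> (ob Y i) (ob X (Suc i))"
      using i by (subst col_opc) simp_all
    finally show ?thesis .
  qed
qed

lemma mcocone_type:
  assumes p: "pushout_data X Y h"
  shows "i \<le> Suc n \<Longrightarrow> ob (cocone X Y h) i \<in> Ob"
    "i \<le> n \<Longrightarrow> arr (df (cocone X Y h) i) \<and> dm (df (cocone X Y h) i) = ob (cocone X Y h) i \<and> cd (df (cocone X Y h) i) = ob (cocone X Y h) (Suc i)"
proof -
  note [simp] = pushout_data_simps[OF p] mcocone_simps
  have n0: "0 < n" using n_pos by simp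
  show "ob (cocone X Y h) i \<in> Ob" if "i \<le> Suc n"
  proof (cases i)
    case (Suc j) then show ?thesis using that by (cases "j = n") simp_all
  qed simp
  show "arr (df (cocone X Y h) i) \<and> dm (df (cocone X Y h) i) = ob (cocone X Y h) i \<and>
     cd (df (cocone X Y h) i) = ob (cocone X Y h) (Suc i)" if i: "i \<le> n"
  proof (cases i)
    case 0 then show ?thesis using n0 by (simp add: mcocone_df[OF p])
  next
    case (Suc j)
    show ?thesis
    proof (cases "Suc j < n")
      case True then show ?thesis using Suc by (simp add: mcocone_df[OF p])
    next
      case False
      then have j: "j < n" "n \<le> Suc j" and e: "Suc j = n" using Suc i by auto
      have "ob (cocone X Y h) (Suc (Suc j)) = ob Y (Suc j)" using e by simp
      then show ?thesis unfolding Suc mcocone_df(3)[OF p j] using j by simp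
    qed
  qed
qed

lemma ccone_type:
  assumes p: "pushout_data X Y h"
  shows "i \<le> Suc n \<Longrightarrow> ob (ccone X Y h) i \<in> Ob"
    "i \<le> n \<Longrightarrow> arr (df (ccone X Y h) i) \<and> dm (df (ccone X Y h) i) = ob (ccone X Y h) i \<and> cd (df (ccone X Y h) i) = ob (ccone X Y h) (Suc i)"
proof -
  note [simp] = pushout_data_simps[OF p] ccone_simps
  note [simp del] = opx_simps
  have n0: "0 < n" using n_pos by simp
  show "ob (ccone X Y h) i \<in> Ob" if "i \<le> Suc n"
  proof (cases i)
    case (Suc j) then show ?thesis using that by (cases "j = n") simp_all
  qed simp
  show "arr (df (ccone X Y h) i) \<and> dm (df (ccone X Y h) i) = ob (ccone X Y h) i \<and>
     cd (df (ccone X Y h) i) = ob (ccone X Y h) (Suc i)" if i: "i \<le> n"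
  proof (cases i)
    case 0 then show ?thesis using n0 by (simp add: ccone_df[OF p])
  next
    case (Suc j)
    show ?thesis
    proof (cases "Suc j < n")
      case True then show ?thesis using Suc by (simp add: ccone_df[OF p])
    next
      case False
      then have j: "j < n" "n \<le> Suc j" and e: "Suc j = n" using Suc i by auto
      have "ob (ccone X Y h) (Suc (Suc j)) = ob Y (Suc j)" using e by simp
      then show ?thesis unfolding Suc ccone_df(3)[OF p j] using j by simp
    qed
  qed
qed

text \<open>Besides changing the chosen biproduct it exchanges the summands, since the cone of the
  reversed map lists the terms of \<open>Y\<close> first. No sign is inserted: the minus sign falls
  on the differential of \<open>Y\<close> in both sequences.\<close>

definition swap :: "'o \<Rightarrow> 'o \<Rightarrow> 'm" where
  "swap A B = row A B (dsum \<D> B A) (prj2 \<D> B A) (prj1 \<D> B A)"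

definition swap' :: "'o \<Rightarrow> 'o \<Rightarrow> 'm" where
  "swap' A B = col (dsum \<D> B A) A B (inj2 \<D> B A) (inj1 \<D> B A)"

lemma swap_simps [simp]:
  assumes [simp]: "A \<in> Ob" "B \<in> Ob"
  shows "arr (swap A B)" "dm (swap A B) = dsum \<C> A B" "cd (swap A B) = dsum \<D> B A"
    "arr (swap' A B)" "cd (swap' A B) = dsum \<C> A B" "dm (swap' A B) = dsum \<D> B A"
    "swap' A B \<cdot> swap A B = Id (dsum \<C> A B)" "swap A B \<cdot> swap' A B = Id (dsum \<D> B A)"
    "swap A B \<cdot> in1 A B = prj2 \<D> B A" "swap A B \<cdot> in2 A B = prj1 \<D> B A"
proof -
  show "arr (swap A B)" "dm (swap A B) = dsum \<C> A B" "cd (swap A B) = dsum \<D> B A"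
    "arr (swap' A B)" "cd (swap' A B) = dsum \<C> A B" "dm (swap' A B) = dsum \<D> B A"
    "swap A B \<cdot> in1 A B = prj2 \<D> B A" "swap A B \<cdot> in2 A B = prj1 \<D> B A"
    by (simp_all add: swap_def swap'_def)
  show "swap A B \<cdot> swap' A B = Id (dsum \<D> B A)"
    by (simp add: swap_def swap'_def row_comp) (subst add_comm; simp)
  show "swap' A B \<cdot> swap A B = Id (dsum \<C> A B)"
  proof (rule dsum_ext[of _ _ A B])
    show "pr1 A B \<cdot> (swap' A B \<cdot> swap A B) = pr1 A B \<cdot> Id (dsum \<C> A B)"
      by (rule dsum_coext[of _ _ A B]) (simp_all add: swap_def swap'_def comp_assoc)
    show "pr2 A B \<cdot> (swap' A B \<cdot> swap A B) = pr2 A B \<cdot> Id (dsum \<C> A B)"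
      by (rule dsum_coext[of _ _ A B]) (simp_all add: swap_def swap'_def comp_assoc)
  qed (simp_all add: swap_def swap'_def)
qed

lemma swap_square:
  assumes p: "pushout_data X Y h" and i: "i \<le> n"
    and s: "\<And>i. s i = (case i of 0 \<Rightarrow> Id (ob X 0) | Suc k \<Rightarrow> if k < n then swap (ob X (Suc k)) (ob Y k) else Id (ob Y n))"
  shows "s (Suc i) \<cdot> df (cocone X Y h) i = df (ccone X Y h) i \<cdot> s i"
proof -
  note [simp] = pushout_data_simps[OF p]
  note [simp del] = opx_simps
  have n0: "0 < n" using n_pos by simp
  show ?thesis
  proof (cases i)
    case 0
    have "swap (ob X (Suc 0)) (ob Y 0) \<cdot> col (ob X 0) (ob X (Suc 0)) (ob Y 0) (df X 0) (h 0) =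
      prj2 \<D> (ob Y 0) (ob X (Suc 0)) \<cdot> df X 0 \<oplus> prj1 \<D> (ob Y 0) (ob X (Suc 0)) \<cdot> h 0"
      using n0 by (simp add: comp_col)
    also have "\<dots> = prj1 \<D> (ob Y 0) (ob X (Suc 0)) \<cdot> h 0 \<oplus> prj2 \<D> (ob Y 0) (ob X (Suc 0)) \<cdot> df X 0"
      using n0 by (intro add_comm) simp_all
    finally show ?thesis using 0 n0 by (simp add: s mcocone_df(1)[OF p] ccone_df(1)[OF p])
  next
    case (Suc k)
    show ?thesis
    proof (cases "Suc k < n")
      case True
      let ?A = "ob X (Suc k)" and ?B = "ob Y k" and ?A' = "ob X (Suc (Suc k))" and ?B' = "ob Y (Suc k)"
      have "swap ?A' ?B' \<cdot> mat ?A ?B ?A' ?B' (df X (Suc k)) (Zm ?B ?A') (h (Suc k)) (neg (df Y k)) =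
        ((prj1 \<D> ?B' ?A' \<cdot> neg (df Y k)) \<cdot> inj1 \<D> ?B ?A \<oplus>
       (prj1 \<D> ?B' ?A' \<cdot> h (Suc k) \<oplus> prj2 \<D> ?B' ?A' \<cdot> df X (Suc k)) \<cdot> inj2 \<D> ?B ?A) \<cdot> swap ?A ?B"
        (is "?l = ?r")
      proof (rule dsum_coext[of _ _ ?A ?B])
        have "?l \<cdot> in1 ?A ?B = prj2 \<D> ?B' ?A' \<cdot> df X (Suc k) \<oplus> prj1 \<D> ?B' ?A' \<cdot> h (Suc k)"
          using True by (simp add: comp_assoc comp_col)
        also have "\<dots> = prj1 \<D> ?B' ?A' \<cdot> h (Suc k) \<oplus> prj2 \<D> ?B' ?A' \<cdot> df X (Suc k)"
          using True by (intro add_comm) simp_all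
        also have "\<dots> = ?r \<cdot> in1 ?A ?B" using True by (simp add: comp_assoc comp_add)
        finally show "?l \<cdot> in1 ?A ?B = ?r \<cdot> in1 ?A ?B" .
        show "?l \<cdot> in2 ?A ?B = ?r \<cdot> in2 ?A ?B" using True by (simp add: comp_assoc comp_add comp_col)
      qed (use True in simp_all)
      then show ?thesis using Suc True by (simp add: s mcocone_df(2)[OF p] ccone_df(2)[OF p])
    next
      case False
      then have j: "k < n" "n \<le> Suc k" and e: "Suc k = n" using Suc i by auto
      let ?A = "ob X (Suc k)" and ?B = "ob Y k"
      have "s (Suc (Suc k)) = Id (ob Y (Suc k))" using e by (simp add: s)
      moreover have "row ?A ?B (ob Y (Suc k)) (h (Suc k)) (neg (df Y k)) =
         (neg (df Y k) \<cdot> inj1 \<D> ?B ?A \<oplus> h (Suc k) \<cdot> inj2 \<D> ?B ?A) \<cdot> swap ?A ?B"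
        by (rule dsum_coext[of _ _ ?A ?B]) (use j in \<open>simp_all add: comp_assoc comp_add\<close>)
      ultimately show ?thesis unfolding Suc mcocone_df(3)[OF p j] ccone_df(3)[OF p j] using j by (simp add: s)
    qed
  qed
qed

lemma mcocone_ccone:
  assumes p: "pushout_data X Y h"
  shows "kerseq (ccone X Y h) \<Longrightarrow> kerseq (cocone X Y h)"
    "cokseq (ccone X Y h) \<longleftrightarrow> cokseq (cocone X Y h)"
proof -
  let ?P = "cocone X Y h" and ?Q = "ccone X Y h"
  note [simp] = pushout_data_simps[OF p] ccone_simps mcocone_simps
  note [simp del] = opx_simps
  define s where "s = (\<lambda>i. case i of 0 \<Rightarrow> Id (ob X 0) | Suc k \<Rightarrow> if k < n then swap (ob X (Suc k)) (ob Y k) else Id (ob Y n))"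
  define t where "t = (\<lambda>i. case i of 0 \<Rightarrow> Id (ob X 0) | Suc k \<Rightarrow> if k < n then swap' (ob X (Suc k)) (ob Y k) else Id (ob Y n))"
  have s: "arr (s i) \<and> dm (s i) = ob ?P i \<and> cd (s i) = ob ?Q i \<and> arr (t i) \<and> dm (t i) = ob ?Q i \<and> cd (t i) = ob ?P i \<and>
     t i \<cdot> s i = Id (ob ?P i) \<and> s i \<cdot> t i = Id (ob ?Q i)" if "i \<le> Suc n" for i
  proof (cases i)
    case 0 then show ?thesis by (simp add: s_def t_def)
  next
    case (Suc k) then show ?thesis using that by (cases "k = n") (simp_all add: s_def t_def)
  qed
  have sq: "s (Suc i) \<cdot> df ?P i = df ?Q i \<cdot> s i" if "i \<le> n" for i
    by (rule swap_square[OF p that]) (simp add: s_def)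
  have tq: "t (Suc i) \<cdot> df ?Q i = df ?P i \<cdot> t i" if "i \<le> n" for i
  proof -
    note [simp] = s[of i] s[of "Suc i"] mcocone_type[OF p] ccone_type[OF p]
    have "t (Suc i) \<cdot> df ?Q i = t (Suc i) \<cdot> (df ?Q i \<cdot> s i \<cdot> t i)" using that by (simp add: comp_assoc del: ccone_simps mcocone_simps)
    also have "\<dots> = t (Suc i) \<cdot> (s (Suc i) \<cdot> df ?P i \<cdot> t i)" using sq[OF that] by simp
    also have "\<dots> = t (Suc i) \<cdot> (s (Suc i) \<cdot> (df ?P i \<cdot> t i))"
      using that by (simp add: comp_assoc del: ccone_simps mcocone_simps)
    also have "\<dots> = t (Suc i) \<cdot> s (Suc i) \<cdot> (df ?P i \<cdot> t i)"
      by (rule comp_assoc[symmetric]) (use that in \<open>simp_all del: ccone_simps mcocone_simps\<close>)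
    also have "\<dots> = df ?P i \<cdot> t i" using that by (simp del: ccone_simps mcocone_simps)
    finally show ?thesis .
  qed
  note PQ = iso_transfer[of ?P ?Q s t] and QP = iso_transfer[of ?Q ?P t s]
  show "kerseq ?Q \<Longrightarrow> kerseq ?P"
    by (rule QP(2)) (use s sq tq mcocone_type[OF p] ccone_type[OF p] in \<open>auto\<close>)
  have "cokseq ?Q \<Longrightarrow> cokseq ?P"
    by (rule QP(3)) (use s sq tq mcocone_type[OF p] ccone_type[OF p] in \<open>auto\<close>)
  moreover have "cokseq ?P \<Longrightarrow> cokseq ?Q"
    by (rule PQ(3)) (use s sq tq mcocone_type[OF p] ccone_type[OF p] in \<open>auto\<close>)
  ultimately show "cokseq ?Q \<longleftrightarrow> cokseq ?P" by blast
qed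

lemma n_exact_mcocone:
  assumes X: "X \<in> cpxs" and Y: "Y \<in> cpxs" and h: "chm X Y h"
    and e: "n_exact_seq n \<D> (mcone n \<D> (opx n Y) (opx n X) (\<lambda>i. h (Suc n - i)))"
  shows "exseq (cocone X Y h)"
  using n_exact_opx[OF e] mcocone_ccone[OF pushout_dataI[OF X Y h]] by (simp add: n_exact_seq_def)

lemma n_cokernel_mcocone:
  assumes p: "pushout_data X Y h"
  shows "cokseq (cocone X Y h) \<longleftrightarrow>
    n_kernel_seq n \<D> (mcone n \<D> (opx n Y) (opx n X) (\<lambda>i. h (Suc n - i)))"
    (is "?l \<longleftrightarrow> n_kernel_seq n _ ?M")
proof
  assume ?l
  then have "cokseq (opx n ?M)" using mcocone_ccone(2)[OF p] by blast
  from coexact_opx[OF this] show "n_kernel_seq n \<D> ?M" by (rule kernel_cong[OF opx_opx])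
next
  assume "n_kernel_seq n \<D> ?M"
  from exact_opx[OF this] show ?l using mcocone_ccone(2)[OF p] by simp
qed

text \<open>The projection to the first summand, with \<open>df Y n\<close> in the last degree,
  where the cocone has no summand from \<open>X\<close>. Its end components will identify the cocone
  with the pullback of \<open>[X]\<close> along \<open>df Y n\<close>.\<close>

lemma chm_from_mcocone:
  assumes X: "X \<in> cpxs" and Y: "Y \<in> cpxs" and h: "chm X Y h"
    and h1: "h (Suc n) = Id (ob X (Suc n))" and C: "cocone X Y h \<in> cpxs"
  shows "rel (cocone X Y h) X (Id (ob X 0)) (df Y n)"
proof -
  note p = pushout_dataI[OF X Y h]
  let ?M = "cocone X Y h"
  note [simp] = X Y C chm_simps(1-3)[OF h X Y] mcocone_simps
  have n0: "0 < n" using n_pos by simp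
  have ob1: "ob Y (Suc n) = ob X (Suc n)" using chm_simps(3)[OF h X Y, of "Suc n"] h1 by simp
  define j where "j = (\<lambda>i. case i of 0 \<Rightarrow> Id (ob X 0) | Suc k \<Rightarrow> if k < n then pr1 (ob X (Suc k)) (ob Y k) else df Y n)"
  have "chm ?M X j"
  proof (rule chmI[OF C X])
    fix i assume "i \<le> Suc n"
    then show "arr (j i) \<and> dm (j i) = ob ?M i \<and> cd (j i) = ob X i"
    proof (cases i)
      case (Suc k) then show ?thesis using \<open>i \<le> Suc n\<close> ob1 by (cases "k = n") (simp_all add: j_def)
    qed (simp add: j_def)
  next
    fix i assume i: "i \<le> n"
    show "j (Suc i) \<cdot> df ?M i = df X i \<cdot> j i"
    proof (cases i)
      case 0 then show ?thesis using n0 by (simp add: j_def mcocone_df(1)[OF p])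
    next
      case (Suc k)
      let ?A = "ob X (Suc k)" and ?B = "ob Y k"
      show ?thesis
      proof (cases "Suc k < n")
        case True
        have "row ?A ?B (ob X (Suc (Suc k))) (df X (Suc k)) (Zm ?B (ob X (Suc (Suc k)))) = df X (Suc k) \<cdot> pr1 ?A ?B"
          by (rule dsum_coext[of _ _ ?A ?B]) (use True in \<open>simp_all add: comp_assoc\<close>)
        then show ?thesis using Suc True by (simp add: j_def mcocone_df(2)[OF p])
      next
        case False
        then have k: "k < n" "n \<le> Suc k" and e: "n = Suc k" using Suc i by auto
        have "Y \<in> complexes (Suc k) \<C>" "X \<in> complexes (Suc k) \<C>" using X Y e by auto
        have hs: "df Y (Suc k) \<cdot> h (Suc k) = df X (Suc k)"
          using chm_simps(4)[OF h X Y i] h1 Suc e k cpx_simps(2-4)[OF X i] by simp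
        have j1: "j (Suc (Suc k)) = df Y (Suc k)" using k e by (simp add: j_def)
        have "df Y (Suc k) \<cdot> row ?A ?B (ob Y (Suc k)) (h (Suc k)) (neg (df Y k)) = df X (Suc k) \<cdot> pr1 ?A ?B"
          by (rule dsum_coext[of _ _ ?A ?B]) (use k hs ob1[unfolded e] in \<open>simp_all add: comp_assoc\<close>)
        then show ?thesis unfolding Suc j1 mcocone_df(3)[OF p k] using k by (simp add: j_def)
      qed
    qed
  qed
  then show ?thesis by (rule relI) (simp_all add: j_def)
qed

end

lemma cpx_eq_sym: "cpx_eq n X Y \<Longrightarrow> cpx_eq n Y X"
  by (auto simp: cpx_eq_def)

lemma mcone_cong:
  assumes "cpx_eq n X X'" "cpx_eq n Y Y'" "\<And>i. i \<le> Suc n \<Longrightarrow> f i = f' i" "1 \<le> n"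
  shows "cpx_eq n (mcone n \<C> X Y f) (mcone n \<C> X' Y' f')"
  using assms unfolding cpx_eq_def mcone_def by auto

lemma n_pullback_cong:
  assumes "cpx_eq n X X'" "cpx_eq n Y Y'" "\<And>i. i \<le> Suc n \<Longrightarrow> f i = f' i" "1 \<le> n" "n_pullback n \<C> X Y f"
  shows "n_pullback n \<C> X' Y' f'"
proof -
  have "n_kernel_seq n \<C> (mcone n \<C> X' Y' f')"
    using kernel_cong[OF mcone_cong[OF assms(1-4)]] assms(5) by (simp add: n_pullback_def)
  then show ?thesis using assms unfolding n_pullback_def cpx_eq_def by auto
qed

lemma is_iso_opc: "is_iso (opc \<C>) A B f \<longleftrightarrow> is_iso \<C> B A f"
  by (auto simp: is_iso_def)

context add_cat_n
begin

lemma n_pushout_opx: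
  assumes "n_pushout n \<C> X Y h"
  shows "n_pullback n \<D> (opx n Y) (opx n X) (\<lambda>i. h (Suc n - i))"
proof -
  have p: "pushout_data X Y h" and c: "cokseq (cocone X Y h)" using assms n_pushout_iff by auto
  have "df Y (n - i) \<in> Mor \<C> (ob Y (n - i)) (ob Y (Suc n - i)) \<and>
        df X (n - i) \<in> Mor \<C> (ob X (n - i)) (ob X (Suc n - i)) \<and>
        h (Suc n - i) \<cdot> df X (n - i) = df Y (n - i) \<cdot> h (n - i)" if "1 \<le> i" "i \<le> n" for i
  proof -
    have "n - i < n" "Suc n - i = Suc (n - i)" using that by auto
    then show ?thesis using p unfolding pushout_data_def by (simp del: Mor_iff)
  qed
  moreover have "ob Y (Suc n - i) \<in> Ob \<and> ob X (Suc n - i) \<in> Ob \<and> h (Suc n - i) \<in> Mor \<C> (ob X (Suc n - i)) (ob Y (Suc n - i))"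
    if "1 \<le> i" for i
    using p that unfolding pushout_data_def by (simp del: Mor_iff)
  ultimately show ?thesis unfolding n_pullback_def using c n_cokernel_mcocone[OF p] by (auto simp del: Mor_iff)
qed

section \<open>Zero objects and the trivial complexes\<close>

lemma zero_unique:
  assumes "is_zero_object \<C> Z" "arr y"
  shows "cd y = Z \<Longrightarrow> y = Zm (dm y) Z" "dm y = Z \<Longrightarrow> y = Zm Z (cd y)"
  using assms unfolding is_zero_object_def by (metis Mor_iff Zm_type arr_cd arr_dm)+

lemma zero_objD [simp]: "is_zero_object \<C> Z \<Longrightarrow> Z \<in> Ob"
  by (simp add: is_zero_object_def)

lemma triv_left_simps:
  "ob (triv_left \<C> A Z) 0 = A" "ob (triv_left \<C> A Z) (Suc 0) = A" "ob (triv_left \<C> A Z) (Suc (Suc i)) = Z"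
  "df (triv_left \<C> A Z) 0 = Id A" "df (triv_left \<C> A Z) (Suc 0) = Zm A Z" "df (triv_left \<C> A Z) (Suc (Suc i)) = Zm Z Z"
  by (simp_all add: triv_left_def)

lemma triv_left_exact:
  assumes A: "A \<in> Ob" and Z: "is_zero_object \<C> Z"
  shows "exseq (triv_left \<C> A Z)"
proof -
  let ?T = "triv_left \<C> A Z"
  note [simp] = A zero_objD[OF Z] triv_left_simps
  have T: "?T \<in> cpxs"
  proof (rule complexesI)
    fix i
    \<comment> \<open>The degrees have three shapes: 0, 1 and at least 2.\<close>
    show "ob ?T i \<in> Ob" by (cases i; cases "i - 1") simp_all
    show "arr (df ?T i) \<and> dm (df ?T i) = ob ?T i \<and> cd (df ?T i) = ob ?T (Suc i)"
      by (cases i; cases "i - 1") simp_all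
    show "df ?T (Suc i) \<cdot> df ?T i = Zm (ob ?T i) (ob ?T (Suc (Suc i)))"
      by (cases i; cases "i - 1") simp_all
  qed
  have "kerseq ?T"
  proof (rule nkerI[OF T])
    fix y assume "arr y" "cd y = ob ?T 0" "df ?T 0 \<cdot> y = Zm (dm y) (ob ?T (Suc 0))"
    then show "y = Zm (dm y) (ob ?T 0)" by simp
  next
    fix i y assume i: "i < n" and y: "arr y" "cd y = ob ?T (Suc i)" "df ?T (Suc i) \<cdot> y = Zm (dm y) (ob ?T (Suc (Suc i)))"
    show "\<exists>z. arr z \<and> cd z = ob ?T i \<and> dm z = dm y \<and> df ?T i \<cdot> z = y"
    proof (cases i)
      case 0 then show ?thesis using y by (intro exI[of _ y]) simp
    next
      case (Suc k)
      then have "y = Zm (dm y) Z" using y zero_unique(1)[OF Z y(1)] by simp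
      then show ?thesis using T i Suc y
        by (intro exI[of _ "Zm (dm y) (ob ?T i)"]) simp
    qed
  qed
  moreover have "cokseq ?T"
  proof (rule ncokI[OF T])
    fix y assume y: "arr y" "dm y = ob ?T (Suc n)"
    then have "dm y = Z" using n_pos by (cases n) simp_all
    then show "y = Zm (ob ?T (Suc n)) (cd y)" using zero_unique(2)[OF Z y(1)] y by simp
  next
    fix i y assume i: "i < n" and y: "arr y" "dm y = ob ?T (Suc i)" "y \<cdot> df ?T i = Zm (ob ?T i) (cd y)"
    have "y = Zm (ob ?T (Suc i)) (cd y)"
    proof (cases i)
      case 0 then show ?thesis using y by simp
    next
      case (Suc k) then show ?thesis using y zero_unique(2)[OF Z y(1)] by simp
    qed
    then show "\<exists>z. arr z \<and> dm z = ob ?T (Suc (Suc i)) \<and> cd z = cd y \<and> z \<cdot> df ?T (Suc i) = y"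
      using T i y by (intro exI[of _ "Zm (ob ?T (Suc (Suc i))) (cd y)"]) (simp del: triv_left_simps)
  qed
  ultimately show ?thesis by (simp add: n_exact_seq_def)
qed

lemma is_zero_object_opc: "is_zero_object \<C> Z \<Longrightarrow> is_zero_object \<D> Z"
  unfolding is_zero_object_def by (simp del: Mor_iff zero_objD)

text \<open>An equality of records, even outside the relevant degrees: the default branches agree
  with what truncated subtraction yields there.\<close>

lemma triv_right_opx: "triv_right n \<C> Z A = opx n (triv_left \<D> A Z)"
  unfolding triv_right_def triv_left_def opx_def by (auto simp: fun_eq_iff)

lemma triv_right_exact:
  assumes A: "A \<in> Ob" and Z: "is_zero_object \<C> Z"
  shows "exseq (triv_right n \<C> Z A)"
  using n_exact_opx[OF add_cat_n.triv_left_exact[OF add_cat_n_opc _ is_zero_object_opc[OF Z], of A]] A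
  by (simp add: triv_right_opx)

lemma rel_zero:
  assumes X: "X \<in> cpxs" and Y: "Y \<in> cpxs"
  shows "rel X Y (Zm (ob X 0) (ob Y 0)) (Zm (ob X (Suc n)) (ob Y (Suc n)))"
  by (rule relI[of _ _ "\<lambda>i. Zm (ob X i) (ob Y i)"], rule chmI) (use X Y in simp_all)

section \<open>Direct sums of complexes\<close>

lemma dsum_cpx:
  "ob (cdsum X Y) i = dsum \<C> (ob X i) (ob Y i)"
  "df (cdsum X Y) i = mat (ob X i) (ob Y i) (ob X (Suc i)) (ob Y (Suc i))
     (df X i) (Zm (ob Y i) (ob X (Suc i))) (Zm (ob X i) (ob Y (Suc i))) (df Y i)"
  by (simp_all add: cpx_dsum_def)

lemma cpx_dsum_complex [simp]:
  assumes [simp]: "X \<in> cpxs" "Y \<in> cpxs"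
  shows "cdsum X Y \<in> cpxs"
proof (rule complexesI)
  let ?D = "cdsum X Y"
  note [simp] = dsum_cpx
  show "ob ?D i \<in> Ob" if "i \<le> Suc n" for i using that by simp
  show "arr (df ?D i) \<and> dm (df ?D i) = ob ?D i \<and> cd (df ?D i) = ob ?D (Suc i)" if "i \<le> n" for i using that by simp
  show "df ?D (Suc i) \<cdot> df ?D i = Zm (ob ?D i) (ob ?D (Suc (Suc i)))" if i: "i < n" for i
  proof (rule dsum_ext[of _ _ "ob X (Suc (Suc i))" "ob Y (Suc (Suc i))"])
    show "pr1 (ob X (Suc (Suc i))) (ob Y (Suc (Suc i))) \<cdot> (df ?D (Suc i) \<cdot> df ?D i) =
        pr1 (ob X (Suc (Suc i))) (ob Y (Suc (Suc i))) \<cdot> Zm (ob ?D i) (ob ?D (Suc (Suc i)))"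
      by (rule dsum_coext[of _ _ "ob X i" "ob Y i"]) (use i in \<open>simp_all add: comp_assoc comp_col\<close>)
    show "pr2 (ob X (Suc (Suc i))) (ob Y (Suc (Suc i))) \<cdot> (df ?D (Suc i) \<cdot> df ?D i) =
        pr2 (ob X (Suc (Suc i))) (ob Y (Suc (Suc i))) \<cdot> Zm (ob ?D i) (ob ?D (Suc (Suc i)))"
      by (rule dsum_coext[of _ _ "ob X i" "ob Y i"]) (use i in \<open>simp_all add: comp_assoc comp_col\<close>)
  qed (use i in simp_all)
qed

lemma cpx_dsum_prj:
  assumes [simp]: "X \<in> cpxs" "Y \<in> cpxs" and i: "i \<le> n" "arr u" "cd u = dsum \<C> (ob X i) (ob Y i)"
  shows "pr1 (ob X (Suc i)) (ob Y (Suc i)) \<cdot> (df (cdsum X Y) i \<cdot> u) = df X i \<cdot> (pr1 (ob X i) (ob Y i) \<cdot> u)"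
    "pr2 (ob X (Suc i)) (ob Y (Suc i)) \<cdot> (df (cdsum X Y) i \<cdot> u) = df Y i \<cdot> (pr2 (ob X i) (ob Y i) \<cdot> u)"
  using i by (simp_all add: dsum_cpx)

lemma cpx_dsum_inj:
  assumes [simp]: "X \<in> cpxs" "Y \<in> cpxs" and i: "i \<le> n"
    and u: "arr u" "dm u = dsum \<C> (ob X (Suc i)) (ob Y (Suc i))"
  shows "u \<cdot> df (cdsum X Y) i \<cdot> in1 (ob X i) (ob Y i) = u \<cdot> in1 (ob X (Suc i)) (ob Y (Suc i)) \<cdot> df X i"
    "u \<cdot> df (cdsum X Y) i \<cdot> in2 (ob X i) (ob Y i) = u \<cdot> in2 (ob X (Suc i)) (ob Y (Suc i)) \<cdot> df Y i"
  using i u by (simp_all add: dsum_cpx comp_assoc comp_col)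

lemma cpx_dsum_kernel:
  assumes X: "kerseq X" and Y: "kerseq Y"
  shows "kerseq (cdsum X Y)"
proof -
  let ?D = "cdsum X Y"
  have Xc: "X \<in> cpxs" and Yc: "Y \<in> cpxs" using X Y by simp_all
  note [simp] = Xc Yc
  have D: "?D \<in> cpxs" by simp
  show ?thesis
  proof (rule nkerI[OF D])
    fix y assume y: "arr y" "cd y = ob ?D 0" and dy: "df ?D 0 \<cdot> y = Zm (dm y) (ob ?D (Suc 0))"
    have y' [simp]: "arr y" "cd y = dsum \<C> (ob X 0) (ob Y 0)" using y by (simp_all add: dsum_cpx)
    have "df X 0 \<cdot> (pr1 (ob X 0) (ob Y 0) \<cdot> y) = df X 0 \<cdot> Zm (dm y) (ob X 0)"
      using cpx_dsum_prj(1)[OF Xc Yc _ y'] unfolding dy by (simp add: dsum_cpx)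
    then have 1: "pr1 (ob X 0) (ob Y 0) \<cdot> y = Zm (dm y) (ob X 0)" by - (rule nker_inj[OF X]; simp)
    have "df Y 0 \<cdot> (pr2 (ob X 0) (ob Y 0) \<cdot> y) = df Y 0 \<cdot> Zm (dm y) (ob Y 0)"
      using cpx_dsum_prj(2)[OF Xc Yc _ y'] unfolding dy by (simp add: dsum_cpx)
    then have 2: "pr2 (ob X 0) (ob Y 0) \<cdot> y = Zm (dm y) (ob Y 0)" by - (rule nker_inj[OF Y]; simp)
    show "y = Zm (dm y) (ob ?D 0)"
      by (rule dsum_ext[of _ _ "ob X 0" "ob Y 0"]) (use 1 2 in \<open>simp_all add: dsum_cpx\<close>)
  next
    fix i y assume i: "i < n" and y: "arr y" "cd y = ob ?D (Suc i)"
      and dy: "df ?D (Suc i) \<cdot> y = Zm (dm y) (ob ?D (Suc (Suc i)))"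
    let ?A = "ob X (Suc i)" and ?B = "ob Y (Suc i)"
    have y' [simp]: "arr y" "cd y = dsum \<C> ?A ?B" using y by (simp_all add: dsum_cpx)
    have "df X (Suc i) \<cdot> (pr1 ?A ?B \<cdot> y) = Zm (dm y) (ob X (Suc (Suc i)))"
      using cpx_dsum_prj(1)[OF Xc Yc _ y'] i unfolding dy by (simp add: dsum_cpx)
    then obtain u where u: "arr u" "cd u = ob X i" "dm u = dm y" "df X i \<cdot> u = pr1 ?A ?B \<cdot> y"
      using nker_ex[OF X i, of "pr1 ?A ?B \<cdot> y"] i by auto
    have "df Y (Suc i) \<cdot> (pr2 ?A ?B \<cdot> y) = Zm (dm y) (ob Y (Suc (Suc i)))"
      using cpx_dsum_prj(2)[OF Xc Yc _ y'] i unfolding dy by (simp add: dsum_cpx)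
    then obtain v where v: "arr v" "cd v = ob Y i" "dm v = dm y" "df Y i \<cdot> v = pr2 ?A ?B \<cdot> y"
      using nker_ex[OF Y i, of "pr2 ?A ?B \<cdot> y"] i by auto
    let ?z = "col (dm y) (ob X i) (ob Y i) u v"
    have z: "arr ?z" "cd ?z = dsum \<C> (ob X i) (ob Y i)" "dm ?z = dm y" using u v by simp_all
    have "df ?D i \<cdot> ?z = y"
      by (rule dsum_ext[of _ _ ?A ?B])
        (use u v i z cpx_dsum_prj[OF Xc Yc _ z(1,2)] in \<open>simp_all add: dsum_cpx(1)\<close>)
    then show "\<exists>z. arr z \<and> cd z = ob ?D i \<and> dm z = dm y \<and> df ?D i \<cdot> z = y"
      using z by (intro exI[of _ ?z]) (simp add: dsum_cpx(1))
  qed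
qed

lemma cpx_dsum_cokernel:
  assumes X: "cokseq X" and Y: "cokseq Y"
  shows "cokseq (cdsum X Y)"
proof -
  let ?D = "cdsum X Y"
  have Xc: "X \<in> cpxs" and Yc: "Y \<in> cpxs" using X Y by simp_all
  note [simp] = Xc Yc
  have D: "?D \<in> cpxs" by simp
  have part: "y \<cdot> in1 (ob X (Suc i)) (ob Y (Suc i)) \<cdot> df X i = Zm (ob X i) (cd y) \<and>
     y \<cdot> in2 (ob X (Suc i)) (ob Y (Suc i)) \<cdot> df Y i = Zm (ob Y i) (cd y)"
    if "i \<le> n" "arr y" "dm y = dsum \<C> (ob X (Suc i)) (ob Y (Suc i))" "y \<cdot> df ?D i = Zm (ob ?D i) (cd y)" for i y
    using cpx_dsum_inj[OF Xc Yc that(1-3)] that unfolding that(4) by (simp add: dsum_cpx)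
  show ?thesis
  proof (rule ncokI[OF D])
    fix y assume y: "arr y" "dm y = ob ?D (Suc n)" and dy: "y \<cdot> df ?D n = Zm (ob ?D n) (cd y)"
    let ?A = "ob X (Suc n)" and ?B = "ob Y (Suc n)"
    have y' [simp]: "arr y" "dm y = dsum \<C> ?A ?B" using y by (simp_all add: dsum_cpx)
    note pt = part[OF _ y' dy]
    have "y \<cdot> in1 ?A ?B \<cdot> df X n = Zm ?A (cd y) \<cdot> df X n" using pt by simp
    then have 1: "y \<cdot> in1 ?A ?B = Zm ?A (cd y)" by - (rule ncok_inj[OF X]; simp)
    have "y \<cdot> in2 ?A ?B \<cdot> df Y n = Zm ?B (cd y) \<cdot> df Y n" using pt by simp
    then have 2: "y \<cdot> in2 ?A ?B = Zm ?B (cd y)" by - (rule ncok_inj[OF Y]; simp)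
    show "y = Zm (ob ?D (Suc n)) (cd y)"
      by (rule dsum_coext[of _ _ ?A ?B]) (use 1 2 in \<open>simp_all add: dsum_cpx\<close>)
  next
    fix i y assume i: "i < n" and y: "arr y" "dm y = ob ?D (Suc i)"
      and dy: "y \<cdot> df ?D i = Zm (ob ?D i) (cd y)"
    let ?A = "ob X (Suc i)" and ?B = "ob Y (Suc i)"
    have y' [simp]: "arr y" "dm y = dsum \<C> ?A ?B" using y by (simp_all add: dsum_cpx)
    note pt = part[OF _ y' dy]
    obtain u where u: "arr u" "dm u = ob X (Suc (Suc i))" "cd u = cd y" "u \<cdot> df X (Suc i) = y \<cdot> in1 ?A ?B"
      using ncok_ex[OF X i, of "y \<cdot> in1 ?A ?B"] i pt by auto
    obtain v where v: "arr v" "dm v = ob Y (Suc (Suc i))" "cd v = cd y" "v \<cdot> df Y (Suc i) = y \<cdot> in2 ?A ?B"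
      using ncok_ex[OF Y i, of "y \<cdot> in2 ?A ?B"] i pt by auto
    let ?z = "row (ob X (Suc (Suc i))) (ob Y (Suc (Suc i))) (cd y) u v"
    have z: "arr ?z" "dm ?z = dsum \<C> (ob X (Suc (Suc i))) (ob Y (Suc (Suc i)))" "cd ?z = cd y" using u v by simp_all
    have "?z \<cdot> df ?D (Suc i) = y"
      by (rule dsum_coext[of _ _ ?A ?B])
        (use u v i z cpx_dsum_inj[OF Xc Yc _ z(1,2)] in \<open>simp_all add: dsum_cpx(1)\<close>)
    then show "\<exists>z. arr z \<and> dm z = ob ?D (Suc (Suc i)) \<and> cd z = cd y \<and> z \<cdot> df ?D (Suc i) = y"
      using z by (intro exI[of _ ?z]) (simp add: dsum_cpx(1))
  qed
qed

lemma cpx_dsum_exact: "\<lbrakk>exseq X; exseq Y\<rbrakk> \<Longrightarrow> exseq (cdsum X Y)"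
  by (simp add: n_exact_seq_def cpx_dsum_kernel cpx_dsum_cokernel)

text \<open>With \<open>rel_col\<close>, the source of all chain maps used for Baer sums: rows and
  columns of end components again belong to chain maps.\<close>

lemma rel_row:
  assumes r: "rel X Z a c" and s: "rel Y Z a' c'"
    and [simp]: "X \<in> cpxs" "Y \<in> cpxs" "Z \<in> cpxs"
  shows "rel (cdsum X Y) Z (row (ob X 0) (ob Y 0) (ob Z 0) a a')
    (row (ob X (Suc n)) (ob Y (Suc n)) (ob Z (Suc n)) c c')"
proof -
  obtain f where f: "chm X Z f" "f 0 = a" "f (Suc n) = c" using r by (rule relE)
  obtain g where g: "chm Y Z g" "g 0 = a'" "g (Suc n) = c'" using s by (rule relE)
  note [simp] = chm_simps[OF f(1) assms(3,5)] chm_simps[OF g(1) assms(4,5)]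
  have "chm (cdsum X Y) Z (\<lambda>i. row (ob X i) (ob Y i) (ob Z i) (f i) (g i))"
  proof (rule chmI)
    fix i assume i: "i \<le> n"
    let ?r = "\<lambda>i. row (ob X i) (ob Y i) (ob Z i) (f i) (g i)"
    have t: "arr (?r (Suc i))" "dm (?r (Suc i)) = dsum \<C> (ob X (Suc i)) (ob Y (Suc i))" using i by simp_all
    show "?r (Suc i) \<cdot> df (cdsum X Y) i = df Z i \<cdot> ?r i"
      by (rule dsum_coext[of _ _ "ob X i" "ob Y i"])
        (use i cpx_dsum_inj[OF assms(3,4) i t] in \<open>simp_all add: dsum_cpx(1) comp_assoc[of _ "row_mor _ _ _ _ _ _"]\<close>)
  qed (simp_all add: dsum_cpx(1))
  then show ?thesis by (rule relI) (use f g in simp_all)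
qed

lemma rel_col:
  assumes r: "rel Z X a c" and s: "rel Z Y a' c'"
    and [simp]: "X \<in> cpxs" "Y \<in> cpxs" "Z \<in> cpxs"
  shows "rel Z (cdsum X Y) (col (ob Z 0) (ob X 0) (ob Y 0) a a')
    (col (ob Z (Suc n)) (ob X (Suc n)) (ob Y (Suc n)) c c')"
proof -
  obtain f where f: "chm Z X f" "f 0 = a" "f (Suc n) = c" using r by (rule relE)
  obtain g where g: "chm Z Y g" "g 0 = a'" "g (Suc n) = c'" using s by (rule relE)
  note [simp] = chm_simps[OF f(1) assms(5,3)] chm_simps[OF g(1) assms(5,4)]
  have "chm Z (cdsum X Y) (\<lambda>i. col (ob Z i) (ob X i) (ob Y i) (f i) (g i))"
  proof (rule chmI)
    fix i assume i: "i \<le> n"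
    let ?r = "\<lambda>i. col (ob Z i) (ob X i) (ob Y i) (f i) (g i)"
    have t: "arr (?r i)" "cd (?r i) = dsum \<C> (ob X i) (ob Y i)" using i by simp_all
    show "?r (Suc i) \<cdot> df Z i = df (cdsum X Y) i \<cdot> ?r i"
      by (rule dsum_ext[of _ _ "ob X (Suc i)" "ob Y (Suc i)"])
        (use i cpx_dsum_prj[OF assms(3,4) i t] in \<open>simp_all add: dsum_cpx(1)\<close>)
  qed (simp_all add: dsum_cpx(1))
  then show ?thesis by (rule relI) (use f g in simp_all)
qed

end

section \<open>Extension classes\<close>

text \<open>A preimage, not an image: reversal is an involution only within the degrees 0 to n+1,
  and in this form membership unfolds directly.\<close>

definition opX :: "nat \<Rightarrow> ('o, 'm) cpx set \<Rightarrow> ('o, 'm) cpx set" where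
  "opX n \<X> = {X. opx n X \<in> \<X>}"

lemma cpx_eq_refl: "cpx_eq n X X"
  by (simp add: cpx_eq_def)

lemma rel_opx_opx [simp]:
  "erel n \<C> (opx n (opx n X)) Y a c \<longleftrightarrow> erel n \<C> X Y a c"
  "erel n \<C> X (opx n (opx n Y)) a c \<longleftrightarrow> erel n \<C> X Y a c"
  by (rule rel_cong[OF opx_opx cpx_eq_refl], rule rel_cong[OF cpx_eq_refl opx_opx])

locale n_exact_pos = n_exact_category n \<C> \<X>
  for n :: nat and \<C> :: "('o, 'm) precat" (structure) and \<X> :: "('o, 'm) cpx set" +
  assumes n_ge_1: "1 \<le> n"

sublocale n_exact_pos \<subseteq> pullback_category n \<C> \<X>
proof unfold_locales
  fix X Y h
  assume "n_exact_seq n \<C> X" "n_exact_seq n \<C> Y" "chain_map n \<C> X Y h"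
    "(\<exists>k\<le>n. is_iso \<C> (ob X k) (ob Y k) (h k) \<and>
                 is_iso \<C> (ob X (k+1)) (ob Y (k+1)) (h (k+1))) \<or>
        (is_iso \<C> (ob X 0) (ob Y 0) (h 0) \<and>
         is_iso \<C> (ob X (n+1)) (ob Y (n+1)) (h (n+1)))"
  then show "X \<in> \<X> \<longleftrightarrow> Y \<in> \<X>" by (rule EC)
qed (use n_ge_1 X_n_exact E2_op in auto)

context n_exact_pos
begin

abbreviation EG where "EG \<equiv> Ext_group n \<C> \<X>"
abbreviation Em where "Em \<equiv> Ext_map n \<C>"

lemma mem_opX: "X \<in> \<X> \<Longrightarrow> opx n X \<in> opX n \<X>"
  unfolding opX_def using X_cong[OF _ cpx_eq_sym[OF opx_opx]] by simp

text \<open>The bridge of the duality: (EC) is self-dual, and (E2) read in the opposite category is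
  \<open>E2_op\<close>.\<close>

lemma pullback_category_opc: "pullback_category n \<D> (opX n \<X>)"
proof (rule pullback_category.intro[OF add_cat_n_opc], rule pullback_category_axioms.intro)
  show ex: "n_exact_seq n \<D> X" if "X \<in> opX n \<X>" for X
  proof -
    have "exseq (opx n X)" using that X_ex by (simp add: opX_def)
    from n_exact_opx[OF this] show ?thesis
      using kernel_cong[OF opx_opx] cokernel_cong[OF opx_opx] unfolding n_exact_seq_def by blast
  qed
  show "X \<in> opX n \<X> \<longleftrightarrow> Y \<in> opX n \<X>"
    if X: "n_exact_seq n \<D> X" and Y: "n_exact_seq n \<D> Y" and h: "chain_map n \<D> X Y h"
      and iso: "(\<exists>k\<le>n. is_iso \<D> (ob X k) (ob Y k) (h k) \<and>
                 is_iso \<D> (ob X (k+1)) (ob Y (k+1)) (h (k+1))) \<or>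
        (is_iso \<D> (ob X 0) (ob Y 0) (h 0) \<and>
         is_iso \<D> (ob X (n+1)) (ob Y (n+1)) (h (n+1)))" for X Y h
  proof -
    have e: "exseq (opx n Y)" "exseq (opx n X)"
      "chm (opx n Y) (opx n X) (\<lambda>i. h (Suc n - i))"
      using n_exact_opx[OF X] n_exact_opx[OF Y] chain_map_opx[OF h] by simp_all
    from iso have "(\<exists>k\<le>n. is_iso \<C> (ob (opx n Y) k) (ob (opx n X) k) (h (Suc n - k)) \<and>
                 is_iso \<C> (ob (opx n Y) (k+1)) (ob (opx n X) (k+1)) (h (Suc n - (k+1)))) \<or>
        (is_iso \<C> (ob (opx n Y) 0) (ob (opx n X) 0) (h (Suc n - 0)) \<and>
         is_iso \<C> (ob (opx n Y) (n+1)) (ob (opx n X) (n+1)) (h (Suc n - (n+1))))"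
    proof (elim disjE exE conjE)
      fix k assume "k \<le> n" "is_iso \<D> (ob X k) (ob Y k) (h k)" "is_iso \<D> (ob X (k+1)) (ob Y (k+1)) (h (k+1))"
      \<comment> \<open>Reversal turns the degrees \<open>k\<close> and \<open>k + 1\<close> into
        \<open>n - k + 1\<close> and \<open>n - k\<close>.\<close>
      then show ?thesis by (intro disjI1 exI[of _ "n - k"]) (simp add: is_iso_opc Suc_diff_le)
    qed (simp add: is_iso_opc)
    from EC[OF e this] show ?thesis unfolding opX_def by simp
  qed
  show "\<exists>X f. ob X (n+1) = D \<and> f (n+1) = c \<and> n_pullback n \<D> X Y f \<and> admissible_epi n (opX n \<X>) (df X n)"
    if Y: "Y \<in> opX n \<X>" and D: "D \<in> Obj \<D>" and c: "c \<in> Mor \<D> D (ob Y (n+1))" for Y D c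
  proof -
    obtain Y' f where f: "ob Y' 0 = D" "f 0 = c" "n_pushout n \<C> (opx n Y) Y' f" "admissible_mono \<X> (df Y' 0)"
      using E2[of "opx n Y" D c] Y D c unfolding opX_def by auto
    have "n_pullback n \<D> (opx n Y') Y (\<lambda>i. f (Suc n - i))"
      by (rule n_pullback_cong[OF _ opx_opx refl n_ge_1 n_pushout_opx[OF f(3)]]) (simp add: cpx_eq_def)
    moreover obtain Z where "Z \<in> \<X>" "df Y' 0 = df Z 0" using f(4) unfolding admissible_mono_def by auto
    then have "admissible_epi n (opX n \<X>) (df (opx n Y') n)"
      unfolding admissible_epi_def using mem_opX by (intro bexI[of _ "opx n Z"]) auto
    ultimately show ?thesis using f(1,2) by (intro exI[of _ "opx n Y'"] exI[of _ "\<lambda>i. f (Suc n - i)"]) simp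
  qed
qed

text \<open>\<open>closed_pull\<close> in the opposite category. It returns \<open>V\<close>
  reversed twice, which \<open>X_cong\<close> repairs.\<close>

lemma closed_push:
  assumes X: "X \<in> \<X>" and V: "exseq V" and r: "rel X V a c"
    and c: "is_iso \<C> (ob X (Suc n)) (ob V (Suc n)) c"
  shows "V \<in> \<X>"
proof -
  have "opx n V \<in> opX n \<X>"
    by (rule pullback_category.closed_pull[OF pullback_category_opc n_exact_opx[OF V] mem_opX[OF X] rel_opx[OF r]])
      (use c in \<open>simp add: is_iso_opc\<close>)
  then show ?thesis unfolding opX_def using X_cong[OF _ opx_opx] by blast
qed

lemma rel_push_universal:
  assumes X: "X \<in> \<X>" and Y: "Y \<in> \<X>" and V: "V \<in> cpxs"
    and r: "rel X Y a (Id (ob Y (Suc n)))" and s: "rel X V (w \<cdot> a) c"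
    and w: "arr w" "dm w = ob Y 0" "cd w = ob V 0"
  shows "rel Y V w c"
proof -
  have "erel n \<D> (opx n V) (opx n Y) c w"
    by (rule pullback_category.rel_pull_universal[OF pullback_category_opc mem_opX[OF Y] mem_opX[OF X] complexes_opx[OF V]])
      (use rel_opx[OF r] rel_opx[OF s] w in simp_all)
  then show ?thesis by (simp add: rel_opx_iff)
qed

lemma mcocone_exact:
  assumes X: "X \<in> \<X>" and Y: "Y \<in> \<X>" and h: "chm X Y h" and h1: "h (Suc n) = Id (ob Y (Suc n))"
  shows "exseq (cocone X Y h)"
  by (rule n_exact_mcocone[OF X_simps(4)[OF X] X_simps(4)[OF Y] h],
      rule pullback_category.mcone_exact[OF pullback_category_opc mem_opX[OF Y] mem_opX[OF X] chain_map_opx[OF h]]) (simp add: h1)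

lemma mcone_mem:
  assumes X: "X \<in> \<X>" and Y: "Y \<in> \<X>" and f: "chm X Y f" and f0: "f 0 = Id (ob X 0)"
  shows "cone X Y f \<in> \<X>" "rel Y (cone X Y f) (df X 0) (Id (ob Y (Suc n)))"
proof -
  show r: "rel Y (cone X Y f) (df X 0) (Id (ob Y (Suc n)))"
    by (rule chm_to_mcone[OF X_simps(4)[OF X] X_simps(4)[OF Y] f f0], rule relI)
  show "cone X Y f \<in> \<X>"
    by (rule closed_push[OF Y mcone_exact[OF X Y f f0] r]) (use Y in \<open>simp add: mcone_ob is_iso_Id\<close>)
qed

lemma mcocone_mem:
  assumes X: "X \<in> \<X>" and Y: "Y \<in> \<X>" and h: "chm X Y h" and h1: "h (Suc n) = Id (ob X (Suc n))"
  shows "cocone X Y h \<in> \<X>" "rel (cocone X Y h) X (Id (ob X 0)) (df Y n)"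
proof -
  have h1': "h (Suc n) = Id (ob Y (Suc n))"
    using chm_simps(3)[OF h X_simps(4)[OF X] X_simps(4)[OF Y], of "Suc n"] h1 X by simp
  note e = mcocone_exact[OF X Y h h1']
  show r: "rel (cocone X Y h) X (Id (ob X 0)) (df Y n)"
    by (rule chm_from_mcocone[OF X_simps(4)[OF X] X_simps(4)[OF Y] h h1]) (use e in simp)
  show "cocone X Y h \<in> \<X>"
    by (rule closed_pull[OF e X r]) (use X in \<open>simp add: mcocone_simps is_iso_Id\<close>)
qed

text \<open>\<open>X\<close> is a pullback of \<open>Y\<close> along an identity, so the identity of
  \<open>Y\<close> factors through it.\<close>

lemma rel_sym:
  assumes X: "X \<in> \<X>" and Y: "Y \<in> \<X>" and r: "rel X Y (Id (ob X 0)) (Id (ob X (Suc n)))"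
  shows "rel Y X (Id (ob Y 0)) (Id (ob Y (Suc n)))"
proof -
  note t = rel_type[OF r X_simps(4)[OF X] X_simps(4)[OF Y]]
  have o: "ob Y 0 = ob X 0" "ob Y (Suc n) = ob X (Suc n)" using t X by simp_all
  show ?thesis
    by (rule rel_pull_universal[OF X Y X_simps(4)[OF Y] r]) (use rel_refl[OF X_simps(4)[OF Y]] o X in auto)
qed

abbreviation cl :: "('o, 'm) cpx \<Rightarrow> ('o, 'm) cpx set" where "cl X \<equiv> hclass n \<C> X"
abbreviation Es :: "'o \<Rightarrow> 'o \<Rightarrow> ('o, 'm) cpx set set" where "Es C A \<equiv> Ext_set n \<C> \<X> C A"
abbreviation pull :: "'m \<Rightarrow> ('o, 'm) cpx set \<Rightarrow> ('o, 'm) cpx set" where "pull c \<delta> \<equiv> Ext_pull n \<C> c \<delta>"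
abbreviation push :: "'m \<Rightarrow> ('o, 'm) cpx set \<Rightarrow> ('o, 'm) cpx set" where "push a \<delta> \<equiv> Ext_push n \<C> a \<delta>"

text \<open>Reduces class membership to one chain map. From left to right, a complex equivalent to
  \<open>X\<close> is n-exact and then a member by \<open>closed_push\<close>, so a class never
  leaves \<X>.\<close>

lemma hclass_iff:
  assumes X: "X \<in> \<X>"
  shows "Z \<in> cl X \<longleftrightarrow> Z \<in> \<X> \<and> ob Z 0 = ob X 0 \<and> ob Z (Suc n) = ob X (Suc n) \<and>
    rel X Z (Id (ob X 0)) (Id (ob X (Suc n)))"
proof
  assume "Z \<in> cl X"
  then have Z: "Z \<in> complexes_betw n \<C> (ob X 0) (ob X (n+1))" "htpy_equiv_betw n \<C> X Z" by (auto simp: hclass_def)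
  then have o: "ob Z 0 = ob X 0" "ob Z (Suc n) = ob X (Suc n)" by (auto simp: complexes_betw_def)
  have r: "rel X Z (Id (ob X 0)) (Id (ob X (Suc n)))"
    using Z(2) unfolding htpy_equiv_betw_def chain_map_betw_def erel_def by auto
  have "Z \<in> \<X>"
    by (rule closed_push[OF X n_exact_htpy[OF X_ex[OF X] Z] r]) (use X o in \<open>simp add: is_iso_Id\<close>)
  then show "Z \<in> \<X> \<and> ob Z 0 = ob X 0 \<and> ob Z (Suc n) = ob X (Suc n) \<and>
    rel X Z (Id (ob X 0)) (Id (ob X (Suc n)))" using o r by blast
next
  assume Z: "Z \<in> \<X> \<and> ob Z 0 = ob X 0 \<and> ob Z (Suc n) = ob X (Suc n) \<and>
    rel X Z (Id (ob X 0)) (Id (ob X (Suc n)))"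
  then show "Z \<in> cl X" using rel_id_htpy[OF X, of Z] by (simp add: hclass_def complexes_betw_def)
qed

lemma self_mem_cl: "X \<in> \<X> \<Longrightarrow> X \<in> cl X"
  using hclass_iff rel_refl by simp

lemma cl_eq:
  assumes X: "X \<in> \<X>" and Y: "Y \<in> \<X>" and r: "rel X Y (Id (ob X 0)) (Id (ob X (Suc n)))"
  shows "cl X = cl Y"
proof -
  note t = rel_type[OF r X_simps(4)[OF X] X_simps(4)[OF Y]]
  have o: "ob Y 0 = ob X 0" "ob Y (Suc n) = ob X (Suc n)" using t X by simp_all
  note Xc = X_simps(4)[OF X] and Yc = X_simps(4)[OF Y]
  have "rel X Z (Id (ob X 0)) (Id (ob X (Suc n))) \<longleftrightarrow> rel Y Z (Id (ob Y 0)) (Id (ob Y (Suc n)))"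
    if Z: "Z \<in> \<X>" for Z
  proof
    assume "rel X Z (Id (ob X 0)) (Id (ob X (Suc n)))"
    from rel_trans[OF rel_sym[OF X Y r] this Yc Xc X_simps(4)[OF Z]]
    show "rel Y Z (Id (ob Y 0)) (Id (ob Y (Suc n)))" using o Yc Xc by simp
  next
    assume "rel Y Z (Id (ob Y 0)) (Id (ob Y (Suc n)))"
    from rel_trans[OF r this Xc Yc X_simps(4)[OF Z]]
    show "rel X Z (Id (ob X 0)) (Id (ob X (Suc n)))" using o Yc Xc by simp
  qed
  then show ?thesis using hclass_iff[OF X] hclass_iff[OF Y] o by auto
qed

lemma cl_eqD:
  assumes X: "X \<in> \<X>" and Y: "Y \<in> \<X>" and e: "cl X = cl Y"
  shows "rel X Y (Id (ob X 0)) (Id (ob X (Suc n)))" "ob Y 0 = ob X 0" "ob Y (Suc n) = ob X (Suc n)"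
  using self_mem_cl[OF Y] unfolding e[symmetric] hclass_iff[OF X] by auto

text \<open>A realizing complex is known only through its class. It lies in its own class by way of
  the identity, hence in that of \<open>X\<close>, and all elements of that class are
  members.\<close>

lemma cl_mem_X:
  assumes "X \<in> \<X>" "cl Y = cl X" "Y \<in> cpxs"
  shows "Y \<in> \<X>" "ob Y 0 = ob X 0" "ob Y (Suc n) = ob X (Suc n)"
proof -
  have id: "chm Y Y (\<lambda>i. Id (ob Y i))" by (rule chm_id[OF assms(3)])
  have "homotopic n \<C> Y Y (\<lambda>i. Id (ob Y i) \<cdot> Id (ob Y i)) (\<lambda>i. Id (ob Y i))"
    by (rule homotopic_eq[OF assms(3) chm_comp[OF id id assms(3,3,3)]]) (use assms(3) in simp)
  then have "htpy_equiv_betw n \<C> Y Y"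
    unfolding htpy_equiv_betw_def chain_map_betw_def using id by (intro exI[of _ "\<lambda>i. Id (ob Y i)"]) simp
  then have "Y \<in> cl Y" using assms(3) by (simp add: hclass_def complexes_betw_def)
  then show "Y \<in> \<X>" "ob Y 0 = ob X 0" "ob Y (Suc n) = ob X (Suc n)"
    unfolding assms(2) hclass_iff[OF assms(1)] by auto
qed

text \<open>Evaluates the definite description at any member with suitable end components. A
  competitor may sit over another representative of \<open>cl Y\<close>; it is moved to
  \<open>Y\<close>, factored through \<open>X\<close> by the universal property, and the identities
  at both ends give equal classes.\<close>

lemma pull_eq:
  assumes X: "X \<in> \<X>" and Y: "Y \<in> \<X>" and r: "rel X Y (Id (ob Y 0)) c"
  shows "pull c (cl Y) = cl X"
  unfolding Ext_pull_def
proof (rule the_equality)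
  note Xc = X_simps(4)[OF X] and Yc = X_simps(4)[OF Y]
  note t = rel_type[OF r Xc Yc]
  have o: "ob X 0 = ob Y 0" using t Yc by simp
  obtain f where f: "chm X Y f" "f 0 = Id (ob Y 0)" "f (Suc n) = c" using r by (rule relE)
  have "n_pullback n \<C> X Y f"
    using mcone_exact[OF X Y f(1)] f(2) o pullback_dataI[OF Xc Yc f(1)] n_pullback_iff by (simp add: n_exact_seq_def)
  then show "\<exists>X' Y' f. Y' \<in> cl Y \<and> exseq X' \<and> ob X' 0 = ob Y' 0 \<and>
     chm X' Y' f \<and> f 0 = Id (ob Y' 0) \<and> f (n+1) = c \<and> n_pullback n \<C> X' Y' f \<and> cl X = cl X'"
    using self_mem_cl[OF Y] X_ex[OF X] o f by (intro exI[of _ X] exI[of _ Y] exI[of _ f]) simp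
  fix \<epsilon> assume "\<exists>X' Y' f. Y' \<in> cl Y \<and> exseq X' \<and> ob X' 0 = ob Y' 0 \<and>
     chm X' Y' f \<and> f 0 = Id (ob Y' 0) \<and> f (n+1) = c \<and> n_pullback n \<C> X' Y' f \<and> \<epsilon> = cl X'"
  then obtain X' Y' f where a: "Y' \<in> cl Y" "exseq X'" "ob X' 0 = ob Y' 0" "chm X' Y' f"
    "f 0 = Id (ob Y' 0)" "f (Suc n) = c" "\<epsilon> = cl X'" by auto
  have Y': "Y' \<in> \<X>" "ob Y' 0 = ob Y 0" "ob Y' (Suc n) = ob Y (Suc n)" "rel Y Y' (Id (ob Y 0)) (Id (ob Y (Suc n)))"
    using a(1) hclass_iff[OF Y] by auto
  note Y'c = X_simps(4)[OF Y'(1)]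
  have X'c: "X' \<in> cpxs" using a(2) by simp
  have r': "rel X' Y' (Id (ob Y 0)) c" by (rule relI[OF a(4)]) (use a Y' in simp_all)
  have X': "X' \<in> \<X>" by (rule closed_pull[OF a(2) Y'(1) r']) (use a(3) Y'(2) Yc in \<open>simp add: is_iso_Id\<close>)
  note t' = rel_type[OF r' X'c Y'c]
  have "rel X' Y (Id (ob Y 0) \<cdot> Id (ob Y 0)) (Id (ob Y (Suc n)) \<cdot> c)"
    by (rule rel_trans[OF r' _ X'c Y'c Yc]) (use rel_sym[OF Y Y'(1,4)] Y' in simp)
  then have s: "rel X' Y (Id (ob Y 0)) c" using Yc t by simp
  have "rel X' X (Id (ob Y 0)) (Id (ob X (Suc n)))"
    by (rule rel_pull_universal[OF X Y X'c]) (use r s o t t' Xc in auto)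
  then have "cl X' = cl X" by (intro cl_eq[OF X' X]) (use a(3) Y'(2) t t' in simp)
  then show "\<epsilon> = cl X" using a by simp
qed

lemma push_eq:
  assumes X: "X \<in> \<X>" and Y: "Y \<in> \<X>" and r: "rel X Y a (Id (ob X (Suc n)))"
  shows "push a (cl X) = cl Y"
  unfolding Ext_push_def
proof (rule the_equality)
  note Xc = X_simps(4)[OF X] and Yc = X_simps(4)[OF Y]
  note t = rel_type[OF r Xc Yc]
  have o: "ob Y (Suc n) = ob X (Suc n)" using t Xc by simp
  obtain f where f: "chm X Y f" "f 0 = a" "f (Suc n) = Id (ob X (Suc n))" using r by (rule relE)
  have "n_pushout n \<C> X Y f"
    using mcocone_exact[OF X Y f(1)] f(3) o pushout_dataI[OF Xc Yc f(1)] n_pushout_iff by (simp add: n_exact_seq_def)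
  then show "\<exists>X' Y' f. X' \<in> cl X \<and> exseq Y' \<and> ob Y' (n+1) = ob X' (n+1) \<and>
     chm X' Y' f \<and> f 0 = a \<and> f (n+1) = Id (ob X' (n+1)) \<and> n_pushout n \<C> X' Y' f \<and> cl Y = cl Y'"
    using self_mem_cl[OF X] X_ex[OF Y] o f by (intro exI[of _ X] exI[of _ Y] exI[of _ f]) simp
  fix \<epsilon> assume "\<exists>X' Y' f. X' \<in> cl X \<and> exseq Y' \<and> ob Y' (n+1) = ob X' (n+1) \<and>
     chm X' Y' f \<and> f 0 = a \<and> f (n+1) = Id (ob X' (n+1)) \<and> n_pushout n \<C> X' Y' f \<and> \<epsilon> = cl Y'"
  then obtain X' Y' f where b: "X' \<in> cl X" "exseq Y'" "ob Y' (Suc n) = ob X' (Suc n)" "chm X' Y' f"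
    "f 0 = a" "f (Suc n) = Id (ob X' (Suc n))" "\<epsilon> = cl Y'" by auto
  have X': "X' \<in> \<X>" "ob X' 0 = ob X 0" "ob X' (Suc n) = ob X (Suc n)" "rel X X' (Id (ob X 0)) (Id (ob X (Suc n)))"
    using b(1) hclass_iff[OF X] by auto
  note X'c = X_simps(4)[OF X'(1)]
  have Y'c: "Y' \<in> cpxs" using b(2) by simp
  have r': "rel X' Y' a (Id (ob X (Suc n)))" by (rule relI[OF b(4)]) (use b X' in simp_all)
  have Y': "Y' \<in> \<X>" by (rule closed_push[OF X'(1) b(2) r']) (use b(3) X'(3) Xc in \<open>simp add: is_iso_Id\<close>)
  note t' = rel_type[OF r' X'c Y'c]
  have "rel X Y' (a \<cdot> Id (ob X 0)) (Id (ob X (Suc n)) \<cdot> Id (ob X (Suc n)))"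
    by (rule rel_trans[OF X'(4) r' Xc X'c Y'c])
  then have s: "rel X Y' a (Id (ob X (Suc n)))" using Xc t by simp
  have "rel Y Y' (Id (ob Y 0)) (Id (ob X (Suc n)))"
    by (rule rel_push_universal[OF X Y Y'c]) (use r s o t t' Yc in auto)
  then have "cl Y = cl Y'" by (intro cl_eq[OF Y Y']) (use o in simp)
  then show "\<epsilon> = cl Y" using b by simp
qed

lemma pull_ex:
  assumes Y: "Y \<in> \<X>" and c: "arr c" "cd c = ob Y (Suc n)"
  obtains X where "X \<in> \<X>" "rel X Y (Id (ob Y 0)) c" "ob X 0 = ob Y 0" "ob X (Suc n) = dm c" "pull c (cl Y) = cl X"
proof -
  obtain X q where X: "X \<in> \<X>" "chm X Y q" "q 0 = Id (ob Y 0)" "ob X 0 = ob Y 0"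
    "q (Suc n) = c" "ob X (Suc n) = dm c" using pull_exists[OF Y c] by metis
  have r: "rel X Y (Id (ob Y 0)) c" by (rule relI[OF X(2,3,5)])
  show ?thesis using that[OF X(1) r X(4,6) pull_eq[OF X(1) Y r]] .
qed

text \<open>Obtained by pulling the reversed complex back along \<open>a\<close> in the opposite
  category.\<close>

lemma push_ex:
  assumes X: "X \<in> \<X>" and a: "arr a" "dm a = ob X 0"
  obtains Y where "Y \<in> \<X>" "rel X Y a (Id (ob X (Suc n)))" "ob Y 0 = cd a" "ob Y (Suc n) = ob X (Suc n)" "push a (cl X) = cl Y"
proof -
  have a': "additive_category.arr \<D> a" "additive_category.cd \<D> a = ob (opx n X) (Suc n)" using a by simp_all
  obtain P q where P: "P \<in> opX n \<X>" "chain_map n \<D> P (opx n X) q" "q 0 = Idt \<D> (ob (opx n X) 0)"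
    "ob P 0 = ob (opx n X) 0" "q (Suc n) = a" "ob P (Suc n) = additive_category.dm \<D> a"
    using pullback_category.pull_exists[OF pullback_category_opc mem_opX[OF X] a'] by metis
  have Y: "opx n P \<in> \<X>" using P(1) by (simp add: opX_def)
  have "erel n \<D> P (opx n X) (Id (ob X (Suc n))) a"
    unfolding erel_def using P by (intro exI[of _ q]) simp
  from rel_opx[OF this] have r: "rel X (opx n P) a (Id (ob X (Suc n)))"
    by simp
  show ?thesis using that[OF Y r _ _ push_eq[OF X Y r]] P(4,6) by simp
qed

lemma push_eq_pull:
  assumes X: "X \<in> \<X>" and Y: "Y \<in> \<X>" and r: "rel X Y a c"
  shows "push a (cl X) = pull c (cl Y)"
proof -
  obtain P where P: "P \<in> \<X>" "rel X P a (Id (ob X (Suc n)))" "rel P Y (Id (ob Y 0)) c"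
    using rel_pull_factor[OF Y X_simps(4)[OF X] r] by metis
  show ?thesis using push_eq[OF X P(1,2)] pull_eq[OF P(1) Y P(3)] by simp
qed

text \<open>The chain map runs from \<open>X\<close> to its pushout \<open>P\<close>, on to the
  pullback \<open>Q\<close>, which has the same class, and from there to \<open>Y\<close>. This will
  give (R0).\<close>

lemma rel_of_push_eq_pull:
  assumes X: "X \<in> \<X>" and Y: "Y \<in> \<X>" and a: "arr a" "dm a = ob X 0" "cd a = ob Y 0"
    and c: "arr c" "dm c = ob X (Suc n)" "cd c = ob Y (Suc n)" and e: "push a (cl X) = pull c (cl Y)"
  shows "rel X Y a c"
proof -
  obtain P where P: "P \<in> \<X>" "rel X P a (Id (ob X (Suc n)))" "ob P 0 = cd a" "ob P (Suc n) = ob X (Suc n)"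
    "push a (cl X) = cl P" using push_ex[OF X a(1,2)] by metis
  obtain Q where Q: "Q \<in> \<X>" "rel Q Y (Id (ob Y 0)) c" "ob Q 0 = ob Y 0" "ob Q (Suc n) = dm c" "pull c (cl Y) = cl Q"
    using pull_ex[OF Y c(1,3)] by metis
  have "rel P Q (Id (ob P 0)) (Id (ob P (Suc n)))" by (rule cl_eqD[OF P(1) Q(1)]) (use P Q e in simp)
  from rel_trans[OF P(2) rel_trans[OF this Q(2)]] show ?thesis
    using P Q X Y a c X_simps(4)[OF P(1)] X_simps(4)[OF Q(1)] by simp
qed

end

section \<open>Membership of trivial complexes and direct sums\<close>

context add_cat_n
begin

lemma biprod_mats:
  assumes [simp]: "A \<in> Ob" "B \<in> Ob"
  shows "col A A B (Id A) (Zm A B) = in1 A B" "col B A B (Zm B A) (Id B) = in2 A B"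
    "row A B A (Id A) (Zm B A) = pr1 A B" "row A B B (Zm A B) (Id B) = pr2 A B"
    "col (dsum \<C> A B) A B (pr1 A B) (pr2 A B) = Id (dsum \<C> A B)"
proof -
  show "col A A B (Id A) (Zm A B) = in1 A B" by (rule dsum_ext[of _ _ A B]) simp_all
  show "col B A B (Zm B A) (Id B) = in2 A B" by (rule dsum_ext[of _ _ A B]) simp_all
  show "row A B A (Id A) (Zm B A) = pr1 A B" by (rule dsum_coext[of _ _ A B]) simp_all
  show "row A B B (Zm A B) (Id B) = pr2 A B" by (rule dsum_coext[of _ _ A B]) simp_all
  show "col (dsum \<C> A B) A B (pr1 A B) (pr2 A B) = Id (dsum \<C> A B)"
    by (rule dsum_ext[of _ _ A B]) simp_all
qed

lemma is_iso_inj1: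
  assumes [simp]: "A \<in> Ob" and Z: "is_zero_object \<C> Z"
  shows "is_iso \<C> A (dsum \<C> A Z) (in1 A Z)"
proof -
  note [simp] = zero_objD[OF Z]
  have "pr2 A Z = Zm (dsum \<C> A Z) Z" using zero_unique(1)[OF Z, of "pr2 A Z"] by simp
  then have "in1 A Z \<cdot> pr1 A Z = Id (dsum \<C> A Z)"
    by (intro dsum_ext[of "in1 A Z \<cdot> pr1 A Z" "Id (dsum \<C> A Z)" A Z]) simp_all
  then show ?thesis unfolding is_iso_def by (auto intro!: bexI[of _ "pr1 A Z"])
qed

lemma is_iso_inj2:
  assumes [simp]: "A \<in> Ob" and Z: "is_zero_object \<C> Z"
  shows "is_iso \<C> A (dsum \<C> Z A) (in2 Z A)"
proof -
  note [simp] = zero_objD[OF Z]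
  have "pr1 Z A = Zm (dsum \<C> Z A) Z" using zero_unique(1)[OF Z, of "pr1 Z A"] by simp
  then have "in2 Z A \<cdot> pr2 Z A = Id (dsum \<C> Z A)"
    by (intro dsum_ext[of "in2 Z A \<cdot> pr2 Z A" "Id (dsum \<C> Z A)" Z A]) simp_all
  then show ?thesis unfolding is_iso_def by (auto intro!: bexI[of _ "pr2 Z A"])
qed

lemma rel_inj:
  assumes X: "X \<in> cpxs" and Y: "Y \<in> cpxs"
  shows "rel X (cdsum X Y) (in1 (ob X 0) (ob Y 0)) (in1 (ob X (Suc n)) (ob Y (Suc n)))"
    "rel Y (cdsum X Y) (in2 (ob X 0) (ob Y 0)) (in2 (ob X (Suc n)) (ob Y (Suc n)))"
    "rel (cdsum X Y) X (pr1 (ob X 0) (ob Y 0)) (pr1 (ob X (Suc n)) (ob Y (Suc n)))"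
    "rel (cdsum X Y) Y (pr2 (ob X 0) (ob Y 0)) (pr2 (ob X (Suc n)) (ob Y (Suc n)))"
  using rel_col[OF rel_refl[OF X] rel_zero[OF X Y] X Y X] rel_col[OF rel_zero[OF Y X] rel_refl[OF Y] X Y Y]
    rel_row[OF rel_refl[OF X] rel_zero[OF Y X] X Y X] rel_row[OF rel_zero[OF X Y] rel_refl[OF Y] X Y Y] X Y
  by (simp_all add: biprod_mats)

end

context n_exact_pos
begin

text \<open>The zero complex of (E0) and the trivial complex share the right end term 0, so the zero
  chain map satisfies the hypotheses of \<open>closed_push\<close>.\<close>

lemma triv_left_mem:
  assumes A: "A \<in> Ob" and Z: "is_zero_object \<C> Z"
  shows "triv_left \<C> A Z \<in> \<X>"
proof (rule closed_push[OF E0[OF Z] triv_left_exact[OF A Z] rel_zero])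
  show "zero_cpx \<C> Z \<in> cpxs" using E0[OF Z] by simp
  show "triv_left \<C> A Z \<in> cpxs" using triv_left_exact[OF A Z] by simp
  have "Zm Z Z = Id Z" using zero_unique(1)[OF Z, of "Id Z"] Z by simp
  moreover have "ob (triv_left \<C> A Z) (Suc n) = Z" using n_ge_1 by (simp add: triv_left_def)
  ultimately show "is_iso \<C> (ob (zero_cpx \<C> Z) (Suc n)) (ob (triv_left \<C> A Z) (Suc n))
     (Zm (ob (zero_cpx \<C> Z) (Suc n)) (ob (triv_left \<C> A Z) (Suc n)))"
    using Z by (simp add: zero_cpx_def is_iso_Id)
qed

lemma triv_right_mem:
  assumes A: "A \<in> Ob" and Z: "is_zero_object \<C> Z"
  shows "triv_right n \<C> Z A \<in> \<X>"
proof (rule closed_pull[OF triv_right_exact[OF A Z] E0[OF Z] rel_zero])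
  show "zero_cpx \<C> Z \<in> cpxs" using E0[OF Z] by simp
  show "triv_right n \<C> Z A \<in> cpxs" using triv_right_exact[OF A Z] by simp
  have "Zm Z Z = Id Z" using zero_unique(1)[OF Z, of "Id Z"] Z by simp
  moreover have "ob (triv_right n \<C> Z A) 0 = Z" using n_ge_1 by (simp add: triv_right_def)
  ultimately show "is_iso \<C> (ob (triv_right n \<C> Z A) 0) (ob (zero_cpx \<C> Z) 0)
     (Zm (ob (triv_right n \<C> Z A) 0) (ob (zero_cpx \<C> Z) 0))"
    using Z by (simp add: zero_cpx_def is_iso_Id)
qed

text \<open>\<open>X\<close> plus a trivial complex on \<open>ob Y 0\<close>, and \<open>Y\<close>
  plus one on \<open>ob X 1\<close>, are members by comparison with \<open>X\<close> and
  \<open>Y\<close>. Their first maps compose to the first map of the sum, so by (E1) some member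
  \<open>W\<close> starts with that map; the cokernel property extends the identities in degrees 0
  and 1 to a chain map into \<open>W\<close>, and (EC) applies with \<open>k = 0\<close>.\<close>

lemma cpx_dsum_mem:
  assumes X: "X \<in> \<X>" and Y: "Y \<in> \<X>"
  shows "cdsum X Y \<in> \<X>"
proof -
  note Xc [simp] = X_simps(4)[OF X] and Yc [simp] = X_simps(4)[OF Y]
  obtain Z where Z: "is_zero_object \<C> Z" using zero_object_exists by blast
  note [simp] = zero_objD[OF Z]
  have n0: "0 < n" using n_ge_1 by simp
  let ?S = "triv_left \<C> (ob Y 0) Z" and ?T = "triv_left \<C> (ob X (Suc 0)) Z"
  have S: "exseq ?S" "?S \<in> cpxs" and T: "exseq ?T" "?T \<in> cpxs"
    using triv_left_exact[OF _ Z, of "ob Y 0"] triv_left_exact[OF _ Z, of "ob X (Suc 0)"] by simp_all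
  have obZ: "ob ?S (Suc n) = Z" "ob ?T (Suc n) = Z" using n_ge_1 by (simp_all add: triv_left_def)
  have XS: "cdsum X ?S \<in> \<X>"
    by (rule closed_push[OF X cpx_dsum_exact[OF X_ex[OF X] S(1)] rel_inj(1)[OF Xc S(2)]])
      (simp add: dsum_cpx obZ is_iso_inj1[OF _ Z])
  have TY: "cdsum ?T Y \<in> \<X>"
    by (rule closed_push[OF Y cpx_dsum_exact[OF T(1) X_ex[OF Y]] rel_inj(2)[OF T(2) Yc]])
      (simp add: dsum_cpx obZ is_iso_inj2[OF _ Z])
  let ?D = "cdsum X Y"
  have D: "exseq ?D" using cpx_dsum_exact X Y by simp
  have "df ?D 0 = df (cdsum ?T Y) 0 \<cdot> df (cdsum X ?S) 0"
  proof (rule dsum_ext[of _ _ "ob X 1" "ob Y 1"])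
    show "pr1 (ob X 1) (ob Y 1) \<cdot> df ?D 0 = pr1 (ob X 1) (ob Y 1) \<cdot> (df (cdsum ?T Y) 0 \<cdot> df (cdsum X ?S) 0)"
      by (rule dsum_coext[of _ _ "ob X 0" "ob Y 0"]) (simp_all add: dsum_cpx triv_left_def comp_assoc)
    show "pr2 (ob X 1) (ob Y 1) \<cdot> df ?D 0 = pr2 (ob X 1) (ob Y 1) \<cdot> (df (cdsum ?T Y) 0 \<cdot> df (cdsum X ?S) 0)"
      by (rule dsum_coext[of _ _ "ob X 0" "ob Y 0"]) (simp_all add: dsum_cpx triv_left_def comp_assoc)
  qed (simp_all add: dsum_cpx triv_left_def)
  moreover have am: "admissible_mono \<X> (df (cdsum X ?S) 0)" "admissible_mono \<X> (df (cdsum ?T Y) 0)"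
    unfolding admissible_mono_def using XS TY by blast+
  have "admissible_mono \<X> (df (cdsum ?T Y) 0 \<cdot> df (cdsum X ?S) 0)"
    by (rule E1[OF _ _ _ _ _ am, of "dsum \<C> (ob X 0) (ob Y 0)" "dsum \<C> (ob X 1) (ob Y 0)" "dsum \<C> (ob X 1) (ob Y 1)"])
      (simp_all add: dsum_cpx triv_left_def)
  ultimately obtain W where W: "W \<in> \<X>" "df W 0 = df ?D 0" unfolding admissible_mono_def by metis
  note Wc = X_simps(4)[OF W(1)]
  have Dc: "?D \<in> cpxs" by simp
  have o: "ob W 0 = ob ?D 0" "ob W 1 = ob ?D 1"
    using cpx_simps(3,4)[OF Wc, of 0] cpx_simps(3,4)[OF Dc, of 0] W(2) by simp_all
  have Dob: "ob ?D 0 \<in> Ob" "ob ?D 1 \<in> Ob" using Dc by (simp_all add: dsum_cpx)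
  have Dcok: "cokseq ?D" using D by (simp add: n_exact_seq_def)
  obtain f where f: "chm ?D W f" "f 0 = Id (ob ?D 0)" "f 1 = Id (ob ?D 1)"
    by (rule chm_extend_up[OF Dcok Wc, of "Id (ob ?D 0)" "Id (ob ?D 1)"])
      (use o Dob W Dc Id_comp[of "df ?D 0"] comp_Id[of "df ?D 0"] in \<open>simp_all add: dsum_cpx(1)\<close>)
  have "is_iso \<C> (ob ?D 0) (ob W 0) (f 0) \<and> is_iso \<C> (ob ?D (0+1)) (ob W (0+1)) (f (0+1))"
    using f o is_iso_Id[OF Dob(1)] is_iso_Id[OF Dob(2)] by simp
  then show ?thesis using EC[OF D X_ex[OF W(1)] f(1)] W(1) le0[of n] by blast
qed

section \<open>Functoriality of pullback and pushout of classes\<close>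

lemma EsE:
  assumes "\<delta> \<in> Es C A" obtains X where "X \<in> \<X>" "ob X 0 = A" "ob X (Suc n) = C" "\<delta> = cl X"
  using assms unfolding Ext_set_def by auto

lemma EsI: "X \<in> \<X> \<Longrightarrow> cl X \<in> Es (ob X (Suc n)) (ob X 0)"
  unfolding Ext_set_def by auto

lemma Es_Obj: "\<delta> \<in> Es C A \<Longrightarrow> C \<in> Ob" "\<delta> \<in> Es C A \<Longrightarrow> A \<in> Ob"
  by (auto elim!: EsE)

lemma pull_closed: "\<lbrakk>\<delta> \<in> Es C A; arr c; cd c = C\<rbrakk> \<Longrightarrow> pull c \<delta> \<in> Es (dm c) A"
  by (metis EsE EsI pull_ex)

lemma push_closed: "\<lbrakk>\<delta> \<in> Es C A; arr a; dm a = A\<rbrakk> \<Longrightarrow> push a \<delta> \<in> Es C (cd a)"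
  by (metis EsE EsI push_ex)

lemma pull_Id: "\<delta> \<in> Es C A \<Longrightarrow> pull (Id C) \<delta> = \<delta>"
  by (erule EsE) (metis X_simps(4) pull_eq rel_refl)

lemma push_Id: "\<delta> \<in> Es C A \<Longrightarrow> push (Id A) \<delta> = \<delta>"
  by (erule EsE) (metis X_simps(4) push_eq rel_refl)

lemma pull_comp:
  assumes "\<delta> \<in> Es C A" "arr c" "cd c = C" "arr c'" "cd c' = dm c"
  shows "pull (c \<cdot> c') \<delta> = pull c' (pull c \<delta>)"
proof -
  obtain X where X: "X \<in> \<X>" "ob X 0 = A" "ob X (Suc n) = C" "\<delta> = cl X" using assms(1) by (rule EsE)
  obtain P where P: "P \<in> \<X>" "rel P X (Id (ob X 0)) c" "ob P 0 = ob X 0" "ob P (Suc n) = dm c" "pull c (cl X) = cl P"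
    using pull_ex[OF X(1)] assms X by metis
  obtain Q where Q: "Q \<in> \<X>" "rel Q P (Id (ob P 0)) c'" "ob Q 0 = ob P 0" "ob Q (Suc n) = dm c'" "pull c' (cl P) = cl Q"
    using pull_ex[OF P(1)] assms P by metis
  have "rel Q X (Id (ob X 0)) (c \<cdot> c')"
    using rel_trans[OF Q(2) P(2)] P Q X Es_Obj[OF assms(1)] by simp
  from pull_eq[OF Q(1) X(1) this] show ?thesis using X P Q by simp
qed

lemma push_comp:
  assumes "\<delta> \<in> Es C A" "arr a" "dm a = A" "arr a'" "dm a' = cd a"
  shows "push (a' \<cdot> a) \<delta> = push a' (push a \<delta>)"
proof -
  obtain X where X: "X \<in> \<X>" "ob X 0 = A" "ob X (Suc n) = C" "\<delta> = cl X" using assms(1) by (rule EsE)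
  obtain P where P: "P \<in> \<X>" "rel X P a (Id (ob X (Suc n)))" "ob P 0 = cd a" "ob P (Suc n) = ob X (Suc n)" "push a (cl X) = cl P"
    using push_ex[OF X(1)] assms X by metis
  obtain Q where Q: "Q \<in> \<X>" "rel P Q a' (Id (ob P (Suc n)))" "ob Q 0 = cd a'" "ob Q (Suc n) = ob P (Suc n)" "push a' (cl P) = cl Q"
    using push_ex[OF P(1)] assms P by metis
  have "rel X Q (a' \<cdot> a) (Id (ob X (Suc n)))"
    using rel_trans[OF P(2) Q(2)] P Q X Es_Obj[OF assms(1)] by simp
  from push_eq[OF X(1) Q(1) this] show ?thesis using X P Q by simp
qed

lemma pull_push:
  assumes "\<delta> \<in> Es C A" "arr a" "dm a = A" "arr c" "cd c = C"
  shows "pull c (push a \<delta>) = push a (pull c \<delta>)"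
proof -
  obtain X where X: "X \<in> \<X>" "ob X 0 = A" "ob X (Suc n) = C" "\<delta> = cl X" using assms(1) by (rule EsE)
  obtain P where P: "P \<in> \<X>" "rel X P a (Id (ob X (Suc n)))" "ob P 0 = cd a" "ob P (Suc n) = ob X (Suc n)" "push a (cl X) = cl P"
    using push_ex[OF X(1)] assms X by metis
  obtain Q where Q: "Q \<in> \<X>" "rel Q X (Id (ob X 0)) c" "ob Q 0 = ob X 0" "ob Q (Suc n) = dm c" "pull c (cl X) = cl Q"
    using pull_ex[OF X(1)] assms X by metis
  have "rel Q P a c"
    using rel_trans[OF Q(2) P(2)] P Q X assms by simp
  from push_eq_pull[OF Q(1) P(1) this] show ?thesis using X P Q by simp
qed

text \<open>Independence of representatives: the projections followed by the two comparison maps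
  form a column with identities as end components.\<close>

lemma class_dsum_eq:
  assumes X: "X \<in> \<X>" and Y: "Y \<in> \<X>"
  shows "class_dsum n \<C> (cl X) (cl Y) = cl (cdsum X Y)"
  unfolding class_dsum_def
proof (rule the_equality)
  show "\<exists>X'\<in>cl X. \<exists>Y'\<in>cl Y. cl (cdsum X Y) = cl (cdsum X' Y')"
    using self_mem_cl[OF X] self_mem_cl[OF Y] by blast
  fix \<kappa> assume "\<exists>X'\<in>cl X. \<exists>Y'\<in>cl Y. \<kappa> = cl (cdsum X' Y')"
  then obtain X' Y' where a: "X' \<in> cl X" "Y' \<in> cl Y" "\<kappa> = cl (cdsum X' Y')" by blast
  have X': "X' \<in> \<X>" "ob X' 0 = ob X 0" "ob X' (Suc n) = ob X (Suc n)" "rel X X' (Id (ob X 0)) (Id (ob X (Suc n)))"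
    using a(1) hclass_iff[OF X] by auto
  have Y': "Y' \<in> \<X>" "ob Y' 0 = ob Y 0" "ob Y' (Suc n) = ob Y (Suc n)" "rel Y Y' (Id (ob Y 0)) (Id (ob Y (Suc n)))"
    using a(2) hclass_iff[OF Y] by auto
  note [simp] = X_simps(4)[OF X] X_simps(4)[OF Y] X_simps(4)[OF X'(1)] X_simps(4)[OF Y'(1)]
  note r = rel_inj(3,4)[of X Y]
  have "rel (cdsum X Y) X' (pr1 (ob X 0) (ob Y 0)) (pr1 (ob X (Suc n)) (ob Y (Suc n)))"
    using rel_trans[OF r(1) X'(4)] by simp
  moreover have "rel (cdsum X Y) Y' (pr2 (ob X 0) (ob Y 0)) (pr2 (ob X (Suc n)) (ob Y (Suc n)))"
    using rel_trans[OF r(2) Y'(4)] by simp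
  ultimately have "rel (cdsum X Y) (cdsum X' Y') (Id (ob (cdsum X Y) 0)) (Id (ob (cdsum X Y) (Suc n)))"
    using rel_col[of "cdsum X Y" X' _ _ Y'] X'(2,3) Y'(2,3) by (fastforce simp: dsum_cpx biprod_mats)
  then show "\<kappa> = cl (cdsum X Y)"
    using cl_eq[OF cpx_dsum_mem[OF X Y] cpx_dsum_mem[OF X'(1) Y'(1)]] a(3) by simp
qed

section \<open>The group structure\<close>

abbreviation baer where "baer C A \<delta> \<epsilon> \<equiv> baer_sum n \<C> C A \<delta> \<epsilon>"

text \<open>The column \<open>(u, v)\<close> and the diagonal are the ends of a chain map from
  \<open>Z\<close> to the sum of the two pushouts; followed by the codiagonal, its left end becomes
  \<open>u + v\<close>. The group laws come from here, since by \<open>pair_ex\<close> given classes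
  are pushouts of a common one.\<close>

lemma baer_push:
  assumes \<zeta>: "\<zeta> \<in> Es C D" and u: "arr u" "dm u = D" "cd u = A" and v: "arr v" "dm v = D" "cd v = A"
  shows "baer C A (push u \<zeta>) (push v \<zeta>) = push (u \<oplus> v) \<zeta>"
proof -
  obtain Z where Z: "Z \<in> \<X>" "ob Z 0 = D" "ob Z (Suc n) = C" "\<zeta> = cl Z" using \<zeta> by (rule EsE)
  obtain X where X: "X \<in> \<X>" "rel Z X u (Id C)" "ob X 0 = A" "ob X (Suc n) = C" "push u \<zeta> = cl X"
    using push_ex[OF Z(1) u(1)] u Z by metis
  obtain Y where Y: "Y \<in> \<X>" "rel Z Y v (Id C)" "ob Y 0 = A" "ob Y (Suc n) = C" "push v \<zeta> = cl Y"
    using push_ex[OF Z(1) v(1)] v Z by metis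
  note [simp] = X_simps(4)[OF X(1)] X_simps(4)[OF Y(1)] X_simps(4)[OF Z(1)]
  have [simp]: "A \<in> Ob" "C \<in> Ob" using u Es_Obj[OF \<zeta>] by auto
  let ?D = "cdsum X Y"
  have D: "?D \<in> \<X>" using cpx_dsum_mem[OF X(1) Y(1)] .
  have "arr (codiag_mor \<C> A)" "dm (codiag_mor \<C> A) = ob ?D 0" using X(3) Y(3) by (simp_all add: codiag_mor_def dsum_cpx)
  then obtain P where P: "P \<in> \<X>" "rel ?D P (codiag_mor \<C> A) (Id (ob ?D (Suc n)))" "ob P 0 = cd (codiag_mor \<C> A)"
     "ob P (Suc n) = ob ?D (Suc n)" "push (codiag_mor \<C> A) (cl ?D) = cl P"
    using push_ex[OF D] by metis
  note [simp] = X_simps(4)[OF P(1)]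
  have "rel Z ?D (col D A A u v) (diag_mor \<C> C)"
    using rel_col[OF X(2) Y(2)] X(3,4) Y(3,4) Z(2,3) by (simp add: diag_mor_def)
  from rel_trans[OF this P(2)] have "rel Z P (codiag_mor \<C> A \<cdot> col D A A u v) (diag_mor \<C> C)"
    using X Y by (simp add: dsum_cpx diag_mor_def)
  moreover have "codiag_mor \<C> A \<cdot> col D A A u v = u \<oplus> v" using u v by (simp add: codiag_mor_def row_comp)
  ultimately have "push (u \<oplus> v) (cl Z) = pull (diag_mor \<C> C) (cl P)" using push_eq_pull[OF Z(1) P(1)] by simp
  then show ?thesis unfolding baer_sum_def using X(5) Y(5) Z(4) P(5) class_dsum_eq[OF X(1) Y(1)] by simp
qed

text \<open>The codiagonal and the row \<open>(u, v)\<close> are the ends of a chain map out of the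
  sum of the two pullbacks; the row composed with the diagonal is \<open>u + v\<close>. This is
  additivity in the first variable.\<close>

lemma baer_pull:
  assumes \<zeta>: "\<zeta> \<in> Es D A" and u: "arr u" "cd u = D" "dm u = C" and v: "arr v" "cd v = D" "dm v = C"
  shows "baer C A (pull u \<zeta>) (pull v \<zeta>) = pull (u \<oplus> v) \<zeta>"
proof -
  obtain Z where Z: "Z \<in> \<X>" "ob Z 0 = A" "ob Z (Suc n) = D" "\<zeta> = cl Z" using \<zeta> by (rule EsE)
  obtain X where X: "X \<in> \<X>" "rel X Z (Id A) u" "ob X 0 = A" "ob X (Suc n) = C" "pull u \<zeta> = cl X"
    using pull_ex[OF Z(1) u(1)] u Z by metis
  obtain Y where Y: "Y \<in> \<X>" "rel Y Z (Id A) v" "ob Y 0 = A" "ob Y (Suc n) = C" "pull v \<zeta> = cl Y"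
    using pull_ex[OF Z(1) v(1)] v Z by metis
  note [simp] = X_simps(4)[OF X(1)] X_simps(4)[OF Y(1)] X_simps(4)[OF Z(1)]
  have [simp]: "A \<in> Ob" "C \<in> Ob" "D \<in> Ob" using u Es_Obj[OF \<zeta>] by auto
  let ?D = "cdsum X Y"
  have D: "?D \<in> \<X>" using cpx_dsum_mem[OF X(1) Y(1)] .
  have "rel ?D Z (codiag_mor \<C> A) (row C C D u v)"
    using rel_row[OF X(2) Y(2)] X(3,4) Y(3,4) Z(2,3) by (simp add: codiag_mor_def)
  then have "push (codiag_mor \<C> A) (cl ?D) = pull (row C C D u v) \<zeta>" using push_eq_pull[OF D Z(1)] Z(4) by simp
  then have "baer C A (pull u \<zeta>) (pull v \<zeta>) = pull (diag_mor \<C> C) (pull (row C C D u v) \<zeta>)"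
    unfolding baer_sum_def using X(5) Y(5) class_dsum_eq[OF X(1) Y(1)] by simp
  also have "\<dots> = pull (row C C D u v \<cdot> diag_mor \<C> C) \<zeta>"
    by (rule pull_comp[OF \<zeta>, symmetric]) (use u v in \<open>simp_all add: diag_mor_def\<close>)
  also have "row C C D u v \<cdot> diag_mor \<C> C = u \<oplus> v" using u v by (simp add: diag_mor_def row_comp)
  finally show ?thesis .
qed

text \<open>The class is that of the sum of the two extensions, pulled back along the diagonal. This
  is the surjectivity half of the decomposition of extensions by a biproduct.\<close>

lemma pair_ex:
  assumes \<delta>: "\<delta> \<in> Es C A" and \<epsilon>: "\<epsilon> \<in> Es C B"
  obtains \<zeta> where "\<zeta> \<in> Es C (dsum \<C> A B)" "push (pr1 A B) \<zeta> = \<delta>" "push (pr2 A B) \<zeta> = \<epsilon>"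
proof -
  obtain X where X: "X \<in> \<X>" "ob X 0 = A" "ob X (Suc n) = C" "\<delta> = cl X" using \<delta> by (rule EsE)
  obtain Y where Y: "Y \<in> \<X>" "ob Y 0 = B" "ob Y (Suc n) = C" "\<epsilon> = cl Y" using \<epsilon> by (rule EsE)
  note [simp] = X_simps(4)[OF X(1)] X_simps(4)[OF Y(1)]
  have [simp]: "A \<in> Ob" "B \<in> Ob" "C \<in> Ob" using Es_Obj[OF \<delta>] Es_Obj[OF \<epsilon>] by auto
  let ?D = "cdsum X Y"
  have D: "?D \<in> \<X>" using cpx_dsum_mem[OF X(1) Y(1)] .
  have obD: "ob ?D 0 = dsum \<C> A B" "ob ?D (Suc n) = dsum \<C> C C" using X Y by (simp_all add: dsum_cpx)
  obtain P where P: "P \<in> \<X>" "rel P ?D (Id (ob ?D 0)) (diag_mor \<C> C)" "ob P 0 = ob ?D 0" "ob P (Suc n) = dm (diag_mor \<C> C)"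
    by (rule pull_ex[OF D, of "diag_mor \<C> C"]) (simp_all add: diag_mor_def obD)
  note [simp] = X_simps(4)[OF P(1)]
  have Pn: "ob P (Suc n) = C" using P(4) by (simp add: diag_mor_def)
  have "rel P X (pr1 A B) (Id C)" "rel P Y (pr2 A B) (Id C)"
    using rel_trans[OF P(2) rel_inj(3)[of X Y]] rel_trans[OF P(2) rel_inj(4)[of X Y]] X Y obD by (simp_all add: diag_mor_def)
  then have "push (pr1 A B) (cl P) = \<delta>" "push (pr2 A B) (cl P) = \<epsilon>"
    using push_eq[OF P(1) X(1)] push_eq[OF P(1) Y(1)] Pn X(4) Y(4) by simp_all
  then show ?thesis using that EsI[OF P(1)] Pn P(3) obD by simp
qed

end

context add_cat_n
begin

lemma rel_diff:
  assumes r: "rel X Y a c" and s: "rel X Y a' c'" and X: "X \<in> cpxs" and Y: "Y \<in> cpxs"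
  shows "rel X Y (a \<oplus> neg a') (c \<oplus> neg c')"
proof -
  obtain f where f: "chm X Y f" "f 0 = a" "f (Suc n) = c" using r by (rule relE)
  obtain g where g: "chm X Y g" "g 0 = a'" "g (Suc n) = c'" using s by (rule relE)
  show ?thesis by (rule relI[OF chm_diff[OF f(1) g(1) X Y]]) (simp_all add: f g)
qed

text \<open>The splitting makes \<open>1, df X 0 \<cdot> s, 0, 0\<close> and so on a chain map.
  Subtracted from the identity it leaves one with left end zero and right end the identity.\<close>

lemma rel_split:
  assumes X: "X \<in> cpxs" and s: "arr s" "dm s = ob X 1" "cd s = ob X 0" "s \<cdot> df X 0 = Id (ob X 0)"
  shows "rel X X (Id (ob X 0)) (Zm (ob X (Suc n)) (ob X (Suc n)))"
proof -
  note [simp] = X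
  let ?k = "\<lambda>i. if i = 0 then Id (ob X 0) else if i = 1 then df X 0 \<cdot> s else Zm (ob X i) (ob X i)"
  have "chm X X ?k"
  proof (rule chmI[OF X X])
    fix i assume i: "i \<le> n"
    consider "i = 0" | "i = 1" | j where "i = Suc (Suc j)" by (metis One_nat_def not0_implies_Suc)
    then show "?k (Suc i) \<cdot> df X i = df X i \<cdot> ?k i"
    proof cases
      case 1 then show ?thesis using s i by (simp add: comp_assoc)
    next
      case 2 then show ?thesis using s i n_pos by simp
    next
      case 3 then show ?thesis using i by simp
    qed
  qed (use s in auto)
  then show ?thesis by (rule relI) (use n_pos in simp_all)
qed

end

context n_exact_pos
begin

abbreviation zeroE where "zeroE C A \<equiv> \<one>\<^bsub>Ext_group n \<C> \<X> C A\<^esub>"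

lemma Ext_simps [simp]: "carrier (EG C A) = Es C A"
  "x \<otimes>\<^bsub>EG C A\<^esub> y = baer C A x y"
  by (simp_all add: Ext_group_def)

lemma baer_pair:
  assumes \<delta>: "\<delta> \<in> Es C A" and \<epsilon>: "\<epsilon> \<in> Es C A"
  obtains \<zeta> where "\<zeta> \<in> Es C (dsum \<C> A A)" "push (pr1 A A) \<zeta> = \<delta>" "push (pr2 A A) \<zeta> = \<epsilon>"
    "baer C A \<delta> \<epsilon> = push (pr1 A A \<oplus> pr2 A A) \<zeta>"
proof -
  obtain \<zeta> where \<zeta>: "\<zeta> \<in> Es C (dsum \<C> A A)" "push (pr1 A A) \<zeta> = \<delta>" "push (pr2 A A) \<zeta> = \<epsilon>"
    using pair_ex[OF assms] by metis
  have "A \<in> Ob" using Es_Obj[OF \<delta>] by simp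
  then show ?thesis using that[OF \<zeta>] baer_push[OF \<zeta>(1), of "pr1 A A" A "pr2 A A"] \<zeta> by simp
qed

lemma baer_closed: "\<lbrakk>\<delta> \<in> Es C A; \<epsilon> \<in> Es C A\<rbrakk> \<Longrightarrow> baer C A \<delta> \<epsilon> \<in> Es C A"
  by (erule (1) baer_pair) (use Es_Obj push_closed[of _ C "dsum \<C> A A" "pr1 A A \<oplus> pr2 A A"] in simp)

text \<open>Both classes are pushouts of one class over \<open>dsum \<C> A A\<close>, along zero
  after either projection, and these two composites are the same zero morphism.\<close>

lemma push_zero_eq:
  assumes \<delta>: "\<delta> \<in> Es C A" and \<epsilon>: "\<epsilon> \<in> Es C A" and B: "B \<in> Ob"
  shows "push (Zm A B) \<delta> = push (Zm A B) \<epsilon>"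
proof -
  obtain \<zeta> where \<zeta>: "\<zeta> \<in> Es C (dsum \<C> A A)" "push (pr1 A A) \<zeta> = \<delta>" "push (pr2 A A) \<zeta> = \<epsilon>"
    using pair_ex[OF \<delta> \<epsilon>] by metis
  have A: "A \<in> Ob" using Es_Obj[OF \<delta>] by simp
  show ?thesis
    using push_comp[OF \<zeta>(1), of "pr1 A A" "Zm A B"] push_comp[OF \<zeta>(1), of "pr2 A A" "Zm A B"] \<zeta> A B by simp
qed

lemma baer_zero:
  assumes \<delta>: "\<delta> \<in> Es C A" and \<epsilon>: "\<epsilon> \<in> Es C A"
  shows "baer C A (push (Zm A A) \<delta>) \<epsilon> = \<epsilon>" "baer C A \<epsilon> (push (Zm A A) \<delta>) = \<epsilon>"
proof -
  have A: "A \<in> Ob" using Es_Obj[OF \<delta>] by simp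
  show "baer C A (push (Zm A A) \<delta>) \<epsilon> = \<epsilon>"
    using baer_push[OF \<epsilon>, of "Zm A A" A "Id A"] push_Id[OF \<epsilon>] push_zero_eq[OF \<delta> \<epsilon> A] A by simp
  show "baer C A \<epsilon> (push (Zm A A) \<delta>) = \<epsilon>"
    using baer_push[OF \<epsilon>, of "Id A" A "Zm A A"] push_Id[OF \<epsilon>] push_zero_eq[OF \<delta> \<epsilon> A] A by simp
qed

text \<open>The unit is a definite description. As \<open>0 + 1 = 1\<close> among endomorphisms of
  \<open>A\<close>, the pushout of any class along zero is neutral, and a neutral element is
  unique.\<close>

lemma zeroE_eq:
  assumes \<delta>: "\<delta> \<in> Es C A" shows "zeroE C A = push (Zm A A) \<delta>"
proof -
  have A: "A \<in> Ob" using Es_Obj[OF \<delta>] by simp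
  have z: "push (Zm A A) \<delta> \<in> Es C A" using push_closed[OF \<delta>, of "Zm A A"] A by simp
  have "(THE e. e \<in> Es C A \<and> (\<forall>\<delta>\<in>Es C A. baer C A e \<delta> = \<delta> \<and> baer C A \<delta> e = \<delta>)) = push (Zm A A) \<delta>"
  proof (rule the_equality)
    show "push (Zm A A) \<delta> \<in> Es C A \<and> (\<forall>\<epsilon>\<in>Es C A. baer C A (push (Zm A A) \<delta>) \<epsilon> = \<epsilon> \<and> baer C A \<epsilon> (push (Zm A A) \<delta>) = \<epsilon>)"
      using z baer_zero[OF \<delta>] by blast
    fix e assume e: "e \<in> Es C A \<and> (\<forall>\<delta>\<in>Es C A. baer C A e \<delta> = \<delta> \<and> baer C A \<delta> e = \<delta>)"
    then have "baer C A e (push (Zm A A) \<delta>) = push (Zm A A) \<delta>" using z by blast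
    then show "e = push (Zm A A) \<delta>" using baer_zero(2)[OF \<delta>, of e] e by simp
  qed
  then show ?thesis by (simp add: Ext_group_def)
qed

lemma Es_nonempty:
  assumes "C \<in> Ob" "A \<in> Ob" obtains \<delta> where "\<delta> \<in> Es C A"
proof -
  obtain Z where Z: "is_zero_object \<C> Z" using zero_object_exists by blast
  have "ob (triv_left \<C> A Z) 0 = A" "ob (triv_left \<C> A Z) (Suc n) = Z" using n_ge_1 by (simp_all add: triv_left_def)
  then have "cl (triv_left \<C> A Z) \<in> Es Z A" using EsI[OF triv_left_mem[OF assms(2) Z]] by simp
  \<comment> \<open>The trivial complex ends in a zero object; pulling it back along the zero
    morphism from \<open>C\<close> produces the required end terms.\<close>
  then have "pull (Zm C Z) (cl (triv_left \<C> A Z)) \<in> Es C A"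
    using pull_closed[of _ Z A "Zm C Z"] assms Z by simp
  then show ?thesis by (rule that)
qed

lemma baer_assoc:
  assumes x: "x \<in> Es C A" and y: "y \<in> Es C A" and z: "z \<in> Es C A"
  shows "baer C A (baer C A x y) z = baer C A x (baer C A y z)"
proof -
  have [simp]: "A \<in> Ob" using Es_Obj[OF x] by simp
  let ?S = "dsum \<C> A A"
  obtain \<zeta> where \<zeta>: "\<zeta> \<in> Es C ?S" "push (pr1 A A) \<zeta> = x" "push (pr2 A A) \<zeta> = y"
    using pair_ex[OF x y] by metis
  obtain w where w: "w \<in> Es C (dsum \<C> ?S A)" "push (pr1 ?S A) w = \<zeta>" "push (pr2 ?S A) w = z"
    using pair_ex[OF \<zeta>(1) z] by metis
  \<comment> \<open>The three projections of the iterated sum: all three classes are pushouts of the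
    single class \<open>w\<close>, and associativity becomes that of adding \<open>q1\<close>,
    \<open>q2\<close> and \<open>q3\<close>.\<close>
  define q1 where "q1 = pr1 A A \<cdot> pr1 ?S A"
  define q2 where "q2 = pr2 A A \<cdot> pr1 ?S A"
  define q3 where "q3 = pr2 ?S A"
  have q [simp]: "arr q1" "dm q1 = dsum \<C> ?S A" "cd q1 = A" "arr q2" "dm q2 = dsum \<C> ?S A" "cd q2 = A"
    "arr q3" "dm q3 = dsum \<C> ?S A" "cd q3 = A"
    by (simp_all add: q1_def q2_def q3_def)
  have e: "x = push q1 w" "y = push q2 w" "z = push q3 w"
    using push_comp[OF w(1), of "pr1 ?S A" "pr1 A A"] push_comp[OF w(1), of "pr1 ?S A" "pr2 A A"] \<zeta> w
    by (simp_all add: q1_def q2_def q3_def)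
  show ?thesis unfolding e by (simp add: baer_push[OF w(1)] add_assoc)
qed

lemma Ext_comm_group:
  assumes C: "C \<in> Ob" and A: "A \<in> Ob"
  shows "comm_group (EG C A)"
proof (rule comm_groupI)
  obtain \<delta> where \<delta>: "\<delta> \<in> Es C A" using Es_nonempty[OF C A] .
  show one: "zeroE C A \<in> carrier (EG C A)" using zeroE_eq[OF \<delta>] push_closed[OF \<delta>, of "Zm A A"] A by simp
  fix x assume "x \<in> carrier (EG C A)"
  then have x: "x \<in> Es C A" by simp
  show "zeroE C A \<otimes>\<^bsub>EG C A\<^esub> x = x" using baer_zero(1)[OF \<delta> x] zeroE_eq[OF \<delta>] by simp
  \<comment> \<open>The inverse is the pushout along minus the identity.\<close>
  show "\<exists>y\<in>carrier (EG C A). y \<otimes>\<^bsub>EG C A\<^esub> x = zeroE C A"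
    using baer_push[OF x, of "neg (Id A)" A "Id A"] push_Id[OF x] push_closed[OF x, of "neg (Id A)"] A zeroE_eq[OF x]
    by (intro bexI[of _ "push (neg (Id A)) x"]) simp_all
  fix y assume "y \<in> carrier (EG C A)"
  then have y: "y \<in> Es C A" by simp
  show "x \<otimes>\<^bsub>EG C A\<^esub> y \<in> carrier (EG C A)" using baer_closed[OF x y] by simp
  obtain \<zeta> where \<zeta>: "\<zeta> \<in> Es C (dsum \<C> A A)" "push (pr1 A A) \<zeta> = x" "push (pr2 A A) \<zeta> = y"
    using pair_ex[OF x y] by metis
  have "baer C A x y = baer C A y x"
    using baer_push[OF \<zeta>(1), of "pr1 A A" A "pr2 A A"] baer_push[OF \<zeta>(1), of "pr2 A A" A "pr1 A A"]
      add_comm[of "pr1 A A" "pr2 A A"] \<zeta> A by simp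
  then show "x \<otimes>\<^bsub>EG C A\<^esub> y = y \<otimes>\<^bsub>EG C A\<^esub> x" by simp
  fix z assume "z \<in> carrier (EG C A)"
  then show "x \<otimes>\<^bsub>EG C A\<^esub> y \<otimes>\<^bsub>EG C A\<^esub> z =
       x \<otimes>\<^bsub>EG C A\<^esub> (y \<otimes>\<^bsub>EG C A\<^esub> z)"
    using baer_assoc[OF x y] by simp
qed

text \<open>Both arguments lift to one class over \<open>dsum \<C> A A\<close>; as pullback commutes
  with pushout, additivity reduces to that of composition with \<open>a\<close>.\<close>

lemma Ext_map_hom:
  assumes c: "arr c" "cd c = C" and a: "arr a" "dm a = A"
  shows "Em c a \<in> hom (EG C A) (EG (dm c) (cd a))"
proof (rule homI)
  have [simp]: "A \<in> Ob" using a by auto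
  fix x assume "x \<in> carrier (EG C A)"
  then have x: "x \<in> Es C A" by simp
  show "Em c a x \<in> carrier (EG (dm c) (cd a))"
    using push_closed[OF pull_closed[OF x c] a] by (simp add: Ext_map_def)
  fix y assume "y \<in> carrier (EG C A)"
  then have y: "y \<in> Es C A" by simp
  obtain \<zeta> where \<zeta>: "\<zeta> \<in> Es C (dsum \<C> A A)" "push (pr1 A A) \<zeta> = x" "push (pr2 A A) \<zeta> = y"
    "baer C A x y = push (pr1 A A \<oplus> pr2 A A) \<zeta>" using baer_pair[OF x y] .
  note \<zeta>' = pull_closed[OF \<zeta>(1) c]
  have e: "Em c a (push p \<zeta>) = push (a \<cdot> p) (pull c \<zeta>)" if "arr p" "dm p = dsum \<C> A A" "cd p = A" for p
    using pull_push[OF \<zeta>(1) that(1,2) c] push_comp[OF \<zeta>' that(1,2) a(1)] a that by (simp add: Ext_map_def)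
  have "Em c a (baer C A x y) = push (a \<cdot> pr1 A A \<oplus> a \<cdot> pr2 A A) (pull c \<zeta>)"
    using e[of "pr1 A A \<oplus> pr2 A A"] \<zeta>(4) a by (simp add: comp_add)
  also have "\<dots> = baer (dm c) (cd a) (push (a \<cdot> pr1 A A) (pull c \<zeta>)) (push (a \<cdot> pr2 A A) (pull c \<zeta>))"
    by (rule baer_push[OF \<zeta>', symmetric]) (use a in simp_all)
  also have "\<dots> = baer (dm c) (cd a) (Em c a x) (Em c a y)"
    using e[of "pr1 A A"] e[of "pr2 A A"] \<zeta>(2,3) by simp
  finally show "Em c a (x \<otimes>\<^bsub>EG C A\<^esub> y) =
      Em c a x \<otimes>\<^bsub>EG (dm c) (cd a)\<^esub> Em c a y" by simp
qed

lemma Ext_map_pull: "\<lbrakk>\<delta> \<in> Es C A; arr c; cd c = C\<rbrakk> \<Longrightarrow> Em c (Id A) \<delta> = pull c \<delta>"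
  using push_Id[OF pull_closed] by (simp add: Ext_map_def)

lemma Ext_map_push: "\<delta> \<in> Es C A \<Longrightarrow> Em (Id C) a \<delta> = push a \<delta>"
  using pull_Id by (simp add: Ext_map_def)

lemma Ext_biadditive: "biadditive_functor \<C> (EG) (Em)"
proof (rule biadditive_functor.intro[OF additive_category_axioms], rule biadditive_functor_axioms.intro)
  show "comm_group (EG C A)" if "C \<in> Ob" "A \<in> Ob" for C A
    using Ext_comm_group[OF that] .
  show "Em c a \<in> hom (EG C A) (EG C' A')"
    if "C \<in> Ob" "C' \<in> Ob" "A \<in> Ob" "A' \<in> Ob" "c \<in> Mor \<C> C' C" "a \<in> Mor \<C> A A'" for C C' A A' c a
    using Ext_map_hom[of c C a A] that by auto
  show "Em (Id C) (Id A) \<delta> = \<delta>"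
    if "C \<in> Ob" "A \<in> Ob" "\<delta> \<in> carrier (EG C A)" for C A \<delta>
    using that Ext_map_push[of \<delta> C A "Id A"] push_Id by simp
  show "Em (c \<cdot> c') (a' \<cdot> a) \<delta> = Em c' a' (Em c a \<delta>)"
    if "C \<in> Ob" "C' \<in> Ob" "C'' \<in> Ob" "A \<in> Ob" "A' \<in> Ob" "A'' \<in> Ob"
        "c \<in> Mor \<C> C' C" "c' \<in> Mor \<C> C'' C'" "a \<in> Mor \<C> A A'" "a' \<in> Mor \<C> A' A''"
        "\<delta> \<in> carrier (EG C A)" for C C' C'' A A' A'' c c' a a' \<delta>
  proof -
    have \<delta>: "\<delta> \<in> Es C A" and c: "arr c" "cd c = C" "arr c'" "cd c' = dm c" and a: "arr a" "dm a = A" "arr a'" "dm a' = cd a"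
      using that by auto
    show ?thesis unfolding Ext_map_def
      using pull_comp[OF \<delta> c] push_comp[OF pull_closed[OF pull_closed[OF \<delta> c(1,2)] c(3,4)] a]
        pull_push[OF pull_closed[OF \<delta> c(1,2)] a(1,2) c(3,4)] by simp
  qed
  show "Em (c \<otimes>\<^bsub>Hom \<C> C' C\<^esub> d) (Id A) \<delta> =
        Em c (Id A) \<delta> \<otimes>\<^bsub>EG C' A\<^esub> Em d (Id A) \<delta>"
    if "C \<in> Ob" "C' \<in> Ob" "A \<in> Ob" "c \<in> Mor \<C> C' C" "d \<in> Mor \<C> C' C"
        "\<delta> \<in> carrier (EG C A)" for C C' A c d \<delta>
    using that baer_pull[of \<delta> C A c C' d] Ext_map_pull[of \<delta> C A] by simp
  show "Em (Id C) (a \<otimes>\<^bsub>Hom \<C> A A'\<^esub> b) \<delta> =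
        Em (Id C) a \<delta> \<otimes>\<^bsub>EG C A'\<^esub> Em (Id C) b \<delta>"
    if "C \<in> Ob" "A \<in> Ob" "A' \<in> Ob" "a \<in> Mor \<C> A A'" "b \<in> Mor \<C> A A'"
        "\<delta> \<in> carrier (EG C A)" for C A A' a b \<delta>
    using that baer_push[of \<delta> C A a A' b] Ext_map_push[of \<delta> C A] by simp
qed

text \<open>Being zero means being one's own pushout along zero, that is, admitting an endomorphism
  with ends 0 and 1. Its difference from the identity has ends 1 and 0, and the exchange of ends
  turns the trivial lift of 0 into a splitting; \<open>rel_split\<close> leads back.\<close>

lemma cl_zero_iff:
  assumes Q: "Q \<in> \<X>"
  shows "cl Q = zeroE (ob Q (Suc n)) (ob Q 0) \<longleftrightarrow> (\<exists>s. arr s \<and> dm s = ob Q 1 \<and> cd s = ob Q 0 \<and> Id (ob Q 0) = s \<cdot> df Q 0)"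
    (is "_ \<longleftrightarrow> ?R")
proof
  note Qc [simp] = X_simps(4)[OF Q]
  have Qo [simp]: "ob Q 0 \<in> Ob" "ob Q (Suc n) \<in> Ob" by simp_all
  note z = zeroE_eq[OF EsI[OF Q]]
  {
    assume "cl Q = zeroE (ob Q (Suc n)) (ob Q 0)"
    then have "push (Zm (ob Q 0) (ob Q 0)) (cl Q) = pull (Id (ob Q (Suc n))) (cl Q)"
      using z pull_Id[OF EsI[OF Q]] by simp
    then have "rel Q Q (Zm (ob Q 0) (ob Q 0)) (Id (ob Q (Suc n)))" by (intro rel_of_push_eq_pull[OF Q Q]) simp_all
    from rel_diff[OF rel_refl[OF Qc] this Qc Qc]
    have "rel Q Q (Id (ob Q 0)) (Zm (ob Q (Suc n)) (ob Q (Suc n)))" by simp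
    from factor_down[OF X_simps(2)[OF Q] Qc this, of "Zm (ob Q (Suc n)) (ob Q n)"] show ?R by simp
  next
    assume ?R
    then obtain s where s: "arr s" "dm s = ob Q 1" "cd s = ob Q 0" "s \<cdot> df Q 0 = Id (ob Q 0)" by metis
    from rel_diff[OF rel_refl[OF Qc] rel_split[OF Qc s] Qc Qc]
    have "rel Q Q (Zm (ob Q 0) (ob Q 0)) (Id (ob Q (Suc n)))" by simp
    from push_eq[OF Q Q this] show "cl Q = zeroE (ob Q (Suc n)) (ob Q 0)" using z by simp
  }
qed

text \<open>The splitting criterion is applied to the pullback \<open>Q\<close>; the exchange of
  ends along the map from \<open>Q\<close> to \<open>X\<close> converts a splitting of its first map
  into a lift of \<open>f\<close>. This is the exactness involving the connecting map in the first
  variable.\<close>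

lemma pull_zero_iff:
  assumes X: "X \<in> \<X>" and f: "arr f" "cd f = ob X (Suc n)"
  shows "pull f (cl X) = zeroE (dm f) (ob X 0) \<longleftrightarrow> (\<exists>t. arr t \<and> dm t = dm f \<and> cd t = ob X n \<and> f = df X n \<cdot> t)"
proof -
  obtain Q where Q: "Q \<in> \<X>" "rel Q X (Id (ob X 0)) f" "ob Q 0 = ob X 0" "ob Q (Suc n) = dm f" "pull f (cl X) = cl Q"
    using pull_ex[OF X f] by metis
  have "(\<exists>s. arr s \<and> dm s = ob Q 1 \<and> cd s = ob Q 0 \<and> Id (ob Q 0) = s \<cdot> df Q 0) \<longleftrightarrow>
      (\<exists>t. arr t \<and> dm t = dm f \<and> cd t = ob X n \<and> f = df X n \<cdot> t)"
    using factor_up[OF X_simps(3)[OF Q(1)] X_simps(4)[OF X] Q(2)]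
      factor_down[OF X_simps(2)[OF X] X_simps(4)[OF Q(1)] Q(2)] Q(3,4) by auto
  then show ?thesis using cl_zero_iff[OF Q(1)] Q by simp
qed

lemma push_zero_iff:
  assumes X: "X \<in> \<X>" and f: "arr f" "dm f = ob X 0"
  shows "push f (cl X) = zeroE (ob X (Suc n)) (cd f) \<longleftrightarrow> (\<exists>s. arr s \<and> dm s = ob X 1 \<and> cd s = cd f \<and> f = s \<cdot> df X 0)"
proof -
  obtain P where P: "P \<in> \<X>" "rel X P f (Id (ob X (Suc n)))" "ob P 0 = cd f" "ob P (Suc n) = ob X (Suc n)" "push f (cl X) = cl P"
    using push_ex[OF X f] by metis
  note Pc = X_simps(4)[OF P(1)]
  have "(\<exists>s. arr s \<and> dm s = ob X 1 \<and> cd s = cd f \<and> f = s \<cdot> df X 0) \<longleftrightarrow>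
      (\<exists>t. arr t \<and> dm t = ob X (Suc n) \<and> cd t = ob P n \<and> Id (ob X (Suc n)) = df P n \<cdot> t)"
    using factor_up[OF X_simps(3)[OF X] Pc P(2)]
      factor_down[OF X_simps(2)[OF P(1)] X_simps(4)[OF X] P(2)] P(3,4) by auto
  moreover have "(\<exists>s. arr s \<and> dm s = ob P 1 \<and> cd s = ob P 0 \<and> Id (ob P 0) = s \<cdot> df P 0) \<longleftrightarrow>
      (\<exists>t. arr t \<and> dm t = ob X (Suc n) \<and> cd t = ob P n \<and> Id (ob X (Suc n)) = df P n \<cdot> t)"
    using factor_up[OF X_simps(3)[OF P(1)] Pc rel_refl[OF Pc]]
      factor_down[OF X_simps(2)[OF P(1)] Pc rel_refl[OF Pc]] P(4) by auto
  ultimately show ?thesis using cl_zero_iff[OF P(1)] P by simp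
qed

section \<open>The \<open>n\<close>-exangulated structure\<close>

lemma n_exangle_cl:
  assumes X: "X \<in> \<X>" shows "n_exangle n \<C> (EG) (Em) X (cl X)"
proof -
  note Xc [simp] = X_simps(4)[OF X]
  have \<delta>: "cl X \<in> Es (ob X (Suc n)) (ob X 0)" by (rule EsI[OF X])
  have 1: "exact_at (Hom \<C> W (ob X n)) (Hom \<C> W (ob X (n+1))) (EG W (ob X 0))
                 (\<lambda>f. df X n \<cdot> f) (\<lambda>f. Em f (Id (ob X 0)) (cl X))" if W [simp]: "W \<in> Ob" for W
    unfolding exact_at_def
  proof (intro equalityI subsetI)
    fix f assume "f \<in> (\<lambda>f. df X n \<cdot> f) ` Mor \<C> W (ob X n)"
    then obtain t where "t \<in> Mor \<C> W (ob X n)" and f: "f = df X n \<cdot> t" by blast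
    then have t: "arr t" "dm t = W" "cd t = ob X n" by simp_all
    have ft: "arr f" "dm f = W" "cd f = ob X (Suc n)" using t f by simp_all
    have "pull f (cl X) = zeroE (dm f) (ob X 0)" using pull_zero_iff[OF X ft(1,3)] t f ft by auto
    then show "f \<in> kernel (Hom \<C> W (ob X (n+1))) (EG W (ob X 0)) (\<lambda>f. Em f (Id (ob X 0)) (cl X))"
      unfolding kernel_def using ft Ext_map_pull[OF \<delta> ft(1,3)] by simp
  next
    fix f assume "f \<in> kernel (Hom \<C> W (ob X (n+1))) (EG W (ob X 0)) (\<lambda>f. Em f (Id (ob X 0)) (cl X))"
    then have ft: "arr f" "dm f = W" "cd f = ob X (Suc n)" and z: "Em f (Id (ob X 0)) (cl X) = zeroE W (ob X 0)"
      unfolding kernel_def by simp_all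
    then obtain t where "arr t" "dm t = dm f" "cd t = ob X n" "f = df X n \<cdot> t"
      using pull_zero_iff[OF X ft(1,3)] Ext_map_pull[OF \<delta> ft(1,3)] by auto
    then show "f \<in> (\<lambda>f. df X n \<cdot> f) ` Mor \<C> W (ob X n)" using ft by (intro image_eqI[of _ _ t]) simp_all
  qed
  have 2: "exact_at (Hom \<C> (ob X 1) W) (Hom \<C> (ob X 0) W) (EG (ob X (n+1)) W)
                 (\<lambda>f. f \<cdot> df X 0) (\<lambda>f. Em (Id (ob X (n+1))) f (cl X))" if W [simp]: "W \<in> Ob" for W
    unfolding exact_at_def
  proof (intro equalityI subsetI)
    fix f assume "f \<in> (\<lambda>f. f \<cdot> df X 0) ` Mor \<C> (ob X 1) W"
    then obtain t where "t \<in> Mor \<C> (ob X 1) W" and f: "f = t \<cdot> df X 0" by blast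
    then have t: "arr t" "cd t = W" "dm t = ob X 1" by simp_all
    have ft: "arr f" "cd f = W" "dm f = ob X 0" using t f by simp_all
    have "push f (cl X) = zeroE (ob X (Suc n)) (cd f)" using push_zero_iff[OF X ft(1,3)] t f ft by auto
    then show "f \<in> kernel (Hom \<C> (ob X 0) W) (EG (ob X (n+1)) W) (\<lambda>f. Em (Id (ob X (n+1))) f (cl X))"
      unfolding kernel_def using ft Ext_map_push[OF \<delta>] by simp
  next
    fix f assume "f \<in> kernel (Hom \<C> (ob X 0) W) (EG (ob X (n+1)) W) (\<lambda>f. Em (Id (ob X (n+1))) f (cl X))"
    then have ft: "arr f" "cd f = W" "dm f = ob X 0" and z: "Em (Id (ob X (Suc n))) f (cl X) = zeroE (ob X (Suc n)) W"
      unfolding kernel_def by simp_all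
    then obtain t where "arr t" "dm t = ob X 1" "cd t = cd f" "f = t \<cdot> df X 0"
      using push_zero_iff[OF X ft(1,3)] Ext_map_push[OF \<delta>] by auto
    then show "f \<in> (\<lambda>f. f \<cdot> df X 0) ` Mor \<C> (ob X 1) W" using ft by (intro image_eqI[of _ _ t]) simp_all
  qed
  show ?thesis unfolding n_exangle_def
    using 1 2 X_simps(2,3)[OF X] \<delta> unfolding n_kernel_seq_def n_cokernel_seq_def by simp
qed

text \<open>The realization is the identity on classes, so the hypothesis says that \<delta> is the
  class of \<open>X\<close>; membership of \<open>X\<close> in \<X> is a consequence.\<close>

lemma realized:
  assumes "\<delta> \<in> carrier (EG C A)" "X \<in> cpxs" "Ext_real C A \<delta> = hclass n \<C> X"
  shows "X \<in> \<X>" "\<delta> = cl X" "ob X 0 = A" "ob X (Suc n) = C"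
proof -
  show d: "\<delta> = cl X" using assms by (simp add: Ext_real_def)
  obtain Y where Y: "Y \<in> \<X>" "ob Y 0 = A" "ob Y (Suc n) = C" "\<delta> = cl Y" using assms(1) by (auto elim: EsE)
  show "X \<in> \<X>" "ob X 0 = A" "ob X (Suc n) = C" using cl_mem_X[OF Y(1) _ assms(2)] d Y by auto
qed

lemma distinguished_iff: "distinguished n \<C> (EG) Ext_real X \<delta> \<longleftrightarrow> X \<in> \<X> \<and> \<delta> = cl X"
proof
  assume "distinguished n \<C> (EG) Ext_real X \<delta>"
  then show "X \<in> \<X> \<and> \<delta> = cl X" unfolding distinguished_def by (meson realized(1,2))
next
  assume "X \<in> \<X> \<and> \<delta> = cl X"
  then show "distinguished n \<C> (EG) Ext_real X \<delta>"
    unfolding distinguished_def using EsI[of X] by (simp add: Ext_real_def)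
qed

lemma Ext_exact_realization: "exact_realization n \<C> (EG) (Em) Ext_real"
proof (rule exact_realization.intro[OF Ext_biadditive], rule exact_realization_axioms.intro)
  show "\<exists>X \<in> complexes_betw n \<C> A C. Ext_real C A \<delta> = hclass n \<C> X"
    if "C \<in> Ob" "A \<in> Ob" "\<delta> \<in> carrier (EG C A)" for C A \<delta>
  proof -
    from that have "\<delta> \<in> Es C A" by simp
    then obtain X where "X \<in> \<X>" "ob X 0 = A" "ob X (Suc n) = C" "\<delta> = cl X" by (rule EsE)
    then show ?thesis by (intro bexI[of _ X]) (simp_all add: Ext_real_def complexes_betw_def)
  qed
  show "\<exists>f. chm X Y f \<and> f 0 = a \<and> f (n+1) = c"
    if o: "A \<in> Ob" "B \<in> Ob" "C \<in> Ob" "D \<in> Ob"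
      and \<delta>: "\<delta> \<in> carrier (EG C A)" and \<rho>: "\<rho> \<in> carrier (EG D B)"
      and X: "X \<in> complexes_betw n \<C> A C" "Ext_real C A \<delta> = hclass n \<C> X"
      and Y: "Y \<in> complexes_betw n \<C> B D" "Ext_real D B \<rho> = hclass n \<C> Y"
      and a: "a \<in> Mor \<C> A B" and c: "c \<in> Mor \<C> C D"
      and e: "Em (Id C) a \<delta> = Em c (Id B) \<rho>" for A B C D \<delta> \<rho> X Y a c
  proof -
    have Xc: "X \<in> cpxs" and Yc: "Y \<in> cpxs" using X Y by (auto simp: complexes_betw_def)
    note X' = realized[OF \<delta> Xc X(2)] and Y' = realized[OF \<rho> Yc Y(2)]
    have "push a (cl X) = pull c (cl Y)"
      using e Ext_map_push[of \<delta> C A a] Ext_map_pull[of \<rho> D B c] \<delta> \<rho> c o X'(2) Y'(2) by simp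
    then have "rel X Y a c" by (intro rel_of_push_eq_pull[OF X'(1) Y'(1)]) (use a c o X' Y' in simp_all)
    then show ?thesis unfolding erel_def .
  qed
  show "n_exangle n \<C> (EG) (Em) X \<delta>"
    if "C \<in> Ob" "A \<in> Ob" "\<delta> \<in> carrier (EG C A)"
      "X \<in> complexes_betw n \<C> A C" "Ext_real C A \<delta> = hclass n \<C> X" for C A \<delta> X
  proof -
    have "X \<in> cpxs" using that by (auto simp: complexes_betw_def)
    from realized[OF that(3) this that(5)] n_exangle_cl[of X] show ?thesis by simp
  qed
  show "Ext_real Z A (zeroE Z A) = hclass n \<C> (triv_left \<C> A Z)" if A: "A \<in> Ob" and Z: "is_zero_object \<C> Z" for A Z
  proof -
    have "ob (triv_left \<C> A Z) (Suc n) = Z" using n_ge_1 by (simp add: triv_left_def)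
    then show ?thesis
      using cl_zero_iff[OF triv_left_mem[OF A Z]] A by (auto simp: Ext_real_def triv_left_simps intro!: exI[of _ "Id A"])
  qed
  show "Ext_real A Z (zeroE A Z) = hclass n \<C> (triv_right n \<C> Z A)" if A: "A \<in> Ob" and Z: "is_zero_object \<C> Z" for A Z
  proof -
    let ?T = "triv_right n \<C> Z A"
    have T: "?T \<in> \<X>" by (rule triv_right_mem[OF A Z])
    note Tc = X_simps(4)[OF T]
    have o: "ob ?T (Suc n) = A" "ob ?T 0 = Z" using n_ge_1 by (simp_all add: triv_right_def)
    \<comment> \<open>On the zero object the identity is zero, so a zero morphism already splits the
      first map.\<close>
    have "Id Z = Zm Z Z" using zero_unique(1)[OF Z, of "Id Z"] Z by simp
    then have "Id (ob ?T 0) = Zm (ob ?T 1) Z \<cdot> df ?T 0" using o Tc Z by simp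
    then have "cl ?T = zeroE (ob ?T (Suc n)) (ob ?T 0)"
      unfolding cl_zero_iff[OF T] using o Tc Z by (intro exI[of _ "Zm (ob ?T 1) Z"]) simp
    then show ?thesis using o by (simp add: Ext_real_def)
  qed
qed

lemma inflation_iff: "inflation n \<C> (EG) Ext_real f \<longleftrightarrow> admissible_mono \<X> f"
  and deflation_iff: "deflation n \<C> (EG) Ext_real f \<longleftrightarrow> admissible_epi n \<X> f"
  by (auto simp: inflation_def deflation_def admissible_mono_def admissible_epi_def distinguished_iff)

lemma Ext_n_exangulated: "n_exangulated_category n \<C> (EG) (Em) Ext_real"
proof (rule n_exangulated_category.intro[OF Ext_exact_realization], rule n_exangulated_category_axioms.intro)
  show "inflation n \<C> (EG) Ext_real (g \<cdot> f)"
    if "A \<in> Ob" "B \<in> Ob" "D \<in> Ob" "f \<in> Mor \<C> A B" "g \<in> Mor \<C> B D"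
        "inflation n \<C> (EG) Ext_real f" "inflation n \<C> (EG) Ext_real g" for A B D f g
    using E1[OF that(1-5)] that(6,7) unfolding inflation_iff by blast
  show "deflation n \<C> (EG) Ext_real (g \<cdot> f)"
    if "A \<in> Ob" "B \<in> Ob" "D \<in> Ob" "f \<in> Mor \<C> A B" "g \<in> Mor \<C> B D"
        "deflation n \<C> (EG) Ext_real f" "deflation n \<C> (EG) Ext_real g" for A B D f g
    using E1_op[OF that(1-5)] that(6,7) unfolding deflation_iff by blast
  show "\<exists>f. chm X Y f \<and> f 0 = Id A \<and> f (n+1) = c \<and>
          distinguished n \<C> (EG) Ext_real (cone X Y f) (Em (Id D) (df X 0) \<rho>)"
    if o: "A \<in> Ob" "C \<in> Ob" "D \<in> Ob" and \<rho>: "\<rho> \<in> carrier (EG D A)" and c: "c \<in> Mor \<C> C D"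
      and X: "X \<in> complexes_betw n \<C> A C" "distinguished n \<C> (EG) Ext_real X (Em c (Id A) \<rho>)"
      and Y: "Y \<in> complexes_betw n \<C> A D" "distinguished n \<C> (EG) Ext_real Y \<rho>" for A C D \<rho> c X Y
  proof -
    have X': "X \<in> \<X>" "ob X 0 = A" "ob X (Suc n) = C" "Em c (Id A) \<rho> = cl X"
      and Y': "Y \<in> \<X>" "ob Y 0 = A" "ob Y (Suc n) = D" "\<rho> = cl Y"
      using X Y by (auto simp: complexes_betw_def distinguished_iff)
    have ct: "arr c" "dm c = C" "cd c = D" using c o by auto
    have "pull c (cl Y) = cl X" using X'(4) Y'(4) Ext_map_pull[of \<rho> D A c] \<rho> ct by simp
    then have "push (Id A) (cl X) = pull c (cl Y)" using push_Id[OF EsI[OF X'(1)]] X' by simp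
    then have "rel X Y (Id A) c" by (intro rel_of_push_eq_pull[OF X'(1) Y'(1)]) (use ct o X' Y' in simp_all)
    \<comment> \<open>Any lift works: the cone is a member for every chain map with left end
      identity, and the inclusion of \<open>Y\<close> shows that it represents the pushout along
      \<open>df X 0\<close>.\<close>
    then obtain f where f: "chm X Y f" "f 0 = Id A" "f (Suc n) = c" by (rule relE)
    have f0: "f 0 = Id (ob X 0)" using f X' by simp
    have "Em (Id D) (df X 0) \<rho> = cl (cone X Y f)"
      using Ext_map_push[of \<rho> D A "df X 0"] \<rho> Y' push_eq[OF Y'(1) mcone_mem[OF X'(1) Y'(1) f(1) f0]] by simp
    then show ?thesis using f mcone_mem(1)[OF X'(1) Y'(1) f(1) f0] by (intro exI[of _ f]) (simp add: distinguished_iff)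
  qed
  show "\<exists>h. chm X Y h \<and> h 0 = a \<and> h (n+1) = Id C \<and>
          distinguished n \<C> (EG) Ext_real (cocone X Y h) (Em (df Y n) (Id A) \<delta>)"
    if o: "A \<in> Ob" "B \<in> Ob" "C \<in> Ob" and \<delta>: "\<delta> \<in> carrier (EG C A)" and a: "a \<in> Mor \<C> A B"
      and X: "X \<in> complexes_betw n \<C> A C" "distinguished n \<C> (EG) Ext_real X \<delta>"
      and Y: "Y \<in> complexes_betw n \<C> B C" "distinguished n \<C> (EG) Ext_real Y (Em (Id C) a \<delta>)"
    for A B C \<delta> a X Y
  proof -
    have X': "X \<in> \<X>" "ob X 0 = A" "ob X (Suc n) = C" "\<delta> = cl X"
      and Y': "Y \<in> \<X>" "ob Y 0 = B" "ob Y (Suc n) = C" "Em (Id C) a \<delta> = cl Y"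
      using X Y by (auto simp: complexes_betw_def distinguished_iff)
    have at: "arr a" "dm a = A" "cd a = B" using a o by auto
    have "push a (cl X) = cl Y" using X'(4) Y'(4) Ext_map_push[of \<delta> C A a] \<delta> by simp
    then have "push a (cl X) = pull (Id C) (cl Y)" using pull_Id[OF EsI[OF Y'(1)]] Y' by simp
    then have "rel X Y a (Id C)" by (intro rel_of_push_eq_pull[OF X'(1) Y'(1)]) (use at o X' Y' in simp_all)
    \<comment> \<open>Again any lift works; the projection of the cocone to \<open>X\<close>
      exhibits the pullback along \<open>df Y n\<close>.\<close>
    then obtain h where h: "chm X Y h" "h 0 = a" "h (Suc n) = Id C" by (rule relE)
    have h1: "h (Suc n) = Id (ob X (Suc n))" using h X' by simp
    have d: "arr (df Y n)" "cd (df Y n) = C" using X_simps(4)[OF Y'(1)] Y' by simp_all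
    have "Em (df Y n) (Id A) \<delta> = cl (cocone X Y h)"
      using Ext_map_pull[of \<delta> C A "df Y n"] \<delta> d X' pull_eq[OF mcocone_mem(1)[OF X'(1) Y'(1) h(1) h1] X'(1) mcocone_mem(2)[OF X'(1) Y'(1) h(1) h1]] by simp
    then show ?thesis using h mcocone_mem(1)[OF X'(1) Y'(1) h(1) h1] by (intro exI[of _ h]) (simp add: distinguished_iff)
  qed
qed

end

theorem proposition4p34:
  fixes n :: nat and \<C> :: "('o, 'm) precat" and \<X> :: "('o, 'm) cpx set"
  assumes "n \<ge> 1" and "n_exact_category n \<C> \<X>"
  shows "n_exangulated_category n \<C> (Ext_group n \<C> \<X>) (Ext_map n \<C>) Ext_real"
proof -
  interpret n_exact_pos n \<C> \<X>
    using assms by (simp add: n_exact_pos_def n_exact_pos_axioms_def)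
  show ?thesis by (rule Ext_n_exangulated)
qed

end
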